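(* Let $\mathcal{B}\subseteq\mathbb{N}$ be non-empty. (a) If $\mathcal{B}$ is primitive, then $$\operatorname{supp}(\nu_\eta)\subseteq X_\eta\subseteq X_\varphi=\overline{[\varphi_{W'},\varphi]}.$$ (b) If $\mathcal{B}$ is taut, then these inclusions are identities, i.e. $\operatorname{supp}(\nu_\eta)=X_\eta=X_\varphi=\overline{[\varphi_{W'},\varphi]}$.
   Context: $\mathbb{N}=\{1,2,\dots\}$. A set $\mathcal{B}\subseteq\mathbb{N}$ is primitive if there are no distinct $b,b'\in\mathcal{B}$ with $b\mid b'$. For $\mathcal{A}\subseteq\mathbb{N}$ let $\mathcal{M}_{\mathcal{A}}:=\bigcup_{a\in\mathcal{A}}a\mathbb{Z}$, and for $M\subseteq\mathbb{Z}$ let $\underline d(M):=\liminf_{N\to\infty}N^{-1}\operatorname{card}(M\cap[1,N])$. The set $\mathcal{B}$ is taut if $\underline d(\mathcal{M}_{\mathcal{B}\setminus\{b\}})<\underline d(\mathcal{M}_{\mathcal{B}})$ for all $b\in\mathcal{B}$. Let $\Delta:\mathbb{Z}\to\prod_{b\in\mathcal{B}}\mathbb{Z}/b\mathbb{Z}$, $\Delta(n)=(n,n,\dots)$, be the canonical diagonal embedding (the product carries the product topology of discrete finite groups), let $H:=\overline{\Delta(\mathbb{Z})}$, a compact abelian group, and let $m_H$ be its normalised Haar measure. The window is $W:=\{h\in H: h_b\neq 0\ \text{for all } b\in\mathcal{B}\}$, and $W':=\overline{\operatorname{int}(W)}$ (interior and closure in $H$). For $A\subseteq H$ the coding function $\varphi_A:H\to\{0,1\}^{\mathbb{Z}}$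 is defined by $\varphi_A(h)(n)=1$ if and only if $h+\Delta(n)\in A$; write $\varphi:=\varphi_W$. Let $\eta:=\varphi(\Delta(0))$ (the characteristic function of $\mathbb{Z}\setminus\mathcal{M}_{\mathcal{B}}$), $X_\eta:=\overline{\varphi(\Delta(\mathbb{Z}))}$ (the orbit closure of $\eta$ under the left shift), and $X_\varphi:=\overline{\varphi(H)}$. The Mirsky measure is $\nu_\eta:=m_H\circ\varphi^{-1}$, a Borel probability measure on $X_\varphi$, and $\operatorname{supp}(\nu_\eta)$ is its topological support. With $\leqslant$ the coordinatewise order, $[\varphi_{W'},\varphi]:=\{x\in\{0,1\}^{\mathbb{Z}}:\exists h\in H\text{ such that }\varphi_{W'}(h)\leqslant x\leqslant\varphi(h)\}$. *)

theory Defs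
  imports "HOL-Analysis.Analysis" "HOL-Algebra.Elementary_Groups" "HOL-Algebra.Product_Groups"
begin

definition primitive_set :: "nat set \<Rightarrow> bool" where
  "primitive_set B \<longleftrightarrow> (\<forall>b\<in>B. \<forall>b'\<in>B. b \<noteq> b' \<longrightarrow> \<not> b dvd b')"

definition multiples :: "nat set \<Rightarrow> int set" where
  "multiples A = (\<Union>a\<in>A. range (\<lambda>k. int a * k))"

definition lower_density :: "int set \<Rightarrow> ereal" where
  "lower_density M = liminf (\<lambda>N. ereal (real (card (M \<inter> {1..int N})) / real N))"

definition taut :: "nat set \<Rightarrow> bool" where
  "taut B \<longleftrightarrow>
     (\<forall>b\<in>B. lower_density (multiples (B - {b})) < lower_density (multiples B))"

(* For b > 0 the carrier of integer_mod_group b is {0..<int b}, so the elements of the product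
   are the extensional functions h on B with h b in {0..<int b}. *)

definition prodG :: "nat set \<Rightarrow> (nat \<Rightarrow> int) monoid" where
  "prodG B = product_group B integer_mod_group"

definition prodT :: "nat set \<Rightarrow> (nat \<Rightarrow> int) topology" where
  "prodT B = product_topology (\<lambda>b. discrete_topology (carrier (integer_mod_group b))) B"

definition diag :: "nat set \<Rightarrow> int \<Rightarrow> nat \<Rightarrow> int" where
  "diag B n = (\<lambda>b\<in>B. n mod int b)"

definition H :: "nat set \<Rightarrow> (nat \<Rightarrow> int) set" where
  "H B = prodT B closure_of range (diag B)"

definition HT :: "nat set \<Rightarrow> (nat \<Rightarrow> int) topology" where
  "HT B = subtopology (prodT B) (H B)"

(* Since H B is compact and metrizable, every Borel probability measure on it is regular;
   so the normalised Haar measure is the translation-invariant Borel probability measure. *)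

definition normalised_haar :: "nat set \<Rightarrow> (nat \<Rightarrow> int) measure \<Rightarrow> bool" where
  "normalised_haar B m \<longleftrightarrow>
     space m = H B \<and>
     sets m = sigma_sets (H B) {U. openin (HT B) U} \<and>
     emeasure m (H B) = 1 \<and>
     (\<forall>h\<in>H B. \<forall>A\<in>sets m. emeasure m ((\<lambda>x. h \<otimes>\<^bsub>prodG B\<^esub> x) ` A) = emeasure m A)"

definition window :: "nat set \<Rightarrow> (nat \<Rightarrow> int) set" where
  "window B = {h \<in> H B. \<forall>b\<in>B. h b \<noteq> 0}"

definition window' :: "nat set \<Rightarrow> (nat \<Rightarrow> int) set" where
  "window' B = HT B closure_of (HT B interior_of window B)"

(* The shift space is int => bool, with False and True for 0 and 1. Its topology and its order
   are the type class instances: the product of discrete topologies, the coordinatewise order. *)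

definition coding :: "nat set \<Rightarrow> (nat \<Rightarrow> int) set \<Rightarrow> (nat \<Rightarrow> int) \<Rightarrow> int \<Rightarrow> bool" where
  "coding B A h = (\<lambda>n. h \<otimes>\<^bsub>prodG B\<^esub> diag B n \<in> A)"

definition X_eta :: "nat set \<Rightarrow> (int \<Rightarrow> bool) set" where
  "X_eta B = closure (range (\<lambda>n. coding B (window B) (diag B n)))"

definition X_phi :: "nat set \<Rightarrow> (int \<Rightarrow> bool) set" where
  "X_phi B = closure (coding B (window B) ` H B)"

definition mirsky :: "nat set \<Rightarrow> (nat \<Rightarrow> int) measure \<Rightarrow> (int \<Rightarrow> bool) measure" where
  "mirsky B m = distr m borel (coding B (window B))"

definition topological_support :: "'a::topological_space measure \<Rightarrow> 'a set" where
  "topological_support \<nu> = {x. \<forall>U. open U \<longrightarrow> x \<in> U \<longrightarrow> emeasure \<nu> U > 0}"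

definition coding_interval :: "nat set \<Rightarrow> (int \<Rightarrow> bool) set" where
  "coding_interval B =
     {x. \<exists>h\<in>H B. coding B (window' B) h \<le> x \<and> x \<le> coding B (window B) h}"

end

theory Submission
  imports Defs "HOL-Number_Theory.Cong"
begin

text \<open>
  A basic open set of the shift space sees only finitely many positions \<open>k\<close>, so every claim is
  about finite patterns. For \<open>h\<close> in \<open>H B\<close> a position \<open>k\<close> is \<^emph>\<open>hit\<close> if \<open>b\<close> divides \<open>h b + k\<close> for some
  \<open>b \<in> B\<close>, and \<^emph>\<open>free\<close> otherwise; the code of \<open>h\<close> is 1 at the free positions. Being hit is an
  open condition with a single witness \<open>b\<close>. Being free is only closed, it involves all of \<open>B\<close>,
  and all difficulties come from it.

  A condition on finitely many coordinates of \<open>h\<close> has as Haar measure the natural density of the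
  integers that satisfy it (\<open>haar_depends_on\<close>), and the measure of a pattern is a limit of such
  densities. This turns the theorem into arithmetic of sets of multiples.

  \<^emph>\<open>The support lies in \<open>X_eta\<close>.\<close> A pattern of positive measure gives, for each finite
  \<open>F \<subseteq> B\<close>, a density of at least \<open>c > 0\<close> of integers with the right hit positions whose free
  positions avoid the multiples of \<open>F\<close>. To find one that avoids the multiples of \<open>B\<close>, the set
  \<open>multiples B - multiples F\<close> has to be thin. The Davenport--Erdos theorem (\<open>davenport_erdos\<close>) says
  that it is, along a subsequence: the lower density of \<open>multiples B\<close> is the supremum of the densities
  of \<open>multiples F\<close>. Its proof gives the integer \<open>n\<close> a weight proportional to \<open>n powr (- s)\<close>. The
  weight of a set closed under multiplication grows as \<open>s\<close> decreases to 1
  (\<open>zeta_on_ratio_antimono\<close>), so for finite \<open>F\<close> it is bounded by its limit, the density, for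
  every \<open>s\<close>; this uniform bound passes to infinite sets, and partial summation compares it with the
  lower density.

  \<^emph>\<open>If \<open>B\<close> is taut, \<open>X_phi\<close> lies in the support.\<close> Given \<open>h\<close> and a finite range of positions, one finds a residue
  class in which at least half of the integers keep the free positions of \<open>h\<close> free
  (\<open>taut_pattern_density\<close>). Modulo a large number, each free position looks like \<open>g * w\<close> with a
  fixed \<open>g\<close> that is not a multiple of \<open>B\<close> and with \<open>w\<close> without small primes, and
  \<open>b\<close> divides it only if \<open>b div gcd b g\<close> divides \<open>w\<close>. Tautness implies that those quotients
  which have no small primes cover an arbitrarily small density (\<open>taut_gcd_quotient_small\<close>), by a
  zero-one law for the tail of a set of multiples. As the density can be made smaller than the reciprocal
  of the number of positions, a union bound over the positions suffices.

  \<^emph>\<open>The interval lies in \<open>X_phi\<close>.\<close> Where \<open>x\<close> is 0 although \<open>h\<close> is free, the translate of \<open>h\<close> lies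
  outside the closure of the interior of the window. This yields \<open>b \<in> B\<close> for which the factor
  \<open>gcd b g\<close> already divides the position, while the cofactor \<open>b div gcd b g\<close> avoids any given primes
  (\<open>not_in_window'_ex_cofactor\<close>). Changing \<open>h\<close> modulo these cofactors only, one hits the desired
  positions and, since the primes involved are larger than all differences of positions, no free one
  (\<open>interval_pattern_realised\<close>).
\<close>

section \<open>Natural density of periodic sets\<close>

definition periodic_mod :: "int \<Rightarrow> int set \<Rightarrow> bool" where
  "periodic_mod L X \<longleftrightarrow> L > 0 \<and> (\<forall>n n'. L dvd n - n' \<longrightarrow> n \<in> X \<longrightarrow> n' \<in> X)"

definition periodic :: "int set \<Rightarrow> bool" where
  "periodic X \<longleftrightarrow> (\<exists>L. periodic_mod L X)"

definition dens :: "int set \<Rightarrow> real" where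
  "dens X = lim (\<lambda>N. real (card (X \<inter> {1..int N})) / real N)"

lemma periodic_modD:
  assumes "periodic_mod L X" "L dvd n - n'"
  shows "n \<in> X \<longleftrightarrow> n' \<in> X"
  using assms unfolding periodic_mod_def by (metis dvd_minus_iff minus_diff_eq)

lemma periodic_modI:
  assumes "L > 0" "\<And>n n'. L dvd n - n' \<Longrightarrow> n \<in> X \<Longrightarrow> n' \<in> X"
  shows "periodic_mod L X"
  using assms unfolding periodic_mod_def by blast

lemma periodic_mod_imp_periodic: "periodic_mod L X \<Longrightarrow> periodic X"
  unfolding periodic_def by blast

lemma periodic_mod_dvd:
  assumes "periodic_mod L X" "L dvd L'" "L' > 0"
  shows "periodic_mod L' X"
  using assms unfolding periodic_mod_def by (meson dvd_trans)

lemma periodic_common: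
  assumes "periodic X" "periodic Y"
  obtains L where "periodic_mod L X" "periodic_mod L Y"
proof -
  obtain L1 L2 where L: "periodic_mod L1 X" "periodic_mod L2 Y"
    using assms unfolding periodic_def by blast
  then have "L1 * L2 > 0" by (auto simp: periodic_mod_def)
  then show thesis
    using that[of "L1 * L2"] periodic_mod_dvd[OF L(1), of "L1 * L2"] periodic_mod_dvd[OF L(2), of "L1 * L2"]
    by simp
qed

lemma periodic_Un [intro]: "periodic X \<Longrightarrow> periodic Y \<Longrightarrow> periodic (X \<union> Y)"
  by (erule (1) periodic_common, unfold periodic_def periodic_mod_def) blast

lemma periodic_Int [intro]: "periodic X \<Longrightarrow> periodic Y \<Longrightarrow> periodic (X \<inter> Y)"
  by (erule (1) periodic_common, unfold periodic_def periodic_mod_def) blast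

lemma periodic_Diff [intro]: "periodic X \<Longrightarrow> periodic Y \<Longrightarrow> periodic (X - Y)"
  apply (erule (1) periodic_common)
  subgoal for L
    unfolding periodic_def
    by (rule exI[of _ L], rule periodic_modI) (auto simp: periodic_modD periodic_mod_def[of L X])
  done

lemma periodic_UNIV [intro, simp]: "periodic UNIV"
  unfolding periodic_def periodic_mod_def by (auto intro: exI[of _ 1])

lemma periodic_empty [intro, simp]: "periodic {}"
  unfolding periodic_def periodic_mod_def by (auto intro: exI[of _ 1])

lemma periodic_UNION:
  "finite I \<Longrightarrow> (\<And>i. i \<in> I \<Longrightarrow> periodic (X i)) \<Longrightarrow> periodic (\<Union>i\<in>I. X i)"
  by (induction I rule: finite_induct) auto

lemma periodic_INTER:
  "finite I \<Longrightarrow> (\<And>i. i \<in> I \<Longrightarrow> periodic (X i)) \<Longrightarrow> periodic (\<Inter>i\<in>I. X i)"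
  by (induction I rule: finite_induct) auto

lemma periodic_mod_shift:
  assumes "periodic_mod L X"
  shows "periodic_mod L {n. n + k \<in> X}"
proof (rule periodic_modI)
  show "L > 0" using assms by (simp add: periodic_mod_def)
  fix n n' assume "L dvd n - n'" "n \<in> {n. n + k \<in> X}"
  then show "n' \<in> {n. n + k \<in> X}"
    using periodic_modD[OF assms, of "n + k" "n' + k"] by simp
qed

lemma periodic_shift: "periodic X \<Longrightarrow> periodic {n. n + k \<in> X}"
  unfolding periodic_def using periodic_mod_shift by blast

lemma periodic_mod_residue:
  assumes "q > 0"
  shows "periodic_mod q {n. q dvd n - a}"
proof (rule periodic_modI[OF assms])
  fix n n' assume "q dvd n - n'" "n \<in> {n. q dvd n - a}"
  then have "q dvd (n - a) - (n - n')" using dvd_diff[of q "n - a" "n - n'"] by simp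
  then show "n' \<in> {n. q dvd n - a}" by simp
qed

text \<open>
  Reduction modulo \<open>L\<close> maps any window of length \<open>L\<close> bijectively to the standard one.
\<close>
lemma card_period:
  assumes X: "periodic_mod L X"
  shows "card (X \<inter> {a + 1..a + L}) = card (X \<inter> {0..<L})"
proof -
  have L: "L > 0" using X by (simp add: periodic_mod_def)
  have inj: "inj_on (\<lambda>n. n mod L) {a + 1..a + L}"
  proof (rule inj_onI)
    fix x y assume xy: "x \<in> {a + 1..a + L}" "y \<in> {a + 1..a + L}" "x mod L = y mod L"
    then have "L dvd x - y" by (simp add: mod_eq_dvd_iff)
    moreover have "\<bar>x - y\<bar> < L" using xy by auto
    ultimately show "x = y" using zdvd_not_zless[of "\<bar>x - y\<bar>" L] by (cases "x = y") auto
  qed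
  have sub: "(\<lambda>n. n mod L) ` {a + 1..a + L} \<subseteq> {0..<L}" using L by auto
  have im: "(\<lambda>n. n mod L) ` {a + 1..a + L} = {0..<L}"
    by (rule card_subset_eq) (use sub card_image[OF inj] L in auto)
  have mem: "n mod L \<in> X \<longleftrightarrow> n \<in> X" for n
    by (rule periodic_modD[OF X]) (simp add: mod_eq_dvd_iff[symmetric])
  have "(\<lambda>n. n mod L) ` (X \<inter> {a + 1..a + L}) = X \<inter> {0..<L}"
  proof (intro equalityI subsetI)
    fix y assume "y \<in> (\<lambda>n. n mod L) ` (X \<inter> {a + 1..a + L})"
    then obtain x where "x \<in> X" "y = x mod L" by blast
    then show "y \<in> X \<inter> {0..<L}" using mem[of x] L by simp
  next
    fix y assume y: "y \<in> X \<inter> {0..<L}"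
    then have "y \<in> (\<lambda>n. n mod L) ` {a + 1..a + L}" unfolding im by blast
    then obtain x where x: "x \<in> {a + 1..a + L}" "y = x mod L" by blast
    then have "x \<in> X" using y mem[of x] by blast
    then show "y \<in> (\<lambda>n. n mod L) ` (X \<inter> {a + 1..a + L})" using x by blast
  qed
  then show ?thesis
    using card_image[OF inj_on_subset[OF inj, of "X \<inter> {a + 1..a + L}"]] by simp
qed

lemma periodic_count_bound:
  assumes X: "periodic_mod L X"
  shows "\<bar>real (card (X \<inter> {1..int N})) - real (card (X \<inter> {0..<L})) / of_int L * real N\<bar> \<le> of_int L"
proof (induction N rule: less_induct)
  case (less N)
  have L: "L > 0" using X by (simp add: periodic_mod_def)
  let ?c = "card (X \<inter> {0..<L})"
  have cL: "?c \<le> nat L"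
    using card_mono[of "{0..<L}" "X \<inter> {0..<L}"] by simp
  then have d: "0 \<le> real ?c / of_int L" "real ?c / of_int L \<le> 1"
    using L by (auto simp: divide_le_eq_1)
  show ?case
  proof (cases "N < nat L")
    case True
    have "card (X \<inter> {1..int N}) \<le> N"
      using card_mono[of "{1..int N}" "X \<inter> {1..int N}"] by simp
    moreover have "real ?c / of_int L * real N \<le> real N" "0 \<le> real ?c / of_int L * real N"
      by (rule mult_left_le_one_le[OF of_nat_0_le_iff d], rule mult_nonneg_nonneg[OF d(1) of_nat_0_le_iff])
    moreover have "real N \<le> of_int L" using True L by linarith
    ultimately show ?thesis by linarith
  next
    case False
    define M where "M = N - nat L"
    have N: "int N = int M + L" and MN: "M < N" using False L by (auto simp: M_def)
    have "{1..int N} = {1..int M} \<union> {int M + 1..int M + L}" using N L by auto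
    then have "card (X \<inter> {1..int N}) = card ((X \<inter> {1..int M}) \<union> (X \<inter> {int M + 1..int M + L}))"
      by (simp add: Int_Un_distrib)
    also have "\<dots> = card (X \<inter> {1..int M}) + card (X \<inter> {int M + 1..int M + L})"
      by (rule card_Un_disjoint) auto
    finally have "card (X \<inter> {1..int N}) = card (X \<inter> {1..int M}) + ?c"
      by (simp add: card_period[OF X])
    moreover have "real N = real M + of_int L" using N by linarith
    ultimately have "real (card (X \<inter> {1..int N})) - real ?c / of_int L * real N
        = real (card (X \<inter> {1..int M})) - real ?c / of_int L * real M"
      using L by (simp add: field_simps)
    then show ?thesis using less.IH[OF MN] by simp
  qed
qed

lemma tendsto_periodic_count:
  assumes X: "periodic_mod L X"
  shows "(\<lambda>N. real (card (X \<inter> {1..int N})) / real N) \<longlonglongrightarrow> real (card (X \<inter> {0..<L})) / of_int L"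
proof -
  let ?d = "real (card (X \<inter> {0..<L})) / of_int L"
  have "(\<lambda>N. real (card (X \<inter> {1..int N})) / real N - ?d) \<longlonglongrightarrow> 0"
  proof (rule Lim_null_comparison)
    show "(\<lambda>N. of_int L / real N) \<longlonglongrightarrow> 0" by (rule lim_const_over_n)
    show "\<forall>\<^sub>F N in sequentially. norm (real (card (X \<inter> {1..int N})) / real N - ?d) \<le> of_int L / real N"
    proof (rule eventually_sequentiallyI[of 1])
      fix N :: nat assume N: "1 \<le> N"
      then have "real (card (X \<inter> {1..int N})) / real N - ?d
          = (real (card (X \<inter> {1..int N})) - ?d * real N) / real N" by (simp add: field_simps)
      then show "norm (real (card (X \<inter> {1..int N})) / real N - ?d) \<le> of_int L / real N"
        using divide_right_mono[OF periodic_count_bound[OF X, of N], of "real N"] by simp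
    qed
  qed
  then show ?thesis by (simp add: LIM_zero_iff)
qed

lemma dens_eq:
  assumes "periodic_mod L X"
  shows "dens X = real (card (X \<inter> {0..<L})) / of_int L"
  unfolding dens_def by (rule limI[OF tendsto_periodic_count[OF assms]])

lemma tendsto_dens:
  assumes "periodic X"
  shows "(\<lambda>N. real (card (X \<inter> {1..int N})) / real N) \<longlonglongrightarrow> dens X"
  using assms tendsto_periodic_count dens_eq unfolding periodic_def by metis

lemma dens_count_bound:
  assumes "periodic X"
  shows "\<exists>C. \<forall>N. \<bar>real (card (X \<inter> {1..int N})) - dens X * real N\<bar> \<le> C"
  using assms periodic_count_bound dens_eq unfolding periodic_def by metis

lemma dens_nonneg: "periodic X \<Longrightarrow> 0 \<le> dens X"
  unfolding periodic_def periodic_mod_def[abs_def] using dens_eq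
  by (metis divide_nonneg_pos of_int_0_less_iff of_nat_0_le_iff periodic_mod_def)

lemma dens_UNIV [simp]: "dens UNIV = 1"
  using dens_eq[of 1 UNIV] by (simp add: periodic_mod_def)

lemma dens_empty [simp]: "dens {} = 0"
  using dens_eq[of 1 "{}"] by (simp add: periodic_mod_def)

lemma dens_mono:
  assumes "periodic X" "periodic Y" "X \<subseteq> Y"
  shows "dens X \<le> dens Y"
  by (rule LIMSEQ_le[OF tendsto_dens[OF assms(1)] tendsto_dens[OF assms(2)]])
     (use assms(3) in \<open>auto intro!: exI[of _ 0] divide_right_mono card_mono\<close>)

lemma dens_le_1: "periodic X \<Longrightarrow> dens X \<le> 1"
  using dens_mono[of X UNIV] by simp

lemma dens_Un_disjoint:
  assumes "periodic X" "periodic Y" "X \<inter> Y = {}"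
  shows "dens (X \<union> Y) = dens X + dens Y"
proof (rule LIMSEQ_unique[OF tendsto_dens])
  show "periodic (X \<union> Y)" using assms by auto
  have "card ((X \<union> Y) \<inter> {1..int N}) = card (X \<inter> {1..int N}) + card (Y \<inter> {1..int N})" for N
    unfolding Int_Un_distrib2 by (rule card_Un_disjoint) (use assms(3) in auto)
  then show "(\<lambda>N. real (card ((X \<union> Y) \<inter> {1..int N})) / real N) \<longlonglongrightarrow> dens X + dens Y"
    using tendsto_add[OF tendsto_dens[OF assms(1)] tendsto_dens[OF assms(2)]]
    by (simp add: add_divide_distrib)
qed

lemma dens_Diff:
  assumes "periodic X" "periodic Y" "Y \<subseteq> X"
  shows "dens (X - Y) = dens X - dens Y"
  using dens_Un_disjoint[of "X - Y" Y] assms by (simp add: Un_absorb2 periodic_Diff inf_commute)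

lemma dens_Int_Diff:
  assumes "periodic X" "periodic Y"
  shows "dens (X - Y) = dens X - dens (X \<inter> Y)"
  using dens_Diff[of X "X \<inter> Y"] assms by (simp add: Diff_Int periodic_Int)

lemma dens_Un_le:
  assumes "periodic X" "periodic Y"
  shows "dens (X \<union> Y) \<le> dens X + dens Y"
proof -
  have "dens (X \<union> Y) = dens (X - Y) + dens Y"
    using dens_Un_disjoint[of "X - Y" Y] assms by (auto simp: Un_absorb2)
  then show ?thesis
    using dens_mono[of "X - Y" X] assms by auto
qed

lemma dens_UNION_le:
  assumes "finite I" "\<And>i. i \<in> I \<Longrightarrow> periodic (X i)"
  shows "dens (\<Union>i\<in>I. X i) \<le> (\<Sum>i\<in>I. dens (X i))"
  using assms
proof (induction I rule: finite_induct)
  case (insert i I)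
  have "dens (X i \<union> (\<Union>i\<in>I. X i)) \<le> dens (X i) + dens (\<Union>i\<in>I. X i)"
    by (rule dens_Un_le) (use insert in \<open>auto intro: periodic_UNION\<close>)
  then show ?case using insert by auto
qed auto

lemma dens_shift:
  assumes "periodic X"
  shows "dens {n. n + k \<in> X} = dens X"
proof -
  obtain L where X: "periodic_mod L X" using assms by (auto simp: periodic_def)
  have "(\<lambda>n. n + k) ` ({n. n + k \<in> X} \<inter> {0..<L}) = X \<inter> {(k - 1) + 1..(k - 1) + L}"
  proof (intro equalityI subsetI)
    fix y assume "y \<in> X \<inter> {k - 1 + 1..k - 1 + L}"
    then show "y \<in> (\<lambda>n. n + k) ` ({n. n + k \<in> X} \<inter> {0..<L})"
      by (intro image_eqI[of _ _ "y - k"]) auto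
  qed auto
  then have "card ({n. n + k \<in> X} \<inter> {0..<L}) = card (X \<inter> {(k - 1) + 1..(k - 1) + L})"
    using card_image[of "\<lambda>n. n + k" "{n. n + k \<in> X} \<inter> {0..<L}"] by (simp add: inj_on_def)
  also have "\<dots> = card (X \<inter> {0..<L})" by (rule card_period[OF X])
  finally show ?thesis using dens_eq[OF X] dens_eq[OF periodic_mod_shift[OF X]] by simp
qed

text \<open>
  Chinese remainder theorem: the pairs of residues modulo \<open>L\<close> and \<open>M\<close> are the residues modulo
  \<open>L * M\<close>.
\<close>
lemma dens_Int_indep:
  assumes X: "periodic_mod L X" and Y: "periodic_mod M Y" and cop: "coprime L M"
  shows "dens (X \<inter> Y) = dens X * dens Y"
proof -
  have L: "L > 0" and M: "M > 0" using X Y by (auto simp: periodic_mod_def)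
  have XY: "periodic_mod (L * M) (X \<inter> Y)"
    using periodic_mod_dvd[OF X, of "L * M"] periodic_mod_dvd[OF Y, of "L * M"] L M
    by (auto simp: periodic_mod_def)
  define g where "g = (\<lambda>n. (n mod L, n mod M))"
  have inj: "inj_on g {0..<L * M}"
  proof (rule inj_onI)
    fix x y assume xy: "x \<in> {0..<L * M}" "y \<in> {0..<L * M}" "g x = g y"
    then have "L dvd x - y" "M dvd x - y" by (auto simp: g_def mod_eq_dvd_iff)
    then have "L * M dvd x - y" using cop by (rule divides_mult)
    then have "x mod (L * M) = y mod (L * M)" by (simp add: mod_eq_dvd_iff)
    then show "x = y" using xy by simp
  qed
  have sub: "g ` {0..<L * M} \<subseteq> {0..<L} \<times> {0..<M}" using L M by (auto simp: g_def)
  have im: "g ` {0..<L * M} = {0..<L} \<times> {0..<M}"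
    by (rule card_subset_eq)
       (use sub L M card_image[OF inj] in \<open>auto simp: card_cartesian_product nat_mult_distrib\<close>)
  have memX: "n mod L \<in> X \<longleftrightarrow> n \<in> X" and memY: "n mod M \<in> Y \<longleftrightarrow> n \<in> Y" for n
    using periodic_modD[OF X, of "n mod L" n] periodic_modD[OF Y, of "n mod M" n]
    by (simp_all add: mod_eq_dvd_iff[symmetric])
  have "g ` ((X \<inter> Y) \<inter> {0..<L * M}) = (X \<inter> {0..<L}) \<times> (Y \<inter> {0..<M})"
  proof (intro equalityI subsetI)
    fix z assume "z \<in> g ` ((X \<inter> Y) \<inter> {0..<L * M})"
    then show "z \<in> (X \<inter> {0..<L}) \<times> (Y \<inter> {0..<M})"
      using memX memY L M by (auto simp: g_def)
  next
    fix z assume z: "z \<in> (X \<inter> {0..<L}) \<times> (Y \<inter> {0..<M})"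
    then have "z \<in> g ` {0..<L * M}" using im by auto
    then obtain n where "n \<in> {0..<L * M}" "z = g n" by blast
    then show "z \<in> g ` ((X \<inter> Y) \<inter> {0..<L * M})"
      using z memX memY by (auto simp: g_def)
  qed
  then have "card ((X \<inter> Y) \<inter> {0..<L * M}) = card (X \<inter> {0..<L}) * card (Y \<inter> {0..<M})"
    using card_image[OF inj_on_subset[OF inj, of "(X \<inter> Y) \<inter> {0..<L * M}"]]
    by (simp add: card_cartesian_product)
  then show ?thesis using dens_eq[OF X] dens_eq[OF Y] dens_eq[OF XY] by simp
qed

lemma dens_residue:
  assumes "q > 0"
  shows "dens {n. q dvd n - a} = 1 / of_int q"
proof -
  have "{n. q dvd n - a} \<inter> {0..<q} = {a mod q}"
  proof (intro equalityI subsetI)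
    fix x assume "x \<in> {n. q dvd n - a} \<inter> {0..<q}"
    then show "x \<in> {a mod q}" by (auto simp: mod_eq_dvd_iff[symmetric])
  qed (use assms in \<open>auto simp: mod_eq_dvd_iff[symmetric]\<close>)
  then show ?thesis using dens_eq[OF periodic_mod_residue[OF assms, of a]] by simp
qed

lemma dens_dilate:
  assumes "periodic X" "d > 0"
  shows "periodic ((*) d ` X)" "dens ((*) d ` X) = dens X / of_int d"
proof -
  obtain L where X: "periodic_mod L X" using assms by (auto simp: periodic_def)
  then have L: "L > 0" by (simp add: periodic_mod_def)
  have per: "periodic_mod (d * L) ((*) d ` X)"
  proof (rule periodic_modI)
    show "d * L > 0" using L assms by simp
    fix n n' assume n: "d * L dvd n - n'" "n \<in> (*) d ` X"
    then obtain x c where x: "x \<in> X" "n = d * x" "n - n' = d * L * c" by (auto simp: dvd_def)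
    then have "n' = d * (x - L * c)" by (simp add: algebra_simps)
    moreover have "x - L * c \<in> X" using x periodic_modD[OF X, of x "x - L * c"] by simp
    ultimately show "n' \<in> (*) d ` X" by blast
  qed
  then show "periodic ((*) d ` X)" by (rule periodic_mod_imp_periodic)
  have "(*) d ` X \<inter> {0..<d * L} = (*) d ` (X \<inter> {0..<L})"
    using assms by (auto simp: zero_le_mult_iff)
  then have "card ((*) d ` X \<inter> {0..<d * L}) = card (X \<inter> {0..<L})"
    using assms by (simp add: card_image inj_on_def)
  then show "dens ((*) d ` X) = dens X / of_int d"
    using dens_eq[OF X] dens_eq[OF per] by simp
qed

lemma mem_multiples: "n \<in> multiples A \<longleftrightarrow> (\<exists>a\<in>A. int a dvd n)"
  by (auto simp: multiples_def dvd_def)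

lemma periodic_mod_multiples:
  assumes "L > 0" "\<And>a. a \<in> A \<Longrightarrow> int a dvd L"
  shows "periodic_mod L (multiples A)"
proof (rule periodic_modI[OF assms(1)])
  fix n n' assume d: "L dvd n - n'" and "n \<in> multiples A"
  then obtain a where a: "a \<in> A" "int a dvd n" by (auto simp: mem_multiples)
  then have "int a dvd n - (n - n')" using assms(2) d by (meson dvd_diff dvd_trans)
  then show "n' \<in> multiples A" using a by (auto simp: mem_multiples)
qed

lemma periodic_multiples:
  assumes "finite F" "0 \<notin> F"
  shows "periodic_mod (int (\<Prod>F)) (multiples F)" "periodic (multiples F)"
proof -
  have "\<Prod>F > 0" using assms by (metis gr0I prod_zero_iff)
  then show "periodic_mod (int (\<Prod>F)) (multiples F)"
  proof (intro periodic_mod_multiples)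
    fix a assume "a \<in> F"
    then have "a dvd \<Prod>F" using assms by (simp add: dvd_prod_eqI)
    then show "int a dvd int (\<Prod>F)" by (simp only: int_dvd_int_iff)
  qed (simp only: of_nat_0_less_iff)
  then show "periodic (multiples F)" by (rule periodic_mod_imp_periodic)
qed

lemma multiples_mono: "A \<subseteq> A' \<Longrightarrow> multiples A \<subseteq> multiples A'"
  by (auto simp: multiples_def)

lemma multiples_Un: "multiples (A \<union> A') = multiples A \<union> multiples A'"
  by (auto simp: multiples_def)

section \<open>The Davenport--Erdos theorem\<close>

text \<open>
  By the Davenport--Erdos theorem below, this is the lower density of the set of multiples of
  \<open>A\<close> if \<open>0 \<notin> A\<close>; as a supremum over finite subsets it is what limits of Haar measures and of
  densities of periodic sets produce.
\<close>
definition inner_density :: "nat set \<Rightarrow> real" where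
  "inner_density A = (SUP F\<in>{F. finite F \<and> F \<subseteq> A}. dens (multiples F))"

lemma inner_density_upper:
  assumes "0 \<notin> A" "finite F" "F \<subseteq> A"
  shows "dens (multiples F) \<le> inner_density A"
  unfolding inner_density_def
proof (rule cSUP_upper)
  show "bdd_above ((\<lambda>F. dens (multiples F)) ` {F. finite F \<and> F \<subseteq> A})"
    by (rule bdd_aboveI[of _ 1]) (use assms in \<open>auto intro!: dens_le_1 periodic_multiples(2)\<close>)
qed (use assms in auto)

lemma inner_density_least:
  assumes "\<And>F. finite F \<Longrightarrow> F \<subseteq> A \<Longrightarrow> dens (multiples F) \<le> c"
  shows "inner_density A \<le> c"
  unfolding inner_density_def by (rule cSUP_least) (use assms in auto)

lemma inner_density_approx:
  assumes "c < inner_density A"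
  obtains F where "finite F" "F \<subseteq> A" "c < dens (multiples F)"
proof -
  have "\<not> (\<forall>F. finite F \<and> F \<subseteq> A \<longrightarrow> dens (multiples F) \<le> c)"
    using inner_density_least[of A c] assms by force
  then show thesis using that by force
qed

text \<open>
  Jordan's totient with a real exponent \<open>\<sigma>\<close>: the Moebius transform of
  \<open>n \<mapsto> n powr \<sigma>\<close>, written as an Euler product so that it is visibly
  nonnegative for \<open>\<sigma> \<ge> 0\<close>.
\<close>
definition jordan_totient :: "real \<Rightarrow> nat \<Rightarrow> real" where
  "jordan_totient \<sigma> n = real n powr \<sigma> * (\<Prod>p\<in>prime_factors n. 1 - real p powr (- \<sigma>))"

lemma jordan_nonneg:
  assumes "\<sigma> \<ge> 0"
  shows "jordan_totient \<sigma> n \<ge> 0"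
proof -
  have "real p powr (- \<sigma>) \<le> 1" if "p \<in> prime_factors n" for p
  proof -
    have "prime p" using that by (rule in_prime_factors_imp_prime)
    then have "real p \<ge> 1" using prime_ge_1_nat[of p] by simp
    then show ?thesis using assms by (simp add: powr_minus_divide ge_one_powr_ge_zero divide_le_eq_1)
  qed
  then show ?thesis unfolding jordan_totient_def by (intro mult_nonneg_nonneg prod_nonneg) auto
qed

lemma jordan_prime_power_mult:
  assumes p: "prime p" and k: "k > 0" and m: "\<not> p dvd m" "m > 0"
  shows "jordan_totient \<sigma> (p ^ k * m) = real (p ^ k) powr \<sigma> * (1 - real p powr (- \<sigma>)) * jordan_totient \<sigma> m"
proof -
  have "prime_factors (p ^ k * m) = insert p (prime_factors m)"
    using assms by (simp add: prime_factors_product prime_factorization_prime_power)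
  moreover have "p \<notin> prime_factors m" using m by (auto simp: prime_factors_dvd)
  ultimately show ?thesis by (simp add: jordan_totient_def powr_mult)
qed

text \<open>
  Strong induction by splitting off a prime power: the divisors of \<open>p ^ k * m\<close> are those of
  \<open>p ^ (k - 1) * m\<close> together with the \<open>p ^ k * d\<close> for \<open>d\<close> dividing \<open>m\<close>, and the second
  family contributes the difference of the two powers.
\<close>
lemma sum_jordan:
  assumes "n > 0"
  shows "(\<Sum>d | d dvd n. jordan_totient \<sigma> d) = real n powr \<sigma>"
  using assms
proof (induction n rule: less_induct)
  case (less n)
  show ?case
  proof (cases "n = 1")
    case True
    then show ?thesis by (simp add: jordan_totient_def)
  next
    case False
    then obtain p where p: "prime p" "p dvd n" using prime_factor_nat by blast
    obtain k m where n: "n = p ^ k * m" and pm: "\<not> p dvd m"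
      using p less.prems multiplicity_decompose'[of n p] by (metis not_prime_unit not_gr_zero)
    have k: "k > 0" using p pm n by (cases k) auto
    have m0: "m > 0" using less.prems n by auto
    have p1: "p > 1" using p prime_gt_1_nat by blast
    define n1 where "n1 = p ^ (k - 1) * m"
    have nn1: "n = p * n1" unfolding n n1_def using k by (cases k) auto
    have n1: "n1 > 0" "n1 < n" using nn1 less.prems p1 by auto
    have mn: "m < n" unfolding n using one_less_power[OF p1 k] m0 by simp
    have split: "{d. d dvd n} = {d. d dvd n1} \<union> (\<lambda>d. p ^ k * d) ` {d. d dvd m}"
    proof (intro equalityI subsetI)
      fix d assume "d \<in> {d. d dvd n}"
      then have "d dvd p ^ k * m" using n by simp
      then obtain x y where xy: "d = x * y" "x dvd p ^ k" "y dvd m"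
        by (metis division_decomp)
      then obtain i where i: "i \<le> k" "x = p ^ i"
        using divides_primepow_nat[OF p(1)] by blast
      show "d \<in> {d. d dvd n1} \<union> (\<lambda>d. p ^ k * d) ` {d. d dvd m}"
      proof (cases "i = k")
        case True then show ?thesis using xy i by auto
      next
        case False
        then have "x dvd p ^ (k - 1)" using i by (auto intro!: le_imp_power_dvd)
        then show ?thesis using xy by (auto simp: n1_def mult_dvd_mono)
      qed
    next
      fix d assume "d \<in> {d. d dvd n1} \<union> (\<lambda>d. p ^ k * d) ` {d. d dvd m}"
      then show "d \<in> {d. d dvd n}"
    proof
      assume "d \<in> {d. d dvd n1}"
      then show ?thesis by (simp add: nn1)
    next
      assume "d \<in> (\<lambda>d. p ^ k * d) ` {d. d dvd m}"
      then show ?thesis unfolding n by (auto intro: mult_dvd_mono)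
    qed
    qed
    have disj: "{d. d dvd n1} \<inter> (\<lambda>d. p ^ k * d) ` {d. d dvd m} = {}"
    proof -
      have False if "p ^ k * d dvd n1" for d
      proof -
        have "p ^ (k - 1) * (p * d) dvd p ^ (k - 1) * m"
          using that k unfolding n1_def by (cases k) (auto simp: ac_simps)
        then have "p * d dvd m" using p1 by simp
        then show False using pm dvd_mult_left by blast
      qed
      then show ?thesis by auto
    qed
    have fin: "finite {d. d dvd n1}" "finite {d. d dvd m}" using n1 m0 by auto
    have "(\<Sum>d | d dvd n. jordan_totient \<sigma> d)
        = (\<Sum>d | d dvd n1. jordan_totient \<sigma> d) + (\<Sum>d\<in>(\<lambda>d. p ^ k * d) ` {d. d dvd m}. jordan_totient \<sigma> d)"
      unfolding split by (rule sum.union_disjoint) (use fin disj in auto)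
    also have "(\<Sum>d\<in>(\<lambda>d. p ^ k * d) ` {d. d dvd m}. jordan_totient \<sigma> d) = (\<Sum>d | d dvd m. jordan_totient \<sigma> (p ^ k * d))"
      using p1 by (subst sum.reindex) (auto simp: inj_on_def)
    also have "\<dots> = (\<Sum>d | d dvd m. real (p ^ k) powr \<sigma> * (1 - real p powr (- \<sigma>)) * jordan_totient \<sigma> d)"
    proof (rule sum.cong[OF refl])
      fix d assume "d \<in> {d. d dvd m}"
      then show "jordan_totient \<sigma> (p ^ k * d) = real (p ^ k) powr \<sigma> * (1 - real p powr (- \<sigma>)) * jordan_totient \<sigma> d"
        using pm m0 dvd_trans by (intro jordan_prime_power_mult p k) (auto intro: Nat.gr0I)
    qed
    also have "\<dots> = real (p ^ k) powr \<sigma> * (1 - real p powr (- \<sigma>)) * real m powr \<sigma>"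
      using less.IH[OF mn m0] by (simp add: sum_distrib_left[symmetric])
    also have "(\<Sum>d | d dvd n1. jordan_totient \<sigma> d) = real n1 powr \<sigma>"
      by (rule less.IH) (use n1 in auto)
    also have "real n1 powr \<sigma> = real p powr (- \<sigma>) * real n powr \<sigma>"
      using p1 by (simp add: nn1 powr_mult powr_minus)
    also have "real (p ^ k) powr \<sigma> * (1 - real p powr (- \<sigma>)) * real m powr \<sigma>
        = (1 - real p powr (- \<sigma>)) * real n powr \<sigma>"
      by (simp add: n powr_mult)
    finally show ?thesis by (simp add: algebra_simps)
  qed
qed

definition zeta_on :: "int set \<Rightarrow> real \<Rightarrow> real" where
  "zeta_on X s = (\<Sum>n. indicator X (int n) * real n powr (- s))"

lemma summable_zeta_on:
  assumes "s > 1"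
  shows "summable (\<lambda>n. indicator X (int n) * real n powr (- s))"
proof (rule summable_comparison_test')
  show "summable (\<lambda>n. real n powr (- s))" using assms by (simp add: summable_real_powr_iff)
qed (auto simp: indicator_def)

lemma zeta_on_nonneg: "s > 1 \<Longrightarrow> 0 \<le> zeta_on X s"
  unfolding zeta_on_def by (rule suminf_nonneg[OF summable_zeta_on]) auto

lemma suminf_ennreal_swap:
  fixes f :: "nat \<Rightarrow> nat \<Rightarrow> ennreal"
  shows "(\<Sum>n. \<Sum>d. f n d) = (\<Sum>d. \<Sum>n. f n d)"
proof -
  have "(\<Sum>n. \<Sum>d. f n d) = (\<integral>\<^sup>+ n. (\<Sum>d. f n d) \<partial>count_space UNIV)"
    by (simp add: nn_integral_count_space_nat)
  also have "\<dots> = (\<Sum>d. \<integral>\<^sup>+ n. f n d \<partial>count_space UNIV)"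
    by (rule nn_integral_suminf) auto
  finally show ?thesis by (simp add: nn_integral_count_space_nat)
qed

lemma ennreal_zeta_on:
  assumes "s > 1"
  shows "ennreal (zeta_on X s) = (\<Sum>n. ennreal (indicator X (int n) * real n powr (- s)))"
  unfolding zeta_on_def
  by (rule suminf_ennreal2[symmetric]) (use summable_zeta_on[OF assms] in auto)

text \<open>
  Write \<open>n powr (- s') = n powr (- s) * n powr (s - s')\<close>, expand the last factor as a divisor sum of
  Jordan totients, and exchange the sums. The point is that all coefficients are nonnegative.
\<close>
lemma zeta_on_expand:
  assumes s: "1 < s'" "s' < s"
  shows "ennreal (zeta_on X s') = (\<Sum>d. ennreal (jordan_totient (s - s') d * real d powr (- s)) *
           (\<Sum>m. ennreal (indicator X (int d * int m) * real m powr (- s))))"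
proof -
  define \<sigma> where "\<sigma> = s - s'"
  define f where "f = (\<lambda>n d. if d dvd n \<and> n > 0 then
      ennreal (indicator X (int n) * real n powr (- s) * jordan_totient \<sigma> d) else 0)"
  have J: "jordan_totient \<sigma> d \<ge> 0" for d using jordan_nonneg[of \<sigma> d] s by (simp add: \<sigma>_def)
  have inner: "(\<Sum>d. f n d) = ennreal (indicator X (int n) * real n powr (- s'))" for n
  proof (cases "n = 0")
    case False
    have "(\<Sum>d. f n d) = (\<Sum>d | d dvd n. f n d)"
      by (rule suminf_finite) (use False in \<open>auto simp: f_def\<close>)
    also have "\<dots> = (\<Sum>d | d dvd n. ennreal (indicator X (int n) * real n powr (- s) * jordan_totient \<sigma> d))"
      using False by (simp add: f_def)
    also have "\<dots> = ennreal (\<Sum>d | d dvd n. indicator X (int n) * real n powr (- s) * jordan_totient \<sigma> d)"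
      by (rule sum_ennreal) (use J in auto)
    also have "(\<Sum>d | d dvd n. indicator X (int n) * real n powr (- s) * jordan_totient \<sigma> d)
        = indicator X (int n) * (real n powr (- s) * real n powr \<sigma>)"
      using False by (simp add: sum_distrib_left[symmetric] sum_jordan)
    also have "real n powr (- s) * real n powr \<sigma> = real n powr (- s')"
      by (simp add: powr_add[symmetric] \<sigma>_def)
    finally show ?thesis .
  qed (simp add: f_def)
  have outer: "(\<Sum>n. f n d) = ennreal (jordan_totient \<sigma> d * real d powr (- s)) *
           (\<Sum>m. ennreal (indicator X (int d * int m) * real m powr (- s)))" for d
  proof (cases "d = 0")
    case False
    have "(\<Sum>n. f n d) = (\<Sum>m. f (d * m) d)"
      by (rule suminf_mono_reindex[symmetric])
         (use False in \<open>auto simp: strict_mono_def f_def dvd_def\<close>)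
    also have "\<dots> = (\<Sum>m. ennreal (jordan_totient \<sigma> d * real d powr (- s)) *
           ennreal (indicator X (int d * int m) * real m powr (- s)))"
    proof (rule suminf_cong)
      fix m
      show "f (d * m) d = ennreal (jordan_totient \<sigma> d * real d powr (- s)) *
           ennreal (indicator X (int d * int m) * real m powr (- s))"
        using J[of d] False
        by (cases "m = 0") (simp_all add: f_def ennreal_mult[symmetric] powr_mult mult_ac)
    qed
    finally show ?thesis by simp
  next
    case True
    have "f n 0 = 0" for n by (auto simp: f_def)
    then show ?thesis using True by simp
  qed
  have "ennreal (zeta_on X s') = (\<Sum>n. \<Sum>d. f n d)"
    unfolding inner by (rule ennreal_zeta_on[OF s(1)])
  also have "\<dots> = (\<Sum>d. \<Sum>n. f n d)" by (rule suminf_ennreal_swap)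
  finally show ?thesis unfolding outer \<sigma>_def .
qed

text \<open>
  The share of \<open>X\<close> under the probability proportional to \<open>n powr (- s)\<close> grows when \<open>s\<close>
  decreases: in the expansion above, passing from \<open>m\<close> to \<open>d * m\<close> never leaves \<open>X\<close>.
\<close>
lemma zeta_on_ratio_antimono:
  assumes s: "1 < s'" "s' < s"
    and up: "\<And>d n. n \<in> X \<Longrightarrow> d * n \<in> X"
  shows "zeta_on X s * zeta_on UNIV s' \<le> zeta_on X s' * zeta_on UNIV s"
proof -
  define C where "C = (\<Sum>d. ennreal (jordan_totient (s - s') d * real d powr (- s)))"
  have s1: "s > 1" using s by simp
  have "C * ennreal (zeta_on X s) = (\<Sum>d. ennreal (jordan_totient (s - s') d * real d powr (- s)) *
           (\<Sum>m. ennreal (indicator X (int m) * real m powr (- s))))"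
    unfolding C_def ennreal_zeta_on[OF s1] by simp
  also have "\<dots> \<le> ennreal (zeta_on X s')"
    unfolding zeta_on_expand[OF s]
    by (intro suminf_le mult_left_mono summableI ennreal_leI mult_right_mono)
       (auto simp: indicator_def up)
  finally have *: "C * ennreal (zeta_on X s) \<le> ennreal (zeta_on X s')" .
  have C: "ennreal (zeta_on UNIV s') = C * ennreal (zeta_on UNIV s)"
    unfolding zeta_on_expand[OF s] C_def ennreal_zeta_on[OF s1] by simp
  have "ennreal (zeta_on X s * zeta_on UNIV s') = (C * ennreal (zeta_on X s)) * ennreal (zeta_on UNIV s)"
    using zeta_on_nonneg[of s] zeta_on_nonneg[of s'] s s1
    by (simp add: ennreal_mult C mult_ac)
  also have "\<dots> \<le> ennreal (zeta_on X s') * ennreal (zeta_on UNIV s)"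
    by (rule mult_right_mono[OF *]) simp
  also have "\<dots> = ennreal (zeta_on X s' * zeta_on UNIV s)"
    using zeta_on_nonneg[of s] zeta_on_nonneg[of s'] s s1 by (simp add: ennreal_mult)
  finally show ?thesis
    using zeta_on_nonneg[of s] zeta_on_nonneg[of s'] s s1 by (simp add: ennreal_le_iff)
qed

lemma abel_inequality:
  fixes a f :: "nat \<Rightarrow> real"
  assumes A: "\<And>N. (\<Sum>n=1..N. a n) \<le> C"
    and f: "\<And>n. n \<ge> 1 \<Longrightarrow> f (Suc n) \<le> f n" "\<And>n. f n \<ge> 0"
  shows "(\<Sum>n=1..N. a n * f n) \<le> C * f 1"
proof -
  have C: "C \<ge> 0" using A[of 0] by simp
  have *: "(\<Sum>n=1..Suc N. a n * f n) \<le> (\<Sum>n=1..Suc N. a n) * f (Suc N) + C * (f 1 - f (Suc N))" for N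
  proof (induction N)
    case (Suc N)
    have "(\<Sum>n=1..Suc N. a n) * (f (Suc N) - f (Suc (Suc N))) \<le> C * (f (Suc N) - f (Suc (Suc N)))"
      by (rule mult_right_mono[OF A]) (use f(1)[of "Suc N"] in simp)
    then show ?case using Suc.IH by (simp add: algebra_simps)
  qed simp
  show ?thesis
  proof (cases N)
    case 0
    then show ?thesis using C f(2) by simp
  next
    case (Suc M)
    have "(\<Sum>n=1..Suc M. a n) * f (Suc M) \<le> C * f (Suc M)"
      by (rule mult_right_mono[OF A f(2)])
    then show ?thesis using *[of M] Suc by (simp add: algebra_simps)
  qed
qed

text \<open>
  Summation by parts turns a bound on the partial sums of the coefficients into a bound that is
  uniform in \<open>s\<close>. Applied to \<open>indicator X n - \<delta>\<close> and its negative, it compares counting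
  functions with zeta sums.
\<close>
lemma dirichlet_le:
  assumes s: "s > 1" and A: "\<And>N. (\<Sum>n=1..N. a n) \<le> C"
    and sm: "summable (\<lambda>n. a n * real n powr (- s))"
  shows "(\<Sum>n. a n * real n powr (- s)) \<le> C"
proof (rule suminf_le_const[OF sm])
  fix N
  have "(\<Sum>n=1..N. a n * real n powr (- s)) \<le> C * real 1 powr (- s)" for N
    by (rule abel_inequality[OF A]) (use s in \<open>auto intro!: powr_mono2'\<close>)
  moreover have "(\<Sum>n<Suc N. a n * real n powr (- s)) = (\<Sum>n=1..N. a n * real n powr (- s))" for N
  proof -
    have "{..<Suc N} = insert 0 {1..N}" by auto
    then show ?thesis by simp
  qed
  moreover have "(\<Sum>n<N. a n * real n powr (- s)) \<le> C" if "N = 0"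
    using that A[of 0] by simp
  ultimately show "(\<Sum>n<N. a n * real n powr (- s)) \<le> C"
    by (cases N) (auto simp: simp del: sum.lessThan_Suc)
qed

lemma sum_indicator_count:
  "(\<Sum>n=1..N. indicator X (int n) :: real) = real (card (X \<inter> {1..int N}))"
proof -
  have "(\<Sum>n=1..N. indicator X (int n) :: real) = real (card {n\<in>{1..N}. int n \<in> X})"
    by (simp add: indicator_def Int_def sum.If_cases)
  also have "card {n\<in>{1..N}. int n \<in> X} = card (int ` {n\<in>{1..N}. int n \<in> X})"
    by (simp add: card_image)
  also have "int ` {n\<in>{1..N}. int n \<in> X} = X \<inter> {1..int N}"
  proof (intro equalityI subsetI)
    fix x assume "x \<in> X \<inter> {1..int N}"
    then show "x \<in> int ` {n\<in>{1..N}. int n \<in> X}" by (intro image_eqI[of _ _ "nat x"]) auto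
  qed auto
  finally show ?thesis .
qed

lemma zeta_on_diff:
  assumes "s > 1"
  shows "summable (\<lambda>n. (indicator X (int n) - \<delta>) * real n powr (- s))"
    "(\<Sum>n. (indicator X (int n) - \<delta>) * real n powr (- s)) = zeta_on X s - \<delta> * zeta_on UNIV s"
proof -
  have X: "(\<lambda>n. indicator X (int n) * real n powr (- s)) sums zeta_on X s"
    unfolding zeta_on_def by (rule summable_sums[OF summable_zeta_on[OF assms]])
  have U: "(\<lambda>n. indicator UNIV (int n) * real n powr (- s)) sums zeta_on UNIV s"
    unfolding zeta_on_def by (rule summable_sums[OF summable_zeta_on[OF assms]])
  have "(\<lambda>n. (indicator X (int n) - \<delta>) * real n powr (- s)) sums (zeta_on X s - \<delta> * zeta_on UNIV s)"
    using sums_diff[OF X sums_mult[OF U, of \<delta>]] by (simp add: algebra_simps)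
  then show "summable (\<lambda>n. (indicator X (int n) - \<delta>) * real n powr (- s))"
    "(\<Sum>n. (indicator X (int n) - \<delta>) * real n powr (- s)) = zeta_on X s - \<delta> * zeta_on UNIV s"
    by (auto simp: sums_iff)
qed

lemma zeta_on_le:
  assumes s: "s > 1" and le: "\<And>N. real (card (X \<inter> {1..int N})) \<le> \<delta> * real N + C"
  shows "zeta_on X s \<le> \<delta> * zeta_on UNIV s + C"
proof -
  have "(\<Sum>n. (indicator X (int n) - \<delta>) * real n powr (- s)) \<le> C"
    by (rule dirichlet_le[OF s _ zeta_on_diff(1)[OF s]])
       (use le in \<open>simp add: sum_subtractf sum_indicator_count mult_ac algebra_simps del: One_nat_def\<close>)
  then show ?thesis using zeta_on_diff(2)[OF s] by simp
qed

lemma zeta_on_ge: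
  assumes s: "s > 1" and le: "\<And>N. real (card (X \<inter> {1..int N})) \<ge> \<delta> * real N - C"
  shows "zeta_on X s \<ge> \<delta> * zeta_on UNIV s - C"
proof -
  have m: "(\<lambda>n. (\<delta> - indicator X (int n)) * real n powr (- s))
      = (\<lambda>n. - ((indicator X (int n) - \<delta>) * real n powr (- s)))"
    by (simp add: fun_eq_iff algebra_simps)
  have "(\<Sum>n. (\<delta> - indicator X (int n)) * real n powr (- s)) \<le> C"
  proof (rule dirichlet_le[OF s])
    show "(\<Sum>n=1..N. \<delta> - indicator X (int n)) \<le> C" for N
      using le[of N] by (simp add: sum_subtractf sum_indicator_count mult_ac algebra_simps del: One_nat_def)
    show "summable (\<lambda>n. (\<delta> - indicator X (int n)) * real n powr (- s))"
      unfolding m by (rule summable_minus[OF zeta_on_diff(1)[OF s]])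
  qed
  then show ?thesis
    unfolding m using suminf_minus[OF zeta_on_diff(1)[OF s, of X \<delta>]] zeta_on_diff(2)[OF s, of X \<delta>] by simp
qed

lemma zeta_unbounded:
  assumes "s > 1"
  obtains s' where "1 < s'" "s' < s" "zeta_on UNIV s' > K"
proof -
  have "\<not> summable (\<lambda>n. real n powr (- 1))" using summable_real_powr_iff[of "- 1"] by linarith
  then have "\<not> (\<forall>N. (\<Sum>n\<le>N. real n powr (- 1)) \<le> K)"
    using bounded_imp_summable[of "\<lambda>n. real n powr (- 1)" K] by auto
  then obtain N' where "(\<Sum>n\<le>N'. real n powr (- 1)) > K" by (auto simp: not_le)
  then obtain N where N: "(\<Sum>n<N. real n powr (- 1)) > K"
    using lessThan_Suc_atMost[of N'] by metis
  have "((\<lambda>t. \<Sum>n<N. real n powr (- t)) \<longlongrightarrow> (\<Sum>n<N. real n powr (- 1))) (at_right 1)"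
  proof (intro tendsto_sum)
    fix n assume "n \<in> {..<N}"
    show "((\<lambda>t. real n powr (- t)) \<longlongrightarrow> real n powr (- 1)) (at_right 1)"
    proof (cases "n = 0")
      case False
      then show ?thesis
        by (intro tendsto_powr tendsto_const tendsto_minus tendsto_ident_at) simp
    qed simp
  qed
  then have "\<forall>\<^sub>F t in at_right 1. (\<Sum>n<N. real n powr (- t)) > K"
    using N by (rule order_tendstoD(1))
  moreover have "\<forall>\<^sub>F t in at_right (1::real). t \<in> {1<..<s}"
    by (rule eventually_at_right_real[OF assms])
  ultimately have "\<forall>\<^sub>F t in at_right 1. (\<Sum>n<N. real n powr (- t)) > K \<and> t \<in> {1<..<s}"
    by eventually_elim simp
  then obtain t where t: "(\<Sum>n<N. real n powr (- t)) > K" "1 < t" "t < s"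
    using eventually_happens'[of "at_right (1::real)"] by (auto simp: trivial_limit_at_right_real)
  have "(\<Sum>n<N. real n powr (- t)) \<le> zeta_on UNIV t"
    unfolding zeta_on_def using sum_le_suminf[OF summable_zeta_on[OF t(2), of UNIV], of "{..<N}"] by simp
  then show thesis using that t by force
qed

text \<open>
  For a periodic set the share tends to the density as \<open>s\<close> decreases to 1, because the counting
  error is bounded and the zeta function is unbounded there; by monotonicity the share is below its
  limit for every \<open>s\<close>.
\<close>
lemma zeta_on_multiples_finite:
  assumes F: "finite F" "0 \<notin> F" and s: "s > 1"
  shows "zeta_on (multiples F) s \<le> dens (multiples F) * zeta_on UNIV s"
proof (rule ccontr)
  assume neg: "\<not> ?thesis"
  define e where "e = zeta_on (multiples F) s - dens (multiples F) * zeta_on UNIV s"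
  have e: "e > 0" using neg by (simp add: e_def)
  obtain C where C: "\<bar>real (card (multiples F \<inter> {1..int N})) - dens (multiples F) * real N\<bar> \<le> C" for N
    using dens_count_bound[OF periodic_multiples(2)[OF F]] by blast
  obtain s' where s': "1 < s'" "s' < s" "zeta_on UNIV s' > C * zeta_on UNIV s / e"
    using zeta_unbounded[OF s] by metis
  have "zeta_on (multiples F) s * zeta_on UNIV s' \<le> zeta_on (multiples F) s' * zeta_on UNIV s"
    by (rule zeta_on_ratio_antimono[OF s'(1,2)]) (auto simp: mem_multiples intro: dvd_mult)
  also have "\<dots> \<le> (dens (multiples F) * zeta_on UNIV s' + C) * zeta_on UNIV s"
  proof (intro mult_right_mono zeta_on_le[OF s'(1)] zeta_on_nonneg[OF s])
    show "real (card (multiples F \<inter> {1..int N})) \<le> dens (multiples F) * real N + C" for N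
      using C[of N] by linarith
  qed
  finally have "e * zeta_on UNIV s' \<le> C * zeta_on UNIV s" by (simp add: e_def algebra_simps)
  then show False using s'(3) e by (simp add: field_simps)
qed

text \<open>
  Each partial sum involves only finitely many elements of \<open>A\<close>, and the bound for finite sets has no
  error term, so it passes to the limit. Counting functions obey such a bound only up to an error that
  depends on the finite set; this is the reason for working with zeta sums.
\<close>
lemma zeta_on_multiples:
  assumes A: "0 \<notin> A" and s: "s > 1"
  shows "zeta_on (multiples A) s \<le> inner_density A * zeta_on UNIV s"
  unfolding zeta_on_def[of "multiples A"]
proof (rule suminf_le_const[OF summable_zeta_on[OF s]])
  fix N
  define F where "F = {a\<in>A. a \<le> N}"
  have F: "finite F" "0 \<notin> F" "F \<subseteq> A" using A by (auto simp: F_def)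
  have "(\<Sum>n<N. indicator (multiples A) (int n) * real n powr (- s))
      = (\<Sum>n<N. indicator (multiples F) (int n) * real n powr (- s))"
  proof (rule sum.cong[OF refl])
    fix n assume "n \<in> {..<N}"
    then have "int n \<in> multiples A \<longleftrightarrow> int n \<in> multiples F" if "n > 0"
      using that by (auto simp: mem_multiples F_def int_dvd_int_iff dest: dvd_imp_le intro: less_imp_le order_trans)
    then show "indicator (multiples A) (int n) * real n powr (- s)
        = indicator (multiples F) (int n) * real n powr (- s)"
      by (cases "n = 0") (auto simp: indicator_def)
  qed
  also have "\<dots> \<le> zeta_on (multiples F) s"
    unfolding zeta_on_def by (rule sum_le_suminf[OF summable_zeta_on[OF s]]) auto
  also have "\<dots> \<le> dens (multiples F) * zeta_on UNIV s"
    by (rule zeta_on_multiples_finite[OF F(1,2) s])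
  also have "\<dots> \<le> inner_density A * zeta_on UNIV s"
    by (intro mult_right_mono inner_density_upper zeta_on_nonneg s A F)
  finally show "(\<Sum>n<N. indicator (multiples A) (int n) * real n powr (- s)) \<le> inner_density A * zeta_on UNIV s" .
qed

text \<open>
  If the multiples had lower density above \<open>c > inner_density A\<close>, their zeta sums would exceed
  \<open>c * zeta - C\<close> with a constant \<open>C\<close>, contradicting the previous bound near \<open>s = 1\<close>.
\<close>
lemma lower_density_multiples_le:
  assumes A: "0 \<notin> A"
  shows "lower_density (multiples A) \<le> ereal (inner_density A)"
proof (rule ccontr)
  let ?M = "multiples A"
  assume "\<not> ?thesis"
  then obtain c where c: "inner_density A < c" "ereal c < lower_density ?M"
    using ereal_dense2[of "ereal (inner_density A)"] by (auto simp: not_le)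
  then have "\<forall>\<^sub>F N in sequentially. ereal c < ereal (real (card (?M \<inter> {1..int N})) / real N)"
    unfolding lower_density_def by (rule_tac less_LiminfD) simp
  then obtain N0 where N0: "\<And>N. N \<ge> N0 \<Longrightarrow> c < real (card (?M \<inter> {1..int N})) / real N"
    by (auto simp: eventually_sequentially)
  define C where "C = \<bar>c\<bar> * real (Suc N0)"
  have C: "real (card (?M \<inter> {1..int N})) \<ge> c * real N - C" for N
  proof (cases "N > N0")
    case True
    then have "c * real N \<le> real (card (?M \<inter> {1..int N}))"
      using N0[of N] by (simp add: field_simps)
    then show ?thesis by (simp add: C_def) (smt (verit) mult_nonneg_nonneg abs_ge_zero of_nat_0_le_iff)
  next
    case False
    then have "c * real N \<le> C" unfolding C_def
      by (intro mult_mono) auto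
    then show ?thesis by linarith
  qed
  obtain s where s: "1 < s" "zeta_on UNIV s > C / (c - inner_density A)"
    using zeta_unbounded[of 2] by (metis one_less_numeral_iff semiring_norm(76))
  have "c * zeta_on UNIV s - C \<le> zeta_on ?M s"
    by (rule zeta_on_ge[OF s(1) C])
  also have "\<dots> \<le> inner_density A * zeta_on UNIV s" by (rule zeta_on_multiples[OF A s(1)])
  finally have "(c - inner_density A) * zeta_on UNIV s \<le> C" by (simp add: algebra_simps)
  then show False using s(2) c(1) by (simp add: field_simps)
qed

lemma lower_density_multiples_ge:
  assumes A: "0 \<notin> A"
  shows "ereal (inner_density A) \<le> lower_density (multiples A)"
proof (rule ccontr)
  assume "\<not> ?thesis"
  then obtain c where c: "lower_density (multiples A) < ereal c" "c < inner_density A"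
    using ereal_dense2[of _ "ereal (inner_density A)"] by (auto simp: not_le)
  obtain F where F: "finite F" "F \<subseteq> A" "c < dens (multiples F)"
    using inner_density_approx[OF c(2)] by blast
  have per: "periodic (multiples F)" using F A by (intro periodic_multiples(2)) auto
  have "ereal (dens (multiples F)) = liminf (\<lambda>N. ereal (real (card (multiples F \<inter> {1..int N})) / real N))"
    using tendsto_dens[OF per] by (intro lim_imp_Liminf[symmetric]) auto
  also have "\<dots> \<le> lower_density (multiples A)"
    unfolding lower_density_def
    by (intro Liminf_mono always_eventually allI ereal_less_eq(3)[THEN iffD2] divide_right_mono)
       (use multiples_mono[OF F(2)] in \<open>auto intro!: card_mono\<close>)
  finally show False using c(1) F(3) by (meson ereal_less_eq(3) less_le_trans not_le less_imp_le order_trans)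
qed

theorem davenport_erdos:
  assumes "0 \<notin> A"
  shows "lower_density (multiples A) = ereal (inner_density A)"
  using lower_density_multiples_le[OF assms] lower_density_multiples_ge[OF assms] by (rule antisym)

section \<open>Quotients of taut sets\<close>

lemma dens_multiples_Un_coprime:
  assumes F: "finite F" "0 \<notin> F" and G: "finite G" "0 \<notin> G"
    and cop: "\<And>f g. f \<in> F \<Longrightarrow> g \<in> G \<Longrightarrow> coprime f g"
  shows "dens (multiples (F \<union> G))
    = dens (multiples F) + dens (multiples G) - dens (multiples F) * dens (multiples G)"
proof -
  let ?X = "multiples F" and ?Y = "multiples G"
  have per: "periodic ?X" "periodic ?Y" using periodic_multiples F G by auto
  have "coprime (\<Prod>F) (\<Prod>G)" using cop by (intro prod_coprime_left prod_coprime_right) auto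
  then have "coprime (int (\<Prod>F)) (int (\<Prod>G))" by (simp only: coprime_int_iff)
  then have "dens (?X \<inter> ?Y) = dens ?X * dens ?Y"
    by (rule dens_Int_indep[OF periodic_multiples(1)[OF F] periodic_multiples(1)[OF G]])
  moreover have "dens (?X \<union> ?Y) = dens (?X - ?Y) + dens ?Y"
    using dens_Un_disjoint[of "?X - ?Y" ?Y] per by (auto simp: Un_absorb2)
  ultimately show ?thesis
    using dens_Int_Diff[OF per] by (simp add: multiples_Un)
qed

lemma inner_density_le_1: "0 \<notin> A \<Longrightarrow> inner_density A \<le> 1"
  by (rule inner_density_least, rule dens_le_1, rule periodic_multiples(2)) auto

lemma inner_density_empty [simp]: "inner_density {} = 0"
  by (simp add: inner_density_def multiples_def)

lemma inner_density_mono: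
  assumes "0 \<notin> A'" "A \<subseteq> A'"
  shows "inner_density A \<le> inner_density A'"
  by (rule inner_density_least, rule inner_density_upper) (use assms in auto)

lemma inner_density_UNION_le:
  assumes I: "finite I" and A: "\<And>i. i \<in> I \<Longrightarrow> 0 \<notin> A i"
  shows "inner_density (\<Union>i\<in>I. A i) \<le> (\<Sum>i\<in>I. inner_density (A i))"
proof (rule inner_density_least)
  fix F assume F: "finite F" "F \<subseteq> (\<Union>i\<in>I. A i)"
  have per: "periodic (multiples (F \<inter> A i))" if "i \<in> I" for i
    by (rule periodic_multiples(2)) (use F A that in auto)
  have "multiples F = (\<Union>i\<in>I. multiples (F \<inter> A i))"
    using F(2) unfolding mem_multiples set_eq_iff by (fastforce simp: mem_multiples)
  also have "dens \<dots> \<le> (\<Sum>i\<in>I. dens (multiples (F \<inter> A i)))"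
    by (rule dens_UNION_le[OF I per])
  also have "\<dots> \<le> (\<Sum>i\<in>I. inner_density (A i))"
    by (intro sum_mono inner_density_upper) (use F A in auto)
  finally show "dens (multiples F) \<le> (\<Sum>i\<in>I. inner_density (A i))" .
qed

text \<open>
  A zero-one law. If the subsets free of small primes all kept density at least \<open>e\<close>, then a
  finite set that nearly exhausts \<open>inner_density A\<close> could be joined with a finite set made of new
  primes only; by independence the union would exceed \<open>inner_density A\<close>, unless that is 1 already.
\<close>
lemma inner_density_coprime_fact_small:
  assumes A: "0 \<notin> A" and lt: "inner_density A < 1" and e: "e > 0"
  shows "\<exists>P0. \<forall>P\<ge>P0. inner_density {a\<in>A. coprime a (fact P)} < e"
proof (rule ccontr)
  assume neg: "\<not> ?thesis"
  have ge: "inner_density {a\<in>A. coprime a (fact P)} \<ge> e" for P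
  proof -
    obtain P' where P': "P' \<ge> P" "inner_density {a\<in>A. coprime a (fact P')} \<ge> e"
      using neg by (auto simp: not_less)
    have "{a\<in>A. coprime a (fact P')} \<subseteq> {a\<in>A. coprime a (fact P)}"
      using P'(1) coprime_divisors[OF dvd_refl fact_dvd[OF P'(1)]] by auto
    then show ?thesis using P'(2) inner_density_mono[of "{a\<in>A. coprime a (fact P)}"] A
      by (smt (verit) mem_Collect_eq)
  qed
  define D where "D = inner_density A"
  \<comment> \<open>A density above \<open>D - \<eta>\<close>, joined with an independent density \<open>e / 2\<close>, exceeds \<open>D\<close>.\<close>
  define \<eta> where "\<eta> = (1 - D) * e / 2"
  have "\<eta> > 0" using lt e by (simp add: \<eta>_def D_def)
  then obtain F where F: "finite F" "F \<subseteq> A" "D - \<eta> < dens (multiples F)"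
    using inner_density_approx[of "D - \<eta>" A] by (auto simp: D_def)
  \<comment> \<open>\<open>P\<close> bounds every element of \<open>F\<close>, so each of them divides \<open>fact P\<close>.\<close>
  define P where "P = \<Sum>F"
  have "e / 2 < inner_density {a\<in>A. coprime a (fact P)}" using ge[of P] e by simp
  then obtain G where G: "finite G" "G \<subseteq> {a\<in>A. coprime a (fact P)}" "e / 2 < dens (multiples G)"
    by (rule inner_density_approx)
  have F0: "0 \<notin> F" and G0: "0 \<notin> G" using F G A by auto
  have cop: "coprime f g" if "f \<in> F" "g \<in> G" for f g
  proof -
    have "f \<le> P" unfolding P_def using member_le_sum[of f F "\<lambda>x. x"] that F(1) by simp
    then have "f dvd fact P" using that F0 by (intro dvd_fact) (auto simp: Suc_le_eq intro: gr0I)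
    moreover have "coprime g (fact P)" using that G(2) by auto
    ultimately show ?thesis using coprime_divisors[OF dvd_refl] coprime_commute by blast
  qed
  have "dens (multiples (F \<union> G)) \<le> D" unfolding D_def
    by (rule inner_density_upper) (use A F G in auto)
  moreover have "dens (multiples F) \<le> D" unfolding D_def
    by (rule inner_density_upper) (use A F in auto)
  moreover have "dens (multiples (F \<union> G))
      = dens (multiples F) + (1 - dens (multiples F)) * dens (multiples G)"
    using dens_multiples_Un_coprime[OF F(1) F0 G(1) G0 cop] by (simp add: algebra_simps)
  moreover have "(1 - D) * (e / 2) \<le> (1 - dens (multiples F)) * dens (multiples G)"
    using calculation(2) G(3) e lt by (intro mult_mono) (auto simp: D_def)
  ultimately show False using F(3) by (simp add: \<eta>_def)
qed

text \<open>
  A number congruent to 1 modulo \<open>q\<close> can only be a multiple of elements coprime to \<open>q\<close>, so these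
  elements alone must cover almost all of that residue class, and by independence almost all integers.
\<close>
lemma inner_density_coprime_eq_1:
  assumes A: "0 \<notin> A" and one: "inner_density A = 1" and q: "q > 0"
  shows "inner_density {a\<in>A. coprime a q} = 1"
proof (rule ccontr)
  let ?D = "inner_density {a\<in>A. coprime a q}"
  assume "?D \<noteq> 1"
  moreover have "?D \<le> 1" by (rule inner_density_le_1) (use A in auto)
  ultimately have lt: "?D < 1" by simp
  \<comment> \<open>The threshold allows for the factor \<open>q\<close> lost by restricting to one residue class.\<close>
  then have "1 - (1 - ?D) / q < inner_density A" using one q by simp
  then obtain F where F: "finite F" "F \<subseteq> A" "1 - (1 - ?D) / q < dens (multiples F)"
    by (rule inner_density_approx)
  define G where "G = {a\<in>F. coprime a q}"
  have F0: "0 \<notin> F" and G: "finite G" "0 \<notin> G" "G \<subseteq> {a\<in>A. coprime a q}" using F A by (auto simp: G_def)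
  let ?R = "{n. int q dvd n - 1}"
  have R: "periodic_mod (int q) ?R" using q by (intro periodic_mod_residue) simp
  have G': "periodic_mod (int (\<Prod>G)) (UNIV - multiples G)"
    using periodic_multiples(1)[OF G(1,2)] unfolding periodic_mod_def
    by (metis Diff_iff UNIV_I dvd_minus_iff minus_diff_eq)
  have cop: "coprime (int q) (int (\<Prod>G))"
    unfolding coprime_int_iff by (rule prod_coprime_right) (auto simp: G_def coprime_commute)
  have pF: "periodic (multiples F)" and pG: "periodic (multiples G)"
    using periodic_multiples(2) F F0 G by auto
  have sub: "?R \<inter> (UNIV - multiples G) \<subseteq> UNIV - multiples F"
  proof
    fix n assume n: "n \<in> ?R \<inter> (UNIV - multiples G)"
    have False if f: "f \<in> F" "int f dvd n" for f
    proof -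
      have "coprime (int f) (int q)"
      proof (rule coprimeI)
        fix c assume "c dvd int f" "c dvd int q"
        then have "c dvd n" "c dvd n - 1" using f n by (auto intro: dvd_trans)
        then show "is_unit c" using dvd_diff[of c n "n - 1"] by simp
      qed
      then show False using f n by (auto simp: G_def mem_multiples)
    qed
    then show "n \<in> UNIV - multiples F" by (auto simp: mem_multiples)
  qed
  have "1 / q * (1 - dens (multiples G)) = dens (?R \<inter> (UNIV - multiples G))"
    using dens_Int_indep[OF R G' cop] dens_residue[of "int q" 1] q dens_Diff[of UNIV "multiples G"] pG by simp
  also have "\<dots> \<le> dens (UNIV - multiples F)"
    by (rule dens_mono[OF _ _ sub]) (use R pF pG periodic_mod_imp_periodic in blast)+
  also have "\<dots> = 1 - dens (multiples F)" using dens_Diff[of UNIV "multiples F"] pF by simp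
  finally have "1 - dens (multiples G) \<le> q * (1 - dens (multiples F))" using q by (simp add: field_simps)
  also have "\<dots> < 1 - ?D" using F(3) q by (simp add: field_simps)
  finally have "?D < dens (multiples G)" by simp
  moreover have "dens (multiples G) \<le> ?D" by (rule inner_density_upper) (use A G in auto)
  ultimately show False by simp
qed

text \<open>
  If \<open>A\<close> covered almost all integers, it would still do so without a chosen \<open>a \<in> A\<close>, since the
  elements coprime to \<open>a\<close> suffice. The remaining \<open>d * a'\<close> then cover almost all multiples of \<open>d\<close>,
  so \<open>d * a\<close> could be removed from \<open>B\<close> without loss of density, against tautness.
\<close>
lemma taut_quotient_inner_density:
  assumes B: "0 \<notin> B" "taut B" and A: "\<And>a. a \<in> A \<Longrightarrow> d * a \<in> B" "1 \<notin> A"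
  shows "inner_density A < 1"
proof (rule ccontr)
  assume neg: "\<not> ?thesis"
  have A0: "0 \<notin> A" using A(1)[of 0] B by auto
  then have one: "inner_density A = 1" using neg inner_density_le_1[OF A0] by simp
  then obtain a where a: "a \<in> A" by fastforce
  have d: "d > 0" using A(1)[OF a] B(1) by (cases d) auto
  have a0: "a > 0" using a A0 by (cases a) auto
  define b where "b = d * a"
  have b: "b \<in> B" using A(1)[OF a] by (simp add: b_def)
  let ?A = "{a'\<in>A. coprime a' a}"
  have one': "inner_density ?A = 1" by (rule inner_density_coprime_eq_1[OF A0 one a0])
  have na: "a \<notin> ?A" using a A(2) by auto
  have "inner_density B \<le> inner_density (B - {b})"
  proof (rule inner_density_least)
    fix F assume F: "finite F" "F \<subseteq> B"
    show "dens (multiples F) \<le> inner_density (B - {b})"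
    proof (rule field_le_epsilon)
      fix e :: real assume e: "e > 0"
      have "1 - e < inner_density ?A" using one' e by simp
      then obtain G where G: "finite G" "G \<subseteq> ?A" "1 - e < dens (multiples G)"
        by (rule inner_density_approx)
      have G0: "0 \<notin> G" using G A0 by auto
      have pG: "periodic (multiples G)" by (rule periodic_multiples(2)[OF G(1) G0])
      define F' where "F' = (F - {b}) \<union> (*) d ` G"
      have F': "finite F'" "F' \<subseteq> B - {b}"
        using F G A na d by (auto simp: F'_def b_def)
      have pF': "periodic (multiples F')" "periodic (multiples F)"
        using F F' B by (auto intro!: periodic_multiples(2))
      let ?E = "(*) (int d) ` (UNIV - multiples G)"
      have E: "periodic ?E" "dens ?E = dens (UNIV - multiples G) / d"
        using dens_dilate[of "UNIV - multiples G" "int d"] pG d by auto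
      have "dens ?E \<le> dens (UNIV - multiples G)" unfolding E(2)
        using d dens_nonneg[of "UNIV - multiples G"] pG
        by (auto simp: divide_le_eq mult_left_le intro!: mult_left_mono[of 1 _ "dens (UNIV - multiples G)", simplified])
      also have "\<dots> < e" using dens_Diff[of UNIV "multiples G"] pG G(3) by simp
      finally have Ee: "dens ?E < e" .
      have "multiples F \<subseteq> multiples F' \<union> ?E"
      proof
        fix n assume "n \<in> multiples F"
        then obtain f where f: "f \<in> F" "int f dvd n" by (auto simp: mem_multiples)
        show "n \<in> multiples F' \<union> ?E"
        proof (cases "f = b")
          case False
          then show ?thesis using f by (auto simp: mem_multiples F'_def)
        next
          case True
          then have "int d dvd n" using f(2) by (auto simp: b_def dest: dvd_mult_left)
          then obtain m where m: "n = int d * m" by (auto simp: dvd_def)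
          show ?thesis
          proof (cases "m \<in> multiples G")
            case True
            then obtain g where "g \<in> G" "int g dvd m" by (auto simp: mem_multiples)
            then have "d * g \<in> F'" "int (d * g) dvd n" by (auto simp: F'_def m)
            then show ?thesis unfolding mem_multiples Un_iff by blast
          next
            case False
            then show ?thesis using m by auto
          qed
        qed
      qed
      then have "dens (multiples F) \<le> dens (multiples F' \<union> ?E)"
        using pF' E by (intro dens_mono) auto
      also have "\<dots> \<le> dens (multiples F') + dens ?E" by (rule dens_Un_le) (use pF' E in auto)
      also have "dens (multiples F') \<le> inner_density (B - {b})"
        by (rule inner_density_upper) (use B F' in auto)
      finally show "dens (multiples F) \<le> inner_density (B - {b}) + e" using Ee by linarith
    qed
  qed
  moreover have "lower_density (multiples (B - {b})) < lower_density (multiples B)"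
    using B(2) b by (simp add: taut_def)
  ultimately show False using davenport_erdos[of B] davenport_erdos[of "B - {b}"] B(1) by simp
qed

text \<open>
  These quotients describe which numbers \<open>g * w\<close> are multiples of \<open>B\<close>. They split into finitely many
  families according to the value of \<open>gcd b g\<close>; no family contains 1 because no \<open>b\<close> divides
  \<open>g\<close>, so each has inner density below 1 by tautness, and the zero-one
  law makes its part coprime to \<open>fact P\<close> small.
\<close>
lemma taut_gcd_quotient_small:
  assumes B: "0 \<notin> B" "taut B" and g: "g > 0" "\<And>b. b \<in> B \<Longrightarrow> \<not> b dvd g" and e: "e > 0"
  shows "\<exists>P0. \<forall>P\<ge>P0. inner_density {b div gcd b g | b. b \<in> B \<and> coprime (b div gcd b g) (fact P)} < e"
proof -
  \<comment> \<open>\<open>A d\<close> collects the quotients with \<open>gcd b g = d\<close>; multiplied by \<open>d\<close> they lie in \<open>B\<close>.\<close>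
  define A where "A = (\<lambda>d. {b div d | b. b \<in> B \<and> gcd b g = d})"
  define D where "D = {d. d dvd g}"
  have D: "finite D" "D \<noteq> {}" using g(1) by (auto simp: D_def)
  have mult: "d * a \<in> B" if "a \<in> A d" for a d
    using that by (auto simp: A_def)
  have A1: "1 \<notin> A d" for d
  proof
    assume "1 \<in> A d"
    then obtain b where b: "b \<in> B" "gcd b g = d" "b div d = 1" by (auto simp: A_def)
    then have "b = d" by (metis dvd_mult_div_cancel gcd_dvd1 mult.right_neutral)
    then show False using g(2)[OF b(1)] b(2) by (metis gcd_dvd2)
  qed
  have A0: "0 \<notin> A d" for d using mult[of 0 d] B(1) by auto
  have "\<exists>P0. \<forall>P\<ge>P0. inner_density {a\<in>A d. coprime a (fact P)} < e / card D" for d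
    by (rule inner_density_coprime_fact_small[OF A0 taut_quotient_inner_density[OF B mult A1]])
       (use e D in \<open>auto simp: card_gt_0_iff\<close>)
  then obtain P0 where P0: "\<And>d P. P \<ge> P0 d \<Longrightarrow> inner_density {a\<in>A d. coprime a (fact P)} < e / card D"
    by metis
  show ?thesis
  proof (intro exI allI impI)
    fix P assume P: "P \<ge> (\<Sum>d\<in>D. P0 d)"
    have Pd: "P \<ge> P0 d" if "d \<in> D" for d
      using P member_le_sum[OF that, of P0] D by simp
    have "{b div gcd b g | b. b \<in> B \<and> coprime (b div gcd b g) (fact P)}
        \<subseteq> (\<Union>d\<in>D. {a\<in>A d. coprime a (fact P)})"
      by (auto simp: A_def D_def)
    then have "inner_density {b div gcd b g | b. b \<in> B \<and> coprime (b div gcd b g) (fact P)}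
        \<le> inner_density (\<Union>d\<in>D. {a\<in>A d. coprime a (fact P)})"
      by (rule inner_density_mono[rotated]) (use A0 in auto)
    also have "\<dots> \<le> (\<Sum>d\<in>D. inner_density {a\<in>A d. coprime a (fact P)})"
      by (rule inner_density_UNION_le[OF D(1)]) (use A0 in auto)
    also have "\<dots> < (\<Sum>d\<in>D. e / card D)"
      by (rule sum_strict_mono[OF D]) (use P0 Pd in blast)
    also have "\<dots> = e" using D by simp
    finally show "inner_density {b div gcd b g | b. b \<in> B \<and> coprime (b div gcd b g) (fact P)} < e" .
  qed
qed

section \<open>Shifts that avoid a set of multiples\<close>

lemma ex_residue_avoiding:
  fixes a c :: "int \<Rightarrow> int"
  assumes S: "finite S" and p: "prime p" and cop: "\<And>k. k \<in> S \<Longrightarrow> coprime (a k) (c k)"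
    and card: "card {k\<in>S. \<not> int p dvd c k} < p"
  shows "\<exists>u::nat. \<forall>k\<in>S. \<not> int p dvd a k + c k * int u"
proof -
  let ?S = "{k\<in>S. \<not> int p dvd c k}"
  define bad where "bad = (\<lambda>k. {u\<in>{..<p}. int p dvd a k + c k * int u})"
  have "card (bad k) \<le> 1" if k: "k \<in> ?S" for k
  proof -
    have "u = v" if uv: "u \<in> bad k" "v \<in> bad k" for u v
    proof -
      have "int p dvd (a k + c k * int u) - (a k + c k * int v)"
        using uv by (intro dvd_diff) (auto simp: bad_def)
      then have "int p dvd c k * (int u - int v)" by (simp add: algebra_simps)
      then have "int p dvd int u - int v" using k p by (simp add: prime_dvd_mult_iff)
      then have "int u mod int p = int v mod int p" by (simp add: mod_eq_dvd_iff)
      then show "u = v" using uv by (simp add: bad_def)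
    qed
    then show ?thesis using card_le_Suc0_iff_eq[of "bad k"] by (auto simp: bad_def)
  qed
  then have "card (\<Union>k\<in>?S. bad k) \<le> (\<Sum>k\<in>?S. 1)"
    using S by (intro order_trans[OF card_UN_le sum_mono]) auto
  then have "card (\<Union>k\<in>?S. bad k) < card {..<p}" using card by simp
  then have "\<not> {..<p} \<subseteq> (\<Union>k\<in>?S. bad k)"
    using S card_mono[of "\<Union>k\<in>?S. bad k" "{..<p}"] by (fastforce simp: bad_def)
  then obtain u where u: "u < p" "u \<notin> (\<Union>k\<in>?S. bad k)" by auto
  have "\<not> int p dvd a k + c k * int u" if k: "k \<in> S" for k
  proof (cases "int p dvd c k")
    case True
    then have "\<not> int p dvd a k"
      using cop[OF k] p by (meson coprime_common_divisor not_prime_unit prime_nat_int_transfer)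
    then show ?thesis using True by (simp add: dvd_add_left_iff)
  qed (use u k in \<open>auto simp: bad_def\<close>)
  then show ?thesis by blast
qed

lemma coprime_int_primeI:
  assumes "\<And>p::nat. prime p \<Longrightarrow> int p dvd x \<Longrightarrow> int p dvd y \<Longrightarrow> False"
  shows "coprime x y"
proof (rule ccontr)
  assume "\<not> coprime x y"
  then have "nat (gcd x y) \<noteq> 1" by (auto simp: coprime_iff_gcd_eq_1 nat_eq_iff)
  then obtain p where p: "prime p" "p dvd nat (gcd x y)" using prime_factor_nat by blast
  then have "int p dvd gcd x y" by (simp add: int_dvd_int_iff[symmetric])
  then show False using assms[OF p(1)] by simp
qed

text \<open>
  Each \<open>k\<close> with \<open>p\<close> not dividing \<open>c k\<close> excludes a single residue of \<open>t\<close> modulo \<open>p\<close>, and the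
  other \<open>k\<close> exclude none; fewer than \<open>p\<close> exclusions leave a residue, and the Chinese remainder
  theorem combines the primes dividing \<open>N\<close>.
\<close>
lemma ex_coprime_shift:
  fixes a c :: "int \<Rightarrow> int"
  assumes S: "finite S" and N: "N > 0" and cop: "\<And>k. k \<in> S \<Longrightarrow> coprime (a k) (c k)"
    and card: "\<And>p. prime p \<Longrightarrow> int p dvd N \<Longrightarrow> card {k\<in>S. \<not> int p dvd c k} < p"
  shows "\<exists>t. \<forall>k\<in>S. coprime (a k + c k * t) N"
proof -
  define PS where "PS = {p. prime p \<and> int p dvd N}"
  have "PS \<subseteq> {..nat N}" using N by (auto simp: PS_def dest: zdvd_imp_le)
  then have fin: "finite PS" by (rule finite_subset) simp
  have "\<forall>p\<in>PS. \<exists>u::nat. \<forall>k\<in>S. \<not> int p dvd a k + c k * int u"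
    using ex_residue_avoiding[OF S _ cop card] by (auto simp: PS_def)
  then obtain u where u: "\<And>p k. p \<in> PS \<Longrightarrow> k \<in> S \<Longrightarrow> \<not> int p dvd a k + c k * int (u p)"
    by metis
  have "\<exists>t. \<forall>p\<in>PS. [t = u p] (mod p)"
    by (rule chinese_remainder_nat[OF fin]) (auto simp: PS_def primes_coprime)
  then obtain t where t: "\<And>p. p \<in> PS \<Longrightarrow> [t = u p] (mod p)" by blast
  have "coprime (a k + c k * int t) N" if k: "k \<in> S" for k
  proof (rule coprime_int_primeI)
    fix p :: nat assume p: "prime p" "int p dvd a k + c k * int t" "int p dvd N"
    then have pS: "p \<in> PS" by (simp add: PS_def)
    have "int p dvd int t - int (u p)"
      using t[OF pS] by (simp add: cong_iff_dvd_diff flip: cong_int_iff)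
    then have "int p dvd (a k + c k * int t) - c k * (int t - int (u p))"
      by (rule dvd_diff[OF p(2) dvd_mult])
    then have "int p dvd a k + c k * int (u p)" by (simp add: algebra_simps)
    then show False using u[OF pS k] by simp
  qed
  then show ?thesis by blast
qed

lemma dvd_div_gcd:
  fixes b :: nat
  assumes b: "b > 0" and dvd: "int b dvd int g * w"
  shows "int (b div gcd b g) dvd w"
proof -
  let ?d = "gcd b g"
  have d: "?d > 0" using b by simp
  have "int ?d * int (b div ?d) dvd int ?d * (int (g div ?d) * w)"
    using dvd by (simp flip: of_nat_mult mult.assoc)
  then have "int (b div ?d) dvd int (g div ?d) * w" using d b by simp
  moreover have "coprime (int (b div ?d)) (int (g div ?d))"
    using b by (simp add: div_gcd_coprime)
  ultimately show ?thesis by (simp add: coprime_dvd_mult_right_iff)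
qed

lemma card_shift_window_le:
  "card ({n. n + k \<in> X} \<inter> {1..int N}) \<le> card (X \<inter> {1..int N}) + nat \<bar>k\<bar>"
proof -
  have "(\<lambda>n. n + k) ` ({n. n + k \<in> X} \<inter> {1..int N})
      \<subseteq> (X \<inter> {1..int N}) \<union> ({1 + k..0} \<union> {int N + 1..int N + k})"
    by auto
  then have "card ((\<lambda>n. n + k) ` ({n. n + k \<in> X} \<inter> {1..int N}))
      \<le> card ((X \<inter> {1..int N}) \<union> ({1 + k..0} \<union> {int N + 1..int N + k}))"
    by (rule card_mono[rotated]) auto
  also have "\<dots> \<le> card (X \<inter> {1..int N}) + (card {1 + k..0} + card {int N + 1..int N + k})"
    by (intro order_trans[OF card_Un_le] add_left_mono card_Un_le)
  also have "card {1 + k..0} + card {int N + 1..int N + k} = nat \<bar>k\<bar>" by simp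
  finally show ?thesis by (simp add: card_image)
qed

text \<open>
  Take \<open>F\<close> so large that the multiples of \<open>B\<close> outside those of \<open>F\<close> have density close to 0 along
  a subsequence of \<open>N\<close>; such a subsequence exists because the lower density of the multiples of \<open>B\<close>
  is at most \<open>inner_density B\<close>. Finitely many shifts of so thin a set cannot cover a set of density
  \<open>c\<close>.
\<close>
lemma ex_free_shift:
  assumes B: "0 \<notin> B" and V: "periodic V" and S: "finite S" and c: "c > 0"
    and ge: "\<And>F. finite F \<Longrightarrow> F \<subseteq> B \<Longrightarrow> c \<le> dens (V - (\<Union>k\<in>S. {n. n + k \<in> multiples F}))"
  shows "\<exists>n\<in>V. \<forall>k\<in>S. n + k \<notin> multiples B"
proof (rule ccontr)
  assume neg: "\<not> ?thesis"
  define s where "s = real (card S)"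
  \<comment> \<open>The \<open>s\<close> shifts of a set of density at most \<open>2 * \<epsilon>\<close> have total density at most \<open>c / 4\<close>.\<close>
  define \<epsilon> where "\<epsilon> = c / (8 * (s + 1))"
  have s: "s \<ge> 0" and e: "\<epsilon> > 0" using c by (auto simp: s_def \<epsilon>_def)
  define D where "D = inner_density B"
  obtain F where F: "finite F" "F \<subseteq> B" "D - \<epsilon> < dens (multiples F)"
    using inner_density_approx[of "D - \<epsilon>" B] e by (auto simp: D_def)
  let ?M = "multiples B" and ?F = "multiples F"
  have pF: "periodic ?F" by (rule periodic_multiples(2)) (use F B in auto)
  define X where "X = V - (\<Union>k\<in>S. {n. n + k \<in> ?F})"
  have pX: "periodic X" unfolding X_def
    by (intro periodic_Diff V periodic_UNION S periodic_shift pF)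
  define K where "K = (\<Sum>k\<in>S. nat \<bar>k\<bar>)"
  define cnt where "cnt = (\<lambda>X N. real (card (X \<inter> {1..int N})))"
  have bound: "cnt X N \<le> s * (cnt ?M N - cnt ?F N) + real K" for N
  proof -
    have "X \<subseteq> (\<Union>k\<in>S. {n. n + k \<in> ?M - ?F})" using neg by (auto simp: X_def)
    then have "card (X \<inter> {1..int N}) \<le> card (\<Union>k\<in>S. {n. n + k \<in> ?M - ?F} \<inter> {1..int N})"
      using S by (intro card_mono) auto
    also have "\<dots> \<le> (\<Sum>k\<in>S. card ({n. n + k \<in> ?M - ?F} \<inter> {1..int N}))"
      by (rule card_UN_le[OF S])
    also have "\<dots> \<le> (\<Sum>k\<in>S. card ((?M - ?F) \<inter> {1..int N}) + nat \<bar>k\<bar>)"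
      by (intro sum_mono card_shift_window_le)
    also have "\<dots> = card S * card ((?M - ?F) \<inter> {1..int N}) + K"
      by (simp add: sum.distrib K_def)
    also have "card ((?M - ?F) \<inter> {1..int N}) = card (?M \<inter> {1..int N}) - card (?F \<inter> {1..int N})"
      using multiples_mono[OF F(2)] by (subst card_Diff_subset[symmetric]) (auto intro: arg_cong[of _ _ card])
    finally have "real (card (X \<inter> {1..int N}))
        \<le> real (card S * (card (?M \<inter> {1..int N}) - card (?F \<inter> {1..int N})) + K)"
      by (simp only: of_nat_le_iff)
    moreover have "card (?F \<inter> {1..int N}) \<le> card (?M \<inter> {1..int N})"
      using multiples_mono[OF F(2)] by (intro card_mono) auto
    ultimately show ?thesis
      unfolding cnt_def s_def by (simp only: of_nat_add of_nat_mult of_nat_diff)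
  qed
  have tendsto_cnt: "(\<lambda>N. cnt Y N / real N) \<longlonglongrightarrow> dens Y" if "periodic Y" for Y
    using tendsto_dens[OF that] by (simp add: cnt_def)
  have "c \<le> dens X" unfolding X_def by (rule ge[OF F(1,2)])
  then have ev1: "\<forall>\<^sub>F N in sequentially. cnt X N / real N > c / 2"
    using c by (intro order_tendstoD(1)[OF tendsto_cnt[OF pX]]) auto
  have ev2: "\<forall>\<^sub>F N in sequentially. cnt ?F N / real N > D - \<epsilon>"
    by (rule order_tendstoD(1)[OF tendsto_cnt[OF pF] F(3)])
  have ev3: "\<forall>\<^sub>F N in sequentially. real K / real N < c / 8"
    using c by (intro order_tendstoD(2)[OF lim_const_over_n]) auto
  have ev4: "\<forall>\<^sub>F N in sequentially. N > (0::nat)" by (rule eventually_gt_at_top)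
  have "\<not> (\<forall>\<^sub>F N in sequentially. cnt ?M N / real N \<ge> D + \<epsilon>)"
  proof
    assume "\<forall>\<^sub>F N in sequentially. cnt ?M N / real N \<ge> D + \<epsilon>"
    then have "ereal (D + \<epsilon>) \<le> lower_density ?M"
      unfolding lower_density_def cnt_def by (intro Liminf_bounded) auto
    also have "\<dots> \<le> ereal D" unfolding D_def by (rule lower_density_multiples_le[OF B])
    finally show False using e by simp
  qed
  moreover have "\<forall>\<^sub>F N in sequentially. cnt ?M N / real N \<ge> D + \<epsilon>"
    using ev1 ev2 ev3 ev4
  proof eventually_elim
    case (elim N)
    show ?case
    proof (rule ccontr)
      assume "\<not> ?thesis"
      then have "cnt ?M N / real N - cnt ?F N / real N \<le> 2 * \<epsilon>" using elim by simp
      then have "s * (cnt ?M N / real N - cnt ?F N / real N) \<le> s * (2 * \<epsilon>)"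
        using s by (rule mult_left_mono)
      also have "s * (2 * \<epsilon>) \<le> c / 4" using s c by (simp add: \<epsilon>_def field_simps)
      finally have *: "s * (cnt ?M N / real N - cnt ?F N / real N) \<le> c / 4" .
      have "cnt X N / real N \<le> (s * (cnt ?M N - cnt ?F N) + real K) / real N"
        by (rule divide_right_mono[OF bound]) simp
      also have "\<dots> = s * (cnt ?M N / real N - cnt ?F N / real N) + real K / real N"
        by (simp add: add_divide_distrib flip: diff_divide_distrib)
      also have "\<dots> \<le> c / 4 + c / 8" using * elim by linarith
      finally show False using elim c by linarith
    qed
  qed
  ultimately show False by simp
qed

text \<open>
  If \<open>p\<close> does not divide \<open>Q div gcd (z + k) Q\<close>, then the full power of \<open>p\<close> in \<open>Q\<close> divides
  \<open>z + k\<close>. For a small prime two such shifts would have a difference of at most \<open>2 * K\<close> divisible by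
  that power, which the square of the factorial in \<open>Q\<close> rules out; for a large prime there are fewer
  than \<open>p\<close> shifts altogether.
\<close>
lemma card_prime_unramified_shifts:
  fixes Q z :: int
  assumes S: "S \<subseteq> {- int K..int K}" and Q: "Q > 0" "fact (2 * K + 1) * fact (2 * K + 1) dvd Q" and p: "prime p"
  shows "card {k\<in>S. \<not> int p dvd Q div gcd (z + k) Q} < p"
proof (cases "p > 2 * K + 1")
  case True
  have "card {k\<in>S. \<not> int p dvd Q div gcd (z + k) Q} \<le> card {- int K..int K}"
    using S by (intro card_mono) auto
  then show ?thesis using True by simp
next
  case False
  define v where "v = multiplicity (int p) Q"
  have pp: "prime (int p)" using p by simp
  have dv: "int p ^ v dvd z + k" if "\<not> int p dvd Q div gcd (z + k) Q" for k
  proof -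
    have "coprime (int p ^ v) (Q div gcd (z + k) Q)"
      using that pp by (simp add: prime_imp_coprime)
    moreover have "int p ^ v dvd Q div gcd (z + k) Q * gcd (z + k) Q"
      by (simp add: v_def multiplicity_dvd)
    ultimately have "int p ^ v dvd gcd (z + k) Q" using coprime_dvd_mult_right_iff by blast
    then show ?thesis using gcd_dvd1 dvd_trans by blast
  qed
  have "k = k'" if k: "k \<in> {k\<in>S. \<not> int p dvd Q div gcd (z + k) Q}"
      and k': "k' \<in> {k\<in>S. \<not> int p dvd Q div gcd (z + k) Q}" for k k'
  proof (rule ccontr)
    assume ne: "k \<noteq> k'"
    have "int p ^ v dvd (z + k) - (z + k')" using k k' dv by (intro dvd_diff) auto
    then have "int p * int p ^ v dvd int p * (k - k')" by simp
    moreover have "int p dvd fact (2 * K + 1)"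
    proof -
      have "p dvd fact (2 * K + 1)" using False p prime_gt_0_nat by (intro dvd_fact) (auto simp: Suc_le_eq)
      then show ?thesis by (metis of_nat_dvd_iff of_nat_fact)
    qed
    moreover have "k - k' dvd fact (2 * K + 1)"
    proof -
      have "nat \<bar>k - k'\<bar> dvd fact (2 * K + 1)"
      proof (rule dvd_fact)
        have "k \<in> {- int K..int K}" "k' \<in> {- int K..int K}" using k k' S by auto
        then show "1 \<le> nat \<bar>k - k'\<bar>" "nat \<bar>k - k'\<bar> \<le> 2 * K + 1" using ne by auto
      qed
      then have "int (nat \<bar>k - k'\<bar>) dvd fact (2 * K + 1)" by (metis of_nat_dvd_iff of_nat_fact)
      then show ?thesis by simp
    qed
    ultimately have "int p ^ Suc v dvd Q"
      using Q(2) by (metis dvd_trans mult_dvd_mono power_Suc)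
    then have "Suc v \<le> multiplicity (int p) Q"
      using Q(1) pp by (intro multiplicity_geI) auto
    then show False by (simp add: v_def)
  qed
  then have "card {k\<in>S. \<not> int p dvd Q div gcd (z + k) Q} \<le> 1"
    using card_le_Suc0_iff_eq[of "{k\<in>S. \<not> int p dvd Q div gcd (z + k) Q}"] finite_subset[OF S] by auto
  then show ?thesis using prime_gt_1_nat[OF p] by linarith
qed

text \<open>
  The free positions are kept free on a whole residue class up to a small density. Choose \<open>z\<close> for a
  suitable modulus \<open>Q\<close> and put \<open>g k = gcd (z + k) Q\<close>, which no \<open>b\<close> divides. Moving inside the class of
  \<open>z\<close> modulo \<open>Q\<close> makes every cofactor \<open>(n + k) div g k\<close> coprime to \<open>P!\<close>, and it stays so modulo
  \<open>Q * P!\<close>. Then \<open>b\<close> can divide \<open>n + k\<close> only if \<open>b div gcd b (g k)\<close> divides that cofactor and is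
  itself coprime to \<open>P!\<close>. By tautness such quotients cover little once \<open>P\<close> is large, and
  since they are coprime to the modulus they cover equally little of the residue class, so a union bound
  over the shifts leaves at least half of it.
\<close>
lemma taut_pattern_density:
  fixes q0 n0 :: int
  assumes B: "0 \<notin> B" "taut B" and S: "S \<subseteq> {- int K..int K}" and q0: "q0 > 0"
    and ex: "\<And>Q. Q > 0 \<Longrightarrow> \<exists>z. q0 dvd z - n0 \<and> (\<forall>b\<in>B. int b dvd Q \<longrightarrow> (\<forall>k\<in>S. \<not> int b dvd z + k))"
  shows "\<exists>c>0. \<forall>F. finite F \<longrightarrow> F \<subseteq> B \<longrightarrow>
      c \<le> dens ({n. q0 dvd n - n0} - (\<Union>k\<in>S. {n. n + k \<in> multiples F}))"
proof -
  have fS: "finite S" by (rule finite_subset[OF S]) simp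
  \<comment> \<open>The square of the factorial gives every prime up to \<open>2 * K + 1\<close> a higher exponent in \<open>Q\<close> than in
  any difference of two shifts.\<close>
  define Q where "Q = q0 * (fact (2 * K + 1) * fact (2 * K + 1))"
  have Q: "Q > 0" using q0 by (simp add: Q_def)
  obtain z where z: "q0 dvd z - n0" and zfree: "\<And>b k. b \<in> B \<Longrightarrow> int b dvd Q \<Longrightarrow> k \<in> S \<Longrightarrow> \<not> int b dvd z + k"
    using ex[OF Q] by blast
  define g where "g = (\<lambda>k. nat (gcd (z + k) Q))"
  have g: "g k > 0" "int (g k) = gcd (z + k) Q" for k using Q by (auto simp: g_def)
  have gfree: "\<not> b dvd g k" if "b \<in> B" "k \<in> S" for b k
  proof
    assume "b dvd g k"
    then have "int b dvd gcd (z + k) Q" by (simp flip: g(2))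
    then show False using zfree[OF that(1) _ that(2)] by simp
  qed
  define a c where "a = (\<lambda>k. (z + k) div gcd (z + k) Q)" and "c = (\<lambda>k. Q div gcd (z + k) Q)"
  have ac: "coprime (a k) (c k)" for k using Q by (auto simp: a_def c_def intro!: div_gcd_coprime)
  define e where "e = 1 / (2 * (real (card S) + 1))"
  have e: "e > 0" by (simp add: e_def)
  have "\<forall>k\<in>S. \<exists>P0. \<forall>P\<ge>P0. inner_density {b div gcd b (g k) | b. b \<in> B \<and> coprime (b div gcd b (g k)) (fact P)} < e"
  proof
    fix k assume "k \<in> S"
    then show "\<exists>P0. \<forall>P\<ge>P0. inner_density {b div gcd b (g k) | b. b \<in> B \<and> coprime (b div gcd b (g k)) (fact P)} < e"
      using gfree by (intro taut_gcd_quotient_small[OF B g(1) _ e])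
  qed
  from bchoice[OF this] obtain P0 where "\<forall>k\<in>S. \<forall>P\<ge>P0 k.
      inner_density {b div gcd b (g k) | b. b \<in> B \<and> coprime (b div gcd b (g k)) (fact P)} < e" ..
  then have P0: "\<And>k P. k \<in> S \<Longrightarrow> P \<ge> P0 k \<Longrightarrow>
      inner_density {b div gcd b (g k) | b. b \<in> B \<and> coprime (b div gcd b (g k)) (fact P)} < e"
    by blast
  \<comment> \<open>Adding \<open>nat Q\<close> makes \<open>Q\<close> divide \<open>fact P\<close>, so the quotients coprime to \<open>fact P\<close> are coprime to the
  final modulus.\<close>
  define P where "P = (\<Sum>k\<in>S. P0 k) + nat Q"
  have PP: "P \<ge> P0 k" if "k \<in> S" for k
    using member_le_sum[OF that, of P0] fS by (simp add: P_def)
  have Qfact: "Q dvd fact P"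
  proof -
    have "nat Q dvd fact P" using Q by (intro dvd_fact) (auto simp: P_def)
    then have "int (nat Q) dvd fact P" by (metis of_nat_dvd_iff of_nat_fact)
    then show ?thesis using Q by simp
  qed
  have "\<exists>t. \<forall>k\<in>S. coprime (a k + c k * t) (fact P)"
    by (rule ex_coprime_shift[OF fS _ ac], simp, unfold c_def, rule card_prime_unramified_shifts[OF S Q])
       (auto simp: Q_def)
  then obtain t where t: "\<And>k. k \<in> S \<Longrightarrow> coprime (a k + c k * t) (fact P)" by blast
  define n1 where "n1 = z + Q * t"
  define Q1 where "Q1 = Q * fact P"
  have Q1: "Q1 > 0" using Q by (simp add: Q1_def)
  let ?R = "{n. Q1 dvd n - n1}"
  have R: "periodic_mod Q1 ?R" by (rule periodic_mod_residue[OF Q1])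
  show ?thesis
  proof (intro exI[of _ "1 / (2 * of_int Q1)"] conjI allI impI)
    show "(0::real) < 1 / (2 * of_int Q1)" using Q1 by simp
    fix F assume F: "finite F" "F \<subseteq> B"
    have F0: "0 \<notin> F" using F B by auto
    have pF: "periodic (multiples F)" by (rule periodic_multiples(2)[OF F(1) F0])
    define G where "G = (\<lambda>k. {b div gcd b (g k) | b. b \<in> F \<and> coprime (b div gcd b (g k)) (fact P)})"
    have Gfin: "finite (G k)" for k
      by (rule finite_subset[of _ "(\<lambda>b. b div gcd b (g k)) ` F"]) (use F in \<open>auto simp: G_def\<close>)
    have quot0: "b div gcd b (g k) \<noteq> 0" if "b \<in> B" for b k
    proof -
      have "b \<noteq> 0" using that B by metis
      then have "gcd b (g k) * (b div gcd b (g k)) \<noteq> 0" by simp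
      then show ?thesis by (metis mult_0_right)
    qed
    have G0: "0 \<notin> G k" for k
    proof
      assume "0 \<in> G k"
      then obtain b where "b \<in> F" "b div gcd b (g k) = 0" unfolding G_def by force
      then show False using quot0[of b k] F by blast
    qed
    define bad where "bad = (\<lambda>k. ?R \<inter> {n. n + k \<in> multiples (G k)})"
    have pbad: "periodic (bad k)" for k unfolding bad_def
      by (intro periodic_Int periodic_shift periodic_multiples(2) Gfin G0 periodic_mod_imp_periodic[OF R])
    have dbad: "dens (bad k) \<le> e / of_int Q1" if k: "k \<in> S" for k
    proof -
      have "coprime Q1 (int (\<Prod>(G k)))"
      proof -
        have "coprime (fact P) (\<Prod>(G k))"
          by (rule prod_coprime_right) (auto simp: G_def coprime_commute)
        then have "coprime (fact P) (int (\<Prod>(G k)))"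
          by (metis coprime_int_iff of_nat_fact)
        then show ?thesis
          using Qfact coprime_divisors[OF Qfact dvd_refl] by (simp add: Q1_def)
      qed
      then have "dens (bad k) = dens ?R * dens {n. n + k \<in> multiples (G k)}"
        unfolding bad_def
        by (rule dens_Int_indep[OF R periodic_mod_shift[OF periodic_multiples(1)[OF Gfin G0]]])
      also have "\<dots> = dens (multiples (G k)) / of_int Q1"
        using dens_shift[OF periodic_multiples(2)[OF Gfin G0]] dens_residue[OF Q1] by simp
      also have "dens (multiples (G k)) \<le>
          inner_density {b div gcd b (g k) | b. b \<in> B \<and> coprime (b div gcd b (g k)) (fact P)}"
      proof (rule inner_density_upper)
        show "0 \<notin> {b div gcd b (g k) | b. b \<in> B \<and> coprime (b div gcd b (g k)) (fact P)}"
        proof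
          assume "0 \<in> {b div gcd b (g k) | b. b \<in> B \<and> coprime (b div gcd b (g k)) (fact P)}"
          then obtain b where "b \<in> B" "b div gcd b (g k) = 0" by force
          then show False using quot0[of b k] by blast
        qed
      qed (use F Gfin in \<open>auto simp: G_def\<close>)
      also have "\<dots> < e" by (rule P0[OF k PP[OF k]])
      finally have "dens (bad k) < e / of_int Q1" using Q1 by (simp add: divide_strict_right_mono divide_right_mono)
      then show ?thesis by simp
    qed
    have sub: "?R - (\<Union>k\<in>S. bad k) \<subseteq> {n. q0 dvd n - n0} - (\<Union>k\<in>S. {n. n + k \<in> multiples F})"
    proof
      fix n assume n: "n \<in> ?R - (\<Union>k\<in>S. bad k)"
      then obtain u where u: "n = n1 + Q1 * u" by (auto simp: dvd_def algebra_simps)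
      have "n - n0 = (z - n0) + q0 * (fact (2 * K + 1) * fact (2 * K + 1) * (t + fact P * u))"
        by (simp add: u n1_def Q1_def Q_def algebra_simps)
      then have "q0 dvd n - n0" by (simp only: dvd_add[OF z dvd_triv_left])
      moreover have False if k: "k \<in> S" and b: "b \<in> F" "int b dvd n + k" for k b
      proof -
        define w where "w = a k + c k * t + fact P * (c k * u)"
        have "gcd (z + k) Q * a k = z + k" "gcd (z + k) Q * c k = Q" by (auto simp: a_def c_def)
        then have "n + k = gcd (z + k) Q * a k + gcd (z + k) Q * c k * (t + fact P * u)"
          by (simp add: u n1_def Q1_def algebra_simps)
        then have nk: "n + k = int (g k) * w" by (simp add: g(2) w_def algebra_simps)
        have "coprime w (fact P)"
        proof (rule coprimeI)
          fix x assume x: "x dvd w" "x dvd fact P"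
          then have "x dvd w - fact P * (c k * u)" by (intro dvd_diff dvd_mult2)
          then have "x dvd a k + c k * t" by (simp add: w_def)
          then show "is_unit x" using t[OF k] x(2) by (meson coprime_common_divisor)
        qed
        moreover have dw: "int (b div gcd b (g k)) dvd w"
          by (rule dvd_div_gcd) (use b nk F0 in \<open>auto intro: gr0I\<close>)
        ultimately have "coprime (int (b div gcd b (g k))) (fact P)"
          using coprime_divisors[OF _ dvd_refl] by blast
        then have "coprime (b div gcd b (g k)) (fact P)" by (metis coprime_int_iff of_nat_fact)
        then have "b div gcd b (g k) \<in> G k" using b by (auto simp: G_def)
        moreover have "int (b div gcd b (g k)) dvd n + k" using dw nk by simp
        ultimately have "n \<in> bad k" using n by (auto simp: bad_def mem_multiples)
        then show False using n k by blast
      qed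
      ultimately show "n \<in> {n. q0 dvd n - n0} - (\<Union>k\<in>S. {n. n + k \<in> multiples F})"
        by (auto simp: mem_multiples)
    qed
    have pU: "periodic (\<Union>k\<in>S. bad k)" by (rule periodic_UNION[OF fS pbad])
    have pR: "periodic ?R" by (rule periodic_mod_imp_periodic[OF R])
    have "(\<Union>k\<in>S. bad k) \<subseteq> ?R" by (auto simp: bad_def)
    then have "dens (?R - (\<Union>k\<in>S. bad k)) = dens ?R - dens (\<Union>k\<in>S. bad k)"
      by (rule dens_Diff[OF pR pU])
    moreover have "dens (\<Union>k\<in>S. bad k) \<le> (\<Sum>k\<in>S. e / of_int Q1)"
      by (rule order_trans[OF dens_UNION_le[OF fS pbad] sum_mono[OF dbad]])
    moreover have "(\<Sum>k\<in>S. e / of_int Q1) \<le> 1 / (2 * of_int Q1)"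
    proof -
      have "real (card S) * e \<le> 1 / 2" by (simp add: e_def field_simps)
      then show ?thesis using Q1 divide_right_mono[of "real (card S) * e" "1 / 2" "of_int Q1"] by simp
    qed
    ultimately have "1 / (2 * of_int Q1) \<le> dens (?R - (\<Union>k\<in>S. bad k))"
      using dens_residue[OF Q1, of n1] Q1 by (simp add: field_simps)
    also have "\<dots> \<le> dens ({n. q0 dvd n - n0} - (\<Union>k\<in>S. {n. n + k \<in> multiples F}))"
      by (intro dens_mono[OF _ _ sub] periodic_Diff pR pU periodic_UNION fS periodic_shift pF
          periodic_mod_imp_periodic[OF periodic_mod_residue[OF q0]])
    finally show "1 / (2 * of_int Q1) \<le> dens ({n. q0 dvd n - n0} - (\<Union>k\<in>S. {n. n + k \<in> multiples F}))" .
  qed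
qed

section \<open>The group H and its topology\<close>

lemma topspace_prodT:
  assumes "0 \<notin> B"
  shows "topspace (prodT B) = (\<Pi>\<^sub>E b\<in>B. {0..<int b})"
proof -
  have "topspace (prodT B) = (\<Pi>\<^sub>E b\<in>B. carrier (integer_mod_group b))"
    by (simp add: prodT_def)
  also have "\<dots> = (\<Pi>\<^sub>E b\<in>B. {0..<int b})"
  proof (rule PiE_cong)
    fix b assume "b \<in> B"
    then have "b \<noteq> 0" using assms by metis
    then show "carrier (integer_mod_group b) = {0..<int b}" by (simp add: carrier_integer_mod_group)
  qed
  finally show ?thesis .
qed

lemma openin_prodT:
  "openin (prodT B) T \<longleftrightarrow> T \<subseteq> topspace (prodT B) \<and>
    (\<forall>x\<in>T. \<exists>F. finite F \<and> F \<subseteq> B \<and> (\<forall>y\<in>topspace (prodT B). (\<forall>b\<in>F. y b = x b) \<longrightarrow> y \<in> T))"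
    (is "?L \<longleftrightarrow> ?R")
proof
  assume L: ?L
  have "\<exists>F. finite F \<and> F \<subseteq> B \<and> (\<forall>y\<in>topspace (prodT B). (\<forall>b\<in>F. y b = x b) \<longrightarrow> y \<in> T)"
    if x: "x \<in> T" for x
  proof -
    obtain U where U: "finite {b \<in> B. U b \<noteq> carrier (integer_mod_group b)}"
        "x \<in> Pi\<^sub>E B U" "Pi\<^sub>E B U \<subseteq> T"
      using L x unfolding prodT_def openin_product_topology_alt by auto
    have "y \<in> T" if y: "y \<in> topspace (prodT B)"
        "\<forall>b\<in>{b \<in> B. U b \<noteq> carrier (integer_mod_group b)}. y b = x b" for y
    proof -
      have yB: "y \<in> (\<Pi>\<^sub>E b\<in>B. carrier (integer_mod_group b))" using y(1) by (simp add: prodT_def)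
      have "y b \<in> U b" if b: "b \<in> B" for b
      proof (cases "U b = carrier (integer_mod_group b)")
        case True
        then show ?thesis using PiE_mem[OF yB b] by simp
      next
        case False
        then show ?thesis using y(2) b PiE_mem[OF U(2) b] by simp
      qed
      then have "y \<in> Pi\<^sub>E B U" using yB by (auto simp: PiE_iff)
      then show ?thesis using U(3) by blast
    qed
    then show ?thesis using U(1) by (intro exI[of _ "{b \<in> B. U b \<noteq> carrier (integer_mod_group b)}"]) auto
  qed
  then show ?R using openin_subset[OF L] by blast
next
  assume R: ?R
  show ?L unfolding prodT_def openin_product_topology_alt
  proof
    fix x assume x: "x \<in> T"
    then obtain F where F: "finite F" "F \<subseteq> B" "\<And>y. y \<in> topspace (prodT B) \<Longrightarrow> (\<forall>b\<in>F. y b = x b) \<Longrightarrow> y \<in> T"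
      using R by meson
    have xB: "x \<in> (\<Pi>\<^sub>E b\<in>B. carrier (integer_mod_group b))" using x R by (auto simp: prodT_def)
    define U where "U = (\<lambda>b. if b \<in> F then {x b} else carrier (integer_mod_group b))"
    have Usub: "U b \<subseteq> carrier (integer_mod_group b)" if "b \<in> B" for b
      using PiE_mem[OF xB that] by (simp add: U_def)
    have "y \<in> T" if y: "y \<in> Pi\<^sub>E B U" for y
    proof (rule F(3))
      have "y \<in> (\<Pi>\<^sub>E b\<in>B. carrier (integer_mod_group b))" by (rule subsetD[OF PiE_mono[OF Usub] y])
      then show "y \<in> topspace (prodT B)" by (simp add: prodT_def)
      show "\<forall>b\<in>F. y b = x b"
      proof
        fix b assume "b \<in> F"
        then show "y b = x b" using PiE_mem[OF y, of b] F(2) by (auto simp: U_def)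
      qed
    qed
    moreover have "finite {b \<in> B. U b \<noteq> topspace (discrete_topology (carrier (integer_mod_group b)))}"
      by (rule finite_subset[OF _ F(1)]) (auto simp: U_def)
    moreover have "x \<in> Pi\<^sub>E B U" using xB by (auto simp: U_def PiE_iff)
    ultimately show "\<exists>U. finite {b \<in> B. U b \<noteq> topspace (discrete_topology (carrier (integer_mod_group b)))} \<and>
        (\<forall>b\<in>B. openin (discrete_topology (carrier (integer_mod_group b))) (U b)) \<and> x \<in> Pi\<^sub>E B U \<and> Pi\<^sub>E B U \<subseteq> T"
      using Usub by (intro exI[of _ U]) auto
  qed
qed

lemma diag_in_prodT: "0 \<notin> B \<Longrightarrow> diag B n \<in> topspace (prodT B)"
  unfolding topspace_prodT by (auto simp: diag_def PiE_iff) (metis gr0I of_nat_0_less_iff pos_mod_bound pos_mod_sign)+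

text \<open>
  The closure of the diagonal consists of the elements that look like an integer on every finite set of
  coordinates.
\<close>
lemma mem_H:
  assumes B: "0 \<notin> B"
  shows "h \<in> H B \<longleftrightarrow> h \<in> extensional B \<and> (\<forall>F. finite F \<longrightarrow> F \<subseteq> B \<longrightarrow> (\<exists>n. \<forall>b\<in>F. h b = n mod int b))"
proof
  assume h: "h \<in> H B"
  then have top: "h \<in> topspace (prodT B)"
    and dense: "\<And>T. h \<in> T \<Longrightarrow> openin (prodT B) T \<Longrightarrow> \<exists>n. diag B n \<in> T"
    unfolding H_def in_closure_of by auto
  have "\<exists>n. \<forall>b\<in>F. h b = n mod int b" if F: "finite F" "F \<subseteq> B" for F
  proof -
    let ?T = "{y \<in> topspace (prodT B). \<forall>b\<in>F. y b = h b}"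
    have "openin (prodT B) ?T" unfolding openin_prodT using F by auto
    then obtain n where "diag B n \<in> ?T" using dense[of ?T] top by auto
    then show ?thesis using F(2) by (intro exI[of _ n]) (auto simp: diag_def subset_iff)
  qed
  then show "h \<in> extensional B \<and> (\<forall>F. finite F \<longrightarrow> F \<subseteq> B \<longrightarrow> (\<exists>n. \<forall>b\<in>F. h b = n mod int b))"
    using top unfolding topspace_prodT[OF B] by (auto simp: PiE_iff)
next
  assume h: "h \<in> extensional B \<and> (\<forall>F. finite F \<longrightarrow> F \<subseteq> B \<longrightarrow> (\<exists>n. \<forall>b\<in>F. h b = n mod int b))"
  have "h b \<in> {0..<int b}" if "b \<in> B" for b
  proof -
    obtain n where "h b = n mod int b" using h[THEN conjunct2, rule_format, of "{b}"] \<open>b \<in> B\<close> by auto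
    moreover have "int b > 0" using that B by (metis gr0I of_nat_0_less_iff)
    ultimately show ?thesis by simp
  qed
  then have top: "h \<in> topspace (prodT B)" unfolding topspace_prodT[OF B] using h by (auto simp: PiE_iff)
  have "\<exists>y\<in>range (diag B). y \<in> T" if T: "h \<in> T" "openin (prodT B) T" for T
  proof -
    obtain F where F: "finite F" "F \<subseteq> B" "\<And>y. y \<in> topspace (prodT B) \<Longrightarrow> (\<forall>b\<in>F. y b = h b) \<Longrightarrow> y \<in> T"
      using T unfolding openin_prodT by meson
    obtain n where n: "\<forall>b\<in>F. h b = n mod int b" using h F by blast
    have "diag B n \<in> T" by (rule F(3)[OF diag_in_prodT[OF B]]) (use n F(2) in \<open>auto simp: diag_def\<close>)
    then show ?thesis by blast
  qed
  then show "h \<in> H B" unfolding H_def in_closure_of using top by blast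
qed

lemma H_rep:
  assumes "0 \<notin> B" "h \<in> H B" "finite F" "F \<subseteq> B"
  obtains n where "\<And>b. b \<in> F \<Longrightarrow> h b = n mod int b"
  using assms mem_H by metis

lemma diag_in_H: "0 \<notin> B \<Longrightarrow> diag B n \<in> H B"
  unfolding mem_H by (auto simp: diag_def)

lemma H_subset: "H B \<subseteq> topspace (prodT B)"
  unfolding H_def by (rule closure_of_subset_topspace)

lemma topspace_HT [simp]: "topspace (HT B) = H B"
  using H_subset by (auto simp: HT_def)

lemma openin_HT:
  "openin (HT B) U \<longleftrightarrow> U \<subseteq> H B \<and>
    (\<forall>x\<in>U. \<exists>F. finite F \<and> F \<subseteq> B \<and> (\<forall>y\<in>H B. (\<forall>b\<in>F. y b = x b) \<longrightarrow> y \<in> U))" (is "?L \<longleftrightarrow> ?R")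
proof
  assume ?L
  then obtain T where T: "openin (prodT B) T" "U = T \<inter> H B" unfolding HT_def openin_subtopology by blast
  show ?R
  proof (intro conjI ballI)
    show "U \<subseteq> H B" using T by blast
    fix x assume "x \<in> U"
    then obtain F where "finite F" "F \<subseteq> B" "\<forall>y\<in>topspace (prodT B). (\<forall>b\<in>F. y b = x b) \<longrightarrow> y \<in> T"
      using T unfolding openin_prodT by blast
    then show "\<exists>F. finite F \<and> F \<subseteq> B \<and> (\<forall>y\<in>H B. (\<forall>b\<in>F. y b = x b) \<longrightarrow> y \<in> U)"
      using H_subset[of B] T(2) by (intro exI[of _ F]) blast
  qed
next
  assume R: ?R
  define T where "T = {y \<in> topspace (prodT B). \<exists>x\<in>U. \<exists>F. finite F \<and> F \<subseteq> B \<and>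
      (\<forall>y\<in>H B. (\<forall>b\<in>F. y b = x b) \<longrightarrow> y \<in> U) \<and> (\<forall>b\<in>F. y b = x b)}"
  have "openin (prodT B) T" unfolding openin_prodT
  proof (intro conjI ballI)
    show "T \<subseteq> topspace (prodT B)" by (auto simp: T_def)
    fix w assume "w \<in> T"
    then obtain x F where xF: "x \<in> U" "finite F" "F \<subseteq> B" "\<forall>y\<in>H B. (\<forall>b\<in>F. y b = x b) \<longrightarrow> y \<in> U" "\<forall>b\<in>F. w b = x b"
      unfolding T_def by blast
    have "y \<in> T" if "y \<in> topspace (prodT B)" "\<forall>b\<in>F. y b = w b" for y
      unfolding T_def using xF that by auto
    then show "\<exists>F. finite F \<and> F \<subseteq> B \<and> (\<forall>y\<in>topspace (prodT B). (\<forall>b\<in>F. y b = w b) \<longrightarrow> y \<in> T)"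
      using xF(2,3) by blast
  qed
  moreover have "U = T \<inter> H B"
  proof (intro equalityI subsetI)
    fix x assume x: "x \<in> U"
    then obtain F where "finite F" "F \<subseteq> B" "\<forall>y\<in>H B. (\<forall>b\<in>F. y b = x b) \<longrightarrow> y \<in> U" using R by blast
    then have "x \<in> T" unfolding T_def using x R H_subset[of B] by blast
    then show "x \<in> T \<inter> H B" using x R by blast
  next
    fix x assume "x \<in> T \<inter> H B"
    then show "x \<in> U" unfolding T_def by blast
  qed
  ultimately show ?L unfolding HT_def openin_subtopology by blast
qed

text \<open>
  Predicates of this kind define the clopen sets from which the topology of \<open>H\<close> is built.
\<close>
definition depends_on :: "nat set \<Rightarrow> ((nat \<Rightarrow> int) \<Rightarrow> bool) \<Rightarrow> bool" where
  "depends_on F P \<longleftrightarrow> (\<forall>h h'. (\<forall>b\<in>F. h b = h' b) \<longrightarrow> P h = P h')"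

lemma openin_depends_on:
  assumes "finite F" "F \<subseteq> B" "depends_on F P"
  shows "openin (HT B) {h \<in> H B. P h}"
  unfolding openin_HT using assms unfolding depends_on_def by (intro conjI ballI exI[of _ F]) auto

lemma closedin_depends_on:
  assumes "finite F" "F \<subseteq> B" "depends_on F P"
  shows "closedin (HT B) {h \<in> H B. P h}"
proof -
  have "openin (HT B) {h \<in> H B. \<not> P h}"
    by (rule openin_depends_on[OF assms(1,2)]) (use assms(3) in \<open>auto simp: depends_on_def\<close>)
  moreover have "H B - {h \<in> H B. P h} = {h \<in> H B. \<not> P h}" by blast
  ultimately show ?thesis unfolding closedin_def by auto
qed

lemma compact_space_HT:
  assumes "0 \<notin> B"
  shows "compact_space (HT B)"
proof -
  have "compact_space (prodT B)"
    unfolding prodT_def compact_space_product_topology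
    using assms by (auto simp: compact_space_discrete_topology carrier_integer_mod_group intro!: gr0I)
  then show ?thesis unfolding HT_def H_def
    by (intro compact_space_subtopology closedin_compact_space closedin_closure_of)
qed

text \<open>
  Constraints that each see finitely many coordinates can be solved in \<open>H\<close> as soon as any finitely
  many of them can, in practice by an integer.
\<close>
lemma H_compactness:
  assumes B: "0 \<notin> B" and dep: "\<And>i. i \<in> I \<Longrightarrow> \<exists>F. finite F \<and> F \<subseteq> B \<and> depends_on F (P i)"
    and fip: "\<And>J. finite J \<Longrightarrow> J \<subseteq> I \<Longrightarrow> \<exists>h\<in>H B. \<forall>i\<in>J. P i h"
  shows "\<exists>h\<in>H B. \<forall>i\<in>I. P i h"
proof -
  define C where "C = (\<lambda>i. {h \<in> H B. P i h})"
  have "\<Inter>(insert (H B) (C ` I)) \<noteq> {}"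
  proof (rule compact_space_fip[THEN iffD1, OF compact_space_HT[OF B], rule_format], intro conjI ballI allI impI)
    fix K assume "K \<in> insert (H B) (C ` I)"
    moreover have "closedin (HT B) (H B)" using closedin_topspace[of "HT B"] by simp
    moreover have "closedin (HT B) (C i)" if "i \<in> I" for i
      using dep[OF that] closedin_depends_on unfolding C_def by blast
    ultimately show "closedin (HT B) K" by blast
  next
    fix \<F> assume F: "finite \<F> \<and> \<F> \<subseteq> insert (H B) (C ` I)"
    then have "finite (\<F> - {H B})" "\<F> - {H B} \<subseteq> C ` I" by auto
    then obtain J where J: "J \<subseteq> I" "finite J" "\<F> - {H B} = C ` J"
      by (metis finite_subset_image)
    obtain h where "h \<in> H B" "\<forall>i\<in>J. P i h" using fip[OF J(2,1)] by blast
    then have "h \<in> K" if "K \<in> \<F>" for K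
      using that J(3) by (cases "K = H B") (auto simp: C_def)
    then show "\<Inter>\<F> \<noteq> {}" by blast
  qed
  then show ?thesis by (auto simp: C_def)
qed

lemma int_Lcm_dvd_iff: "int (Lcm F) dvd x \<longleftrightarrow> (\<forall>b\<in>F. int b dvd x)"
  by (simp add: Lcm_dvd_iff flip: dvd_nat_abs_iff)

lemma Lcm_pos: "finite F \<Longrightarrow> 0 \<notin> F \<Longrightarrow> Lcm F > (0::nat)"
  by (metis Lcm_0_iff_nat gr0I)

lemma dvd_mod_add [simp]: "(b::int) dvd n mod b + k \<longleftrightarrow> b dvd n + k"
  by (metis dvd_eq_mod_eq_0 mod_add_left_eq)

lemma mult_diag: "h \<otimes>\<^bsub>prodG B\<^esub> diag B n = (\<lambda>b\<in>B. (h b + n) mod int b)"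
  by (auto simp: prodG_def product_group_def diag_def fun_eq_iff mod_add_right_eq)

lemma mult_diag_in_H:
  assumes "0 \<notin> B" "h \<in> H B"
  shows "h \<otimes>\<^bsub>prodG B\<^esub> diag B n \<in> H B"
  unfolding mem_H[OF assms(1)] mult_diag
proof (intro conjI allI impI)
  fix F assume F: "finite F" "F \<subseteq> B"
  obtain m where "\<And>b. b \<in> F \<Longrightarrow> h b = m mod int b" using H_rep[OF assms F] by blast
  then show "\<exists>m. \<forall>b\<in>F. (\<lambda>b\<in>B. (h b + n) mod int b) b = m mod int b"
    using F by (intro exI[of _ "m + n"]) (auto simp: mod_add_left_eq)
qed simp

lemma coding_window:
  assumes "0 \<notin> B" "h \<in> H B"
  shows "coding B (window B) h k \<longleftrightarrow> (\<forall>b\<in>B. \<not> int b dvd h b + k)"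
  using mult_diag_in_H[OF assms, of k]
  unfolding coding_def window_def by (auto simp: mult_diag dvd_eq_mod_eq_0)

lemma coding_window_diag:
  assumes "0 \<notin> B"
  shows "coding B (window B) (diag B n) k \<longleftrightarrow> n + k \<notin> multiples B"
  using coding_window[OF assms diag_in_H[OF assms]] by (auto simp: diag_def mem_multiples)

text \<open>
  If \<open>p\<close> survives in \<open>b\<close> after cancelling \<open>gcd b g\<close>, then \<open>b\<close> contains a higher power of \<open>p\<close> than
  \<open>g\<close>.
\<close>
lemma prime_power_dvd_of_dvd_div_gcd:
  fixes b g :: nat
  assumes p: "prime p" and pos: "b > 0" "g > 0" and dvd: "p dvd b div gcd b g"
  shows "p ^ Suc (multiplicity p g) dvd b"
proof -
  let ?d = "gcd b g" and ?e = "multiplicity p g"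
  have "coprime (b div ?d) (g div ?d)" using pos by (intro div_gcd_coprime) auto
  then have "\<not> p dvd g div ?d" using dvd p by (meson coprime_common_divisor not_prime_unit)
  then have "coprime (p ^ ?e) (g div ?d)" using p by (simp add: prime_imp_coprime)
  moreover have "p ^ ?e dvd ?d * (g div ?d)" by (simp add: multiplicity_dvd)
  ultimately have "p ^ ?e dvd ?d" using coprime_dvd_mult_left_iff by blast
  then have "p ^ ?e * p dvd ?d * (b div ?d)" using dvd by (rule mult_dvd_mono)
  then show ?thesis by (simp add: mult.commute)
qed

section \<open>The interior of the window\<close>

lemma closedin_window:
  assumes B: "0 \<notin> B"
  shows "closedin (HT B) (window B)"
proof -
  have "closedin (HT B) (H B \<inter> (\<Inter>b\<in>B. {h \<in> H B. h b \<noteq> 0}))"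
  proof (cases "B = {}")
    case True
    then show ?thesis using closedin_topspace[of "HT B"] by simp
  next
    case False
    then show ?thesis
      using closedin_topspace[of "HT B"]
      by (intro closedin_Int closedin_INT closedin_depends_on[of "{b}" for b]) (auto simp: depends_on_def)
  qed
  moreover have "window B = H B \<inter> (\<Inter>b\<in>B. {h \<in> H B. h b \<noteq> 0})" by (auto simp: window_def)
  ultimately show ?thesis by simp
qed

lemma window'_subset:
  assumes "0 \<notin> B"
  shows "window' B \<subseteq> window B"
  unfolding window'_def
  by (rule closure_of_minimal[OF interior_of_subset closedin_window[OF assms]])

text \<open>
  Near \<open>h\<close> no cylinder lies in the window. Apply this to the cylinder around an integer \<open>n = g * w\<close>
  with \<open>w\<close> coprime to \<open>R\<close>, over a set \<open>F'\<close> of coordinates that contains, for each prime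
  \<open>p\<close> dividing \<open>R\<close>, an element with more factors \<open>p\<close> than \<open>g\<close>, if \<open>B\<close> has one. A point of the
  cylinder outside the window vanishes at some coordinate \<open>b\<close>. If this \<open>b\<close> had more factors \<open>p\<close>
  than \<open>g\<close>, it would share with the element chosen for \<open>p\<close> a power of \<open>p\<close> too high for \<open>g\<close>,
  and that power would divide \<open>n\<close>.
\<close>
lemma not_in_window'_ex_cofactor:
  assumes B: "0 \<notin> B" and h: "h \<in> H B" "h \<notin> window' B"
  shows "\<exists>F0. finite F0 \<and> F0 \<subseteq> B \<and> (\<forall>F n0. finite F \<longrightarrow> F0 \<subseteq> F \<longrightarrow> F \<subseteq> B \<longrightarrow>
      (\<forall>b\<in>F. h b = n0 mod int b) \<longrightarrow> (\<forall>R::nat>0. \<exists>b\<in>B. coprime (b div gcd b (nat (gcd n0 (int (Lcm F))))) R))"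
proof -
  have "h \<notin> HT B closure_of (HT B interior_of window B)" using h by (simp add: window'_def)
  then obtain T where T: "openin (HT B) T" "h \<in> T" "T \<inter> (HT B interior_of window B) = {}"
    using h unfolding in_closure_of by auto
  obtain F0 where F0: "finite F0" "F0 \<subseteq> B" "\<And>y. y \<in> H B \<Longrightarrow> (\<forall>b\<in>F0. y b = h b) \<Longrightarrow> y \<in> T"
    using T(1,2) unfolding openin_HT by meson
  have "\<exists>b\<in>B. coprime (b div gcd b (nat (gcd n0 (int (Lcm F))))) R"
    if F: "finite F" "F0 \<subseteq> F" "F \<subseteq> B" and n0: "\<forall>b\<in>F. h b = n0 mod int b" and R: "R > 0" for F n0 and R :: nat
  proof -
    define q where "q = int (Lcm F)"
    have "0 \<notin> F" using F(3) B by blast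
    then have q: "q > 0" using Lcm_pos[OF F(1)] by (simp add: q_def)
    define g where "g = nat (gcd n0 q)"
    have g: "g > 0" "int g = gcd n0 q" using q by (auto simp: g_def)
    define a c where "a = n0 div gcd n0 q" and "c = q div gcd n0 q"
    have ac: "coprime a c" using q by (auto simp: a_def c_def intro!: div_gcd_coprime)
    have "\<exists>t. \<forall>k\<in>{0::int}. coprime (a + c * t) (int R)"
    proof (rule ex_coprime_shift)
      fix p :: nat assume "prime p"
      have "card {k \<in> {0::int}. \<not> int p dvd c} \<le> card {0::int}" by (rule card_mono) auto
      then show "card {k \<in> {0::int}. \<not> int p dvd c} < p" using prime_gt_1_nat[OF \<open>prime p\<close>] by simp
    qed (use R ac in auto)
    then obtain t where t: "coprime (a + c * t) (int R)" by blast
    define n where "n = n0 + q * t"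
    have "gcd n0 q * a = n0" "gcd n0 q * c = q" by (auto simp: a_def c_def)
    then have "n = gcd n0 q * a + gcd n0 q * c * t" by (simp add: n_def)
    then have ng: "n = int g * (a + c * t)" by (simp add: g(2) algebra_simps)
    have modF: "n mod int b = h b" if "b \<in> F" for b
    proof -
      have "int b dvd q" using that by (simp add: q_def dvd_Lcm)
      then have "int b dvd n - n0" by (simp add: n_def)
      then show ?thesis using n0 that by (simp add: mod_eq_dvd_iff)
    qed
    define PS where "PS = {p. prime p \<and> p dvd R}"
    have "finite PS" using R by (intro finite_subset[of PS "{..R}"]) (auto simp: PS_def dest: dvd_imp_le)
    \<comment> \<open>The primes for which some \<open>b\<close> has more factors \<open>p\<close> than \<open>g\<close>, with such a \<open>b\<close> chosen as \<open>f p\<close>.\<close>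
    define PB where "PB = {p \<in> PS. \<exists>b\<in>B. p dvd b div gcd b g}"
    have "\<forall>p\<in>PB. \<exists>b. b \<in> B \<and> p dvd b div gcd b g" by (auto simp: PB_def)
    from bchoice[OF this] obtain f where f: "\<forall>p\<in>PB. f p \<in> B \<and> p dvd f p div gcd (f p) g" ..
    define F' where "F' = F \<union> f ` PB"
    have F': "finite F'" "F' \<subseteq> B" using F f \<open>finite PS\<close> by (auto simp: F'_def PB_def)
    let ?y = "diag B n"
    have yH: "?y \<in> H B" by (rule diag_in_H[OF B])
    have "?y b = h b" if "b \<in> F0" for b
    proof -
      have "b \<in> F" "b \<in> B" using that F(2,3) by auto
      then show ?thesis using modF by (simp add: diag_def)
    qed
    then have "?y \<in> T" by (intro F0(3) yH) blast
    then have "?y \<notin> HT B interior_of window B" using T(3) by blast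
    moreover have "openin (HT B) {y \<in> H B. \<forall>b\<in>F'. y b = ?y b}"
      by (rule openin_depends_on[OF F']) (simp add: depends_on_def)
    ultimately have "\<not> {y \<in> H B. \<forall>b\<in>F'. y b = ?y b} \<subseteq> window B"
      using interior_of_maximal[of "{y \<in> H B. \<forall>b\<in>F'. y b = ?y b}" "window B" "HT B"] yH by blast
    then obtain y b where y: "y \<in> H B" "\<And>b. b \<in> F' \<Longrightarrow> y b = ?y b" and b: "b \<in> B" "y b = 0"
      by (auto simp: window_def)
    have "finite (insert b F')" "insert b F' \<subseteq> B" using F' b by auto
    then obtain n' where n': "\<And>x. x \<in> insert b F' \<Longrightarrow> y x = n' mod int x"
      using H_rep[OF B y(1)] by blast
    have bn': "int b dvd n'" using n'[of b] b(2) by (simp add: dvd_eq_mod_eq_0)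
    have F'n': "int x dvd n' - n" if "x \<in> F'" for x
    proof -
      have "n' mod int x = n mod int x"
        using n'[of x] y(2)[OF that] that F'(2) by (auto simp: diag_def)
      then show ?thesis by (simp add: mod_eq_dvd_iff)
    qed
    have "coprime (int (b div gcd b g)) (int R)"
    proof (rule coprime_int_primeI)
      fix p :: nat assume p: "prime p" "int p dvd int (b div gcd b g)" "int p dvd int R"
      then have pd: "p dvd b div gcd b g" "p dvd R" by (simp_all only: int_dvd_int_iff)
      then have "p \<in> PB" using p(1) b(1) by (auto simp: PB_def PS_def)
      then have fp: "f p \<in> B" "f p \<in> F'" "p dvd f p div gcd (f p) g" using f by (auto simp: F'_def)
      have pos: "b > 0" "f p > 0" using b(1) fp(1) B by (metis gr0I)+
      let ?P = "p ^ Suc (multiplicity p g)"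
      have "?P dvd b" by (rule prime_power_dvd_of_dvd_div_gcd[OF p(1) pos(1) g(1) pd(1)])
      then have "int ?P dvd n'" using bn' by (meson dvd_trans int_dvd_int_iff)
      moreover have "?P dvd f p" by (rule prime_power_dvd_of_dvd_div_gcd[OF p(1) pos(2) g(1) fp(3)])
      then have "int ?P dvd n' - n" using F'n'[OF fp(2)] by (meson dvd_trans int_dvd_int_iff)
      ultimately have "int ?P dvd n' - (n' - n)" by (rule dvd_diff)
      then have "int ?P dvd int g * (a + c * t)" by (simp add: ng)
      moreover have "coprime (int ?P) (a + c * t)"
      proof -
        have "\<not> int p dvd a + c * t"
          using t p by (meson coprime_common_divisor not_prime_unit prime_nat_int_transfer)
        then have "coprime (int p) (a + c * t)" using p(1) by (simp add: prime_imp_coprime)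
        then show ?thesis by (simp only: of_nat_power coprime_power_left_iff) simp
      qed
      ultimately have "int ?P dvd int g" using coprime_dvd_mult_left_iff by blast
      then have "?P dvd g" by (simp only: int_dvd_int_iff)
      then have "Suc (multiplicity p g) \<le> multiplicity p g"
        using p(1) g(1) by (intro multiplicity_geI) auto
      then show False by simp
    qed
    then have "coprime (b div gcd b g) R" by (simp only: coprime_int_iff)
    then show ?thesis using b(1) by (auto simp: g_def q_def)
  qed
  then show ?thesis by (intro exI[of _ F0] conjI allI impI F0(1,2))
qed

text \<open>
  Choose one after the other, each coprime to \<open>R\<close> times the product of the earlier ones.
\<close>
lemma ex_pairwise_coprime_choice:
  fixes P :: "'k \<Rightarrow> nat \<Rightarrow> bool"
  assumes fin: "finite T" and R: "R > 0"
    and ex: "\<And>k R. k \<in> T \<Longrightarrow> R > 0 \<Longrightarrow> \<exists>a. P k a \<and> coprime a R"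
    and pos: "\<And>k a. k \<in> T \<Longrightarrow> P k a \<Longrightarrow> a > 0"
  shows "\<exists>\<alpha>. \<forall>k\<in>T. P k (\<alpha> k) \<and> coprime (\<alpha> k) R \<and> (\<forall>k'\<in>T. k \<noteq> k' \<longrightarrow> coprime (\<alpha> k) (\<alpha> k'))"
  using fin ex pos
proof (induction T rule: finite_induct)
  case (insert j T)
  have "\<exists>\<alpha>. \<forall>k\<in>T. P k (\<alpha> k) \<and> coprime (\<alpha> k) R \<and> (\<forall>k'\<in>T. k \<noteq> k' \<longrightarrow> coprime (\<alpha> k) (\<alpha> k'))"
    by (rule insert.IH) (use insert.prems in auto)
  then obtain \<alpha> where \<alpha>: "\<And>k. k \<in> T \<Longrightarrow> P k (\<alpha> k)" "\<And>k. k \<in> T \<Longrightarrow> coprime (\<alpha> k) R"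
    "\<And>k k'. k \<in> T \<Longrightarrow> k' \<in> T \<Longrightarrow> k \<noteq> k' \<Longrightarrow> coprime (\<alpha> k) (\<alpha> k')" by blast
  have "R * (\<Prod>k\<in>T. \<alpha> k) > 0"
    using R \<alpha>(1) insert.prems(2) by (auto intro!: prod_pos)
  then obtain a where a: "P j a" "coprime a (R * (\<Prod>k\<in>T. \<alpha> k))" using insert.prems(1)[of j] by blast
  have aT: "coprime a (\<alpha> k)" if "k \<in> T" for k
  proof -
    have "\<alpha> k dvd R * (\<Prod>k\<in>T. \<alpha> k)" using that insert.hyps(1) by (simp add: dvd_prod_eqI dvd_mult)
    then show ?thesis using a(2) coprime_divisors dvd_refl by blast
  qed
  show ?case
  proof (intro exI[of _ "\<alpha>(j := a)"] ballI)
    fix k assume "k \<in> insert j T"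
    then show "P k ((\<alpha>(j := a)) k) \<and> coprime ((\<alpha>(j := a)) k) R \<and>
        (\<forall>k'\<in>insert j T. k \<noteq> k' \<longrightarrow> coprime ((\<alpha>(j := a)) k) ((\<alpha>(j := a)) k'))"
      using \<alpha> a aT insert.hyps(2) by (auto simp: coprime_commute)
  qed
qed simp

text \<open>
  The positions split into the free ones \<open>S\<close>, the ones \<open>T0\<close> hit by \<open>h\<close>, which finitely many
  coordinates witness, and the ones \<open>T1\<close> that \<open>h\<close> leaves free although \<open>x\<close> is 0 there. At the
  latter the translate of \<open>h\<close> lies outside \<open>window' B\<close>, so there are \<open>\<beta> k \<in> B\<close> whose cofactors
  \<open>\<alpha> k\<close> are pairwise coprime and avoid the primes up to \<open>2 * K\<close> and those of the fixed coordinates.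
  As \<open>gcd (\<beta> k) (g k)\<close> divides the position already, prescribing the residue \<open>- k\<close> modulo
  \<open>\<alpha> k\<close> hits it. This hits no free position: a prime of \<open>\<alpha> k\<close>
  divides \<open>h1 + k\<close> and is too large to divide any other \<open>h1 + k'\<close>, while at all other primes \<open>h1\<close>
  agrees with \<open>h\<close>.
\<close>
lemma interval_pattern_realised:
  assumes B: "0 \<notin> B" and h: "h \<in> H B"
    and lo: "coding B (window' B) h \<le> x" and up: "x \<le> coding B (window B) h"
  shows "\<exists>h1\<in>H B. \<forall>k\<in>{- int K..int K}. coding B (window B) h1 k = x k"
proof -
  define S where "S = {k \<in> {- int K..int K}. x k}"
  define T0 where "T0 = {k \<in> {- int K..int K}. \<not> x k \<and> (\<exists>b\<in>B. int b dvd h b + k)}"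
  define T1 where "T1 = {k \<in> {- int K..int K}. \<not> x k \<and> \<not> (\<exists>b\<in>B. int b dvd h b + k)}"
  have Sfree: "\<not> int b dvd h b + k" if "k \<in> S" "b \<in> B" for k b
  proof -
    have "coding B (window B) h k" using that(1) up by (auto simp: S_def le_fun_def)
    then show ?thesis using coding_window[OF B h] that(2) by blast
  qed
  have "\<forall>k\<in>T0. \<exists>b. b \<in> B \<and> int b dvd h b + k" by (auto simp: T0_def)
  from bchoice[OF this] obtain \<zeta> where \<zeta>: "\<forall>k\<in>T0. \<zeta> k \<in> B \<and> int (\<zeta> k) dvd h (\<zeta> k) + k" ..
  have "\<forall>k\<in>T1. \<exists>F0. finite F0 \<and> F0 \<subseteq> B \<and> (\<forall>F n0. finite F \<longrightarrow> F0 \<subseteq> F \<longrightarrow> F \<subseteq> B \<longrightarrow>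
      (\<forall>b\<in>F. (h \<otimes>\<^bsub>prodG B\<^esub> diag B k) b = n0 mod int b) \<longrightarrow>
      (\<forall>R::nat>0. \<exists>b\<in>B. coprime (b div gcd b (nat (gcd n0 (int (Lcm F))))) R))"
  proof
    fix k assume "k \<in> T1"
    then have "\<not> coding B (window' B) h k" using lo by (auto simp: T1_def le_fun_def)
    then have "h \<otimes>\<^bsub>prodG B\<^esub> diag B k \<notin> window' B" by (simp add: coding_def)
    then show "\<exists>F0. finite F0 \<and> F0 \<subseteq> B \<and> (\<forall>F n0. finite F \<longrightarrow> F0 \<subseteq> F \<longrightarrow> F \<subseteq> B \<longrightarrow>
      (\<forall>b\<in>F. (h \<otimes>\<^bsub>prodG B\<^esub> diag B k) b = n0 mod int b) \<longrightarrow>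
      (\<forall>R::nat>0. \<exists>b\<in>B. coprime (b div gcd b (nat (gcd n0 (int (Lcm F))))) R))"
      by (rule not_in_window'_ex_cofactor[OF B mult_diag_in_H[OF B h]])
  qed
  from bchoice[OF this] obtain \<Phi> where \<Phi>: "\<forall>k\<in>T1. finite (\<Phi> k) \<and> \<Phi> k \<subseteq> B \<and>
      (\<forall>F n0. finite F \<longrightarrow> \<Phi> k \<subseteq> F \<longrightarrow> F \<subseteq> B \<longrightarrow>
      (\<forall>b\<in>F. (h \<otimes>\<^bsub>prodG B\<^esub> diag B k) b = n0 mod int b) \<longrightarrow>
      (\<forall>R::nat>0. \<exists>b\<in>B. coprime (b div gcd b (nat (gcd n0 (int (Lcm F))))) R))" ..
  have fin: "finite S" "finite T0" "finite T1"
    by (rule finite_subset[of _ "{- int K..int K}"]; auto simp: S_def T0_def T1_def)+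
  have \<Phi>fin: "finite (\<Phi> k)" "\<Phi> k \<subseteq> B" if "k \<in> T1" for k
    using \<Phi>[rule_format, OF that] by blast+
  define F0 where "F0 = \<zeta> ` T0 \<union> (\<Union>k\<in>T1. \<Phi> k)"
  have F0: "finite F0" "F0 \<subseteq> B" using fin \<zeta> \<Phi>fin by (auto simp: F0_def)
  have F00: "0 \<notin> F0" using F0 B by blast
  obtain n0 where n0: "\<And>b. b \<in> F0 \<Longrightarrow> h b = n0 mod int b" using H_rep[OF B h F0] by blast
  define q0 where "q0 = Lcm F0"
  have q0: "q0 > 0" unfolding q0_def by (rule Lcm_pos[OF F0(1) F00])
  define g where "g = (\<lambda>k. nat (gcd (n0 + k) (int q0)))"
  have g: "int (g k) dvd n0 + k" "g k dvd q0" for k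
  proof -
    have "int (g k) = gcd (n0 + k) (int q0)" by (simp add: g_def)
    then have "int (g k) dvd n0 + k" "int (g k) dvd int q0" by auto
    then show "int (g k) dvd n0 + k" "g k dvd q0" by (simp_all only: int_dvd_int_iff)
  qed
  have cof: "\<exists>b\<in>B. coprime (b div gcd b (g k)) R" if k: "k \<in> T1" and R: "R > 0" for k and R :: nat
  proof -
    have "\<Phi> k \<subseteq> F0" using k by (auto simp: F0_def)
    moreover have "\<forall>b\<in>F0. (h \<otimes>\<^bsub>prodG B\<^esub> diag B k) b = (n0 + k) mod int b"
    proof
      fix b assume "b \<in> F0"
      then show "(h \<otimes>\<^bsub>prodG B\<^esub> diag B k) b = (n0 + k) mod int b"
        using n0 F0(2) by (auto simp: mult_diag mod_add_left_eq)
    qed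
    ultimately show ?thesis
      using \<Phi>[rule_format, OF k, THEN conjunct2, THEN conjunct2, rule_format, OF F0(1) _ F0(2)] R
      unfolding g_def q0_def by blast
  qed
  \<comment> \<open>Coprimality to \<open>q0\<close> keeps the coordinates in \<open>F0\<close> unchanged, coprimality to the factorial separates
  the positions.\<close>
  define R0 where "R0 = q0 * fact (2 * K)"
  have "\<exists>\<alpha>. \<forall>k\<in>T1. (\<exists>b\<in>B. \<alpha> k = b div gcd b (g k)) \<and> coprime (\<alpha> k) R0 \<and>
      (\<forall>k'\<in>T1. k \<noteq> k' \<longrightarrow> coprime (\<alpha> k) (\<alpha> k'))"
  proof (rule ex_pairwise_coprime_choice[OF fin(3), of R0 "\<lambda>k a. \<exists>b\<in>B. a = b div gcd b (g k)"])
    show "R0 > 0" using q0 by (simp add: R0_def)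
    show "\<exists>a. (\<exists>b\<in>B. a = b div gcd b (g k)) \<and> coprime a R" if "k \<in> T1" "R > 0" for k R
      using cof[OF that] by blast
    fix k a assume "\<exists>b\<in>B. a = b div gcd b (g k)"
    then obtain b where b: "b \<in> B" "a = b div gcd b (g k)" by blast
    then have "b > 0" using B by (metis gr0I)
    moreover have "b = gcd b (g k) * a" using b(2) by simp
    ultimately show "a > 0" by (metis gr0I mult_0_right less_irrefl)
  qed
  then obtain \<alpha> where \<alpha>: "\<And>k. k \<in> T1 \<Longrightarrow> \<exists>b\<in>B. \<alpha> k = b div gcd b (g k)"
      "\<And>k. k \<in> T1 \<Longrightarrow> coprime (\<alpha> k) R0"
      "\<And>k k'. k \<in> T1 \<Longrightarrow> k' \<in> T1 \<Longrightarrow> k \<noteq> k' \<Longrightarrow> coprime (\<alpha> k) (\<alpha> k')" by blast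
  have "\<forall>k\<in>T1. \<exists>b. b \<in> B \<and> \<alpha> k = b div gcd b (g k)" using \<alpha>(1) by blast
  from bchoice[OF this] obtain \<beta> where \<beta>: "\<forall>k\<in>T1. \<beta> k \<in> B \<and> \<alpha> k = \<beta> k div gcd (\<beta> k) (g k)" ..
  have \<alpha>q0: "coprime (\<alpha> k) q0" and \<alpha>K: "coprime (\<alpha> k) (fact (2 * K))" if "k \<in> T1" for k
    using \<alpha>(2)[OF that] by (simp_all add: R0_def)
  define A where "A = (\<Prod>k\<in>T1. \<alpha> k)"
  have "\<exists>y::nat. \<forall>k\<in>T1. [y = nat ((- k) mod int (\<alpha> k))] (mod \<alpha> k)"
    by (rule chinese_remainder_nat[OF fin(3)]) (use \<alpha>(3) in blast)
  then obtain y where y: "\<And>k. k \<in> T1 \<Longrightarrow> [y = nat ((- k) mod int (\<alpha> k))] (mod \<alpha> k)" by blast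
  have \<alpha>pos: "\<alpha> k > 0" if "k \<in> T1" for k
  proof -
    have "\<beta> k > 0" using \<beta> that B by (metis gr0I)
    moreover have "\<beta> k = gcd (\<beta> k) (g k) * \<alpha> k" using \<beta> that by simp
    ultimately show ?thesis by (metis gr0I mult_0_right less_irrefl)
  qed
  have y: "int (\<alpha> k) dvd int y + k" if k: "k \<in> T1" for k
  proof -
    have "[int y = (- k) mod int (\<alpha> k)] (mod int (\<alpha> k))"
      using y[OF k] \<alpha>pos[OF k] by (simp flip: cong_int_iff)
    then have "[int y = - k] (mod int (\<alpha> k))" by (simp add: cong_def)
    then show ?thesis by (simp add: cong_iff_dvd_diff)
  qed
  \<comment> \<open>The first two conditions are repeated for each \<open>b\<close> to have one family of constraints; the index 0,
  which is not in \<open>B\<close>, stands for these two conditions alone.\<close>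
  define P where "P = (\<lambda>b h1. (\<forall>c\<in>F0. h1 c = h c) \<and> (\<forall>k\<in>T1. int (\<beta> k) dvd h1 (\<beta> k) + k) \<and>
      (b \<in> B \<longrightarrow> (\<forall>k\<in>S. \<not> int b dvd h1 b + k)))"
  have "\<exists>h1\<in>H B. \<forall>b\<in>insert 0 B. P b h1"
  proof (rule H_compactness[OF B])
    fix b assume "b \<in> insert 0 B"
    define G where "G = F0 \<union> \<beta> ` T1 \<union> (if b \<in> B then {b} else {})"
    have "depends_on G (P b)"
      unfolding depends_on_def
    proof (intro allI impI)
      fix u v :: "nat \<Rightarrow> int" assume "\<forall>b\<in>G. u b = v b"
      then have uv: "c \<in> F0 \<Longrightarrow> u c = v c" "k \<in> T1 \<Longrightarrow> u (\<beta> k) = v (\<beta> k)" "b \<in> B \<Longrightarrow> u b = v b" for c k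
        by (auto simp: G_def)
      show "P b u = P b v" unfolding P_def
        by (cases "b \<in> B") (simp_all add: uv cong: ball_cong)
    qed
    moreover have "finite G" "G \<subseteq> B" using F0 fin \<beta> by (auto simp: G_def)
    ultimately show "\<exists>G. finite G \<and> G \<subseteq> B \<and> depends_on G (P b)" by blast
  next
    fix J assume J: "finite J" "J \<subseteq> insert 0 B"
    define F where "F = (J \<inter> B) \<union> F0"
    have F: "finite F" "F \<subseteq> B" using J F0 by (auto simp: F_def)
    obtain z where z: "\<And>b. b \<in> F \<Longrightarrow> h b = z mod int b" using H_rep[OF B h F] by blast
    \<comment> \<open>Coordinates coprime to \<open>A\<close> keep the residues of \<open>z\<close>; the others share a prime with some \<open>\<alpha> k\<close> and
    need no prescription.\<close>
    define \<Lambda> where "\<Lambda> = (\<Prod>b\<in>{b \<in> F. coprime b A}. b)"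
    have "coprime \<Lambda> A" unfolding \<Lambda>_def by (rule prod_coprime_left) auto
    then have "coprime (int \<Lambda>) (int A)" by (simp only: coprime_int_iff)
    then obtain n where n: "[n = z] (mod int \<Lambda>)" "[n = int y] (mod int A)"
      using binary_chinese_remainder_int by blast
    have nz: "int b dvd n - z" if "b \<in> F" "coprime b A" for b
    proof -
      have "b dvd \<Lambda>" unfolding \<Lambda>_def using that F(1) by (intro dvd_prod_eqI) auto
      then show ?thesis using n(1) by (meson cong_iff_dvd_diff dvd_trans int_dvd_int_iff)
    qed
    have \<alpha>n: "int (\<alpha> k) dvd n + k" if "k \<in> T1" for k
    proof -
      have "\<alpha> k dvd A" unfolding A_def using that fin(3) by (intro dvd_prod_eqI) auto
      then have "int (\<alpha> k) dvd n - int y" using n(2) by (meson cong_iff_dvd_diff dvd_trans int_dvd_int_iff)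
      then have "int (\<alpha> k) dvd (n - int y) + (int y + k)" using y[OF that] by (rule dvd_add)
      then show ?thesis by simp
    qed
    have F0n: "int b dvd n - z" if "b \<in> F0" for b
    proof (rule nz)
      show "b \<in> F" using that by (simp add: F_def)
      have "b dvd q0" using that by (simp add: q0_def dvd_Lcm)
      then have "coprime b (\<alpha> k)" if "k \<in> T1" for k
        using \<alpha>q0[OF that] coprime_divisors[OF _ dvd_refl] by (metis coprime_commute)
      then show "coprime b A" unfolding A_def by (intro prod_coprime_right) auto
    qed
    have n0n: "int q0 dvd n - n0"
      unfolding q0_def int_Lcm_dvd_iff
    proof
      fix b assume b: "b \<in> F0"
      then have "n0 mod int b = z mod int b" using n0[OF b] z[of b] by (simp add: F_def)
      then have "int b dvd z - n0" by (simp add: mod_eq_dvd_iff[symmetric])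
      then have "int b dvd (n - z) + (z - n0)" using F0n[OF b] by (intro dvd_add)
      then show "int b dvd n - n0" by simp
    qed
    have "P b (diag B n)" if bJ: "b \<in> J" for b
      unfolding P_def
    proof (intro conjI ballI impI)
      fix c assume c: "c \<in> F0"
      then have "n mod int c = z mod int c" using F0n[OF c] by (simp add: mod_eq_dvd_iff)
      then show "diag B n c = h c" using c F0(2) z[of c] by (auto simp: diag_def F_def)
    next
      fix k assume k: "k \<in> T1"
      let ?d = "gcd (\<beta> k) (g k)"
      have bB: "\<beta> k \<in> B" and prod: "\<beta> k = ?d * \<alpha> k" using \<beta> k by auto
      have "int (g k) dvd int q0" using g(2)[of k] by (simp only: int_dvd_int_iff)
      then have "int (g k) dvd n - n0" using n0n by (rule dvd_trans)
      then have "int (g k) dvd (n - n0) + (n0 + k)" using g(1)[of k] by (rule dvd_add)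
      then have "int (g k) dvd n + k" by simp
      moreover have "int ?d dvd int (g k)" by (simp only: int_dvd_int_iff gcd_dvd2)
      ultimately have "int ?d dvd n + k" by (rule dvd_trans[rotated])
      moreover have "?d dvd q0" using g(2)[of k] by (rule dvd_trans[OF gcd_dvd2])
      then have "coprime ?d (\<alpha> k)"
        using coprime_divisors[OF _ dvd_refl, of ?d q0 "\<alpha> k"] \<alpha>q0[OF k] by (simp add: coprime_commute)
      then have "coprime (int ?d) (int (\<alpha> k))" by (simp only: coprime_int_iff)
      ultimately have "int ?d * int (\<alpha> k) dvd n + k" using \<alpha>n[OF k] divides_mult by blast
      then have "int (\<beta> k) dvd n + k" by (metis prod of_nat_mult)
      then show "int (\<beta> k) dvd diag B n (\<beta> k) + k" using bB by (simp add: diag_def)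
    next
      fix k assume "b \<in> B" "k \<in> S"
      have bF: "b \<in> F" using bJ \<open>b \<in> B\<close> by (simp add: F_def)
      show "\<not> int b dvd diag B n b + k"
      proof
        assume "int b dvd diag B n b + k"
        then have dvd: "int b dvd n + k" using \<open>b \<in> B\<close> by (simp add: diag_def)
        show False
        proof (cases "coprime b A")
          case True
          have "int b dvd (n + k) - (n - z)" using dvd nz[OF bF True] by (rule dvd_diff)
          moreover have "(n + k) - (n - z) = z + k" by simp
          ultimately have "int b dvd z + k" by (simp only:)
          then have "int b dvd h b + k" using z[OF bF] by simp
          then show False using Sfree[OF \<open>k \<in> S\<close> \<open>b \<in> B\<close>] by blast
        next
          case False
          then have "\<not> (\<forall>j\<in>T1. coprime b (\<alpha> j))"
            using prod_coprime_right[of T1 b \<alpha>] unfolding A_def by auto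
          then obtain j where j: "j \<in> T1" "\<not> coprime b (\<alpha> j)" by auto
          then have "gcd b (\<alpha> j) \<noteq> 1" by (simp add: coprime_iff_gcd_eq_1)
          then obtain p where p: "prime p" "p dvd gcd b (\<alpha> j)" using prime_factor_nat by blast
          then have pd: "p dvd b" "p dvd \<alpha> j" by auto
          have "int p dvd n + k" using dvd pd(1) by (meson dvd_trans int_dvd_int_iff)
          moreover have "int p dvd n + j" using \<alpha>n[OF j(1)] pd(2) by (meson dvd_trans int_dvd_int_iff)
          ultimately have "int p dvd (n + k) - (n + j)" by (rule dvd_diff)
          then have "int p dvd k - j" by simp
          moreover have "k \<noteq> j" "\<bar>k - j\<bar> \<le> 2 * int K"
            using \<open>k \<in> S\<close> j(1) by (auto simp: S_def T1_def)
          ultimately have "int p \<le> 2 * int K"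
            using dvd_imp_le_int[of "k - j" "int p"] by simp
          then have "p dvd fact (2 * K)" using p(1) prime_gt_0_nat by (intro dvd_fact) (auto simp: Suc_le_eq)
          then show False
            using \<alpha>K[OF j(1)] pd(2) p(1) by (meson coprime_common_divisor not_prime_unit)
        qed
      qed
    qed
    then show "\<exists>h1\<in>H B. \<forall>b\<in>J. P b h1" using diag_in_H[OF B] by blast
  qed
  then obtain h1 where h1: "h1 \<in> H B" "\<And>b. b \<in> insert 0 B \<Longrightarrow> P b h1" by blast
  have "coding B (window B) h1 k = x k" if k: "k \<in> {- int K..int K}" for k
  proof -
    consider "k \<in> S" | "k \<in> T0" | "k \<in> T1" using k by (auto simp: S_def T0_def T1_def)
    then show ?thesis
    proof cases
      case 1
      then have "x k" by (simp add: S_def)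
      moreover have "\<not> int b dvd h1 b + k" if "b \<in> B" for b
        using h1(2)[of b] that 1 by (auto simp: P_def)
      ultimately show ?thesis using coding_window[OF B h1(1)] by blast
    next
      case 2
      then have "\<not> x k" by (simp add: T0_def)
      moreover have "\<zeta> k \<in> B" "int (\<zeta> k) dvd h1 (\<zeta> k) + k"
        using h1(2)[of 0] 2 \<zeta> by (auto simp: P_def F0_def)
      ultimately show ?thesis using coding_window[OF B h1(1)] by blast
    next
      case 3
      then have "\<not> x k" by (simp add: T1_def)
      moreover have "\<beta> k \<in> B" "int (\<beta> k) dvd h1 (\<beta> k) + k"
        using h1(2)[of 0] 3 \<beta> by (auto simp: P_def)
      ultimately show ?thesis using coding_window[OF B h1(1)] by blast
    qed
  qed
  then show ?thesis using h1(1) by blast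
qed

section \<open>Cylinders in the shift space\<close>

lemma open_bool_cylinder: "open {y :: int \<Rightarrow> bool. \<forall>k\<in>{- int K..int K}. y k = x k}"
  using product_topology_basis'[of "{- int K..int K}" "\<lambda>k. {x k}" "\<lambda>k. k"]
  by (simp add: open_discrete)

lemma open_bool_contains_cylinder:
  fixes U :: "(int \<Rightarrow> bool) set"
  assumes "open U" "x \<in> U"
  obtains K where "{y. \<forall>k\<in>{- int K..int K}. y k = x k} \<subseteq> U"
proof -
  have "openin (product_topology (\<lambda>_. euclidean) UNIV) U" using assms(1) by (simp add: open_fun_def)
  then obtain V where V: "finite {i \<in> UNIV. V i \<noteq> topspace (euclidean :: bool topology)}"
      "x \<in> Pi\<^sub>E UNIV V" "Pi\<^sub>E UNIV V \<subseteq> U"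
    using assms(2) unfolding openin_product_topology_alt by blast
  define I where "I = {i. V i \<noteq> UNIV}"
  have I: "finite I" using V(1) by (simp add: I_def)
  define K where "K = (\<Sum>i\<in>I. nat \<bar>i\<bar>)"
  have IK: "i \<in> {- int K..int K}" if "i \<in> I" for i
  proof -
    have "nat \<bar>i\<bar> \<le> K" unfolding K_def using that I by (intro member_le_sum[of i I "\<lambda>i. nat \<bar>i\<bar>"]) auto
    then show ?thesis by auto
  qed
  have "y \<in> U" if y: "\<forall>k\<in>{- int K..int K}. y k = x k" for y
  proof -
    have "y i \<in> V i" for i
    proof (cases "i \<in> I")
      case True
      have "y i = x i" by (rule bspec[OF y IK[OF True]])
      then show ?thesis using PiE_mem[OF V(2) UNIV_I, of i] by simp
    qed (simp add: I_def)
    then have "y \<in> Pi\<^sub>E UNIV V" by (auto simp: PiE_iff)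
    then show ?thesis using V(3) by blast
  qed
  then show thesis using that by blast
qed

lemma mem_closure_bool_iff:
  fixes x :: "int \<Rightarrow> bool"
  shows "x \<in> closure Y \<longleftrightarrow> (\<forall>K. \<exists>y\<in>Y. \<forall>k\<in>{- int K..int K}. y k = x k)"
proof
  assume x: "x \<in> closure Y"
  show "\<forall>K. \<exists>y\<in>Y. \<forall>k\<in>{- int K..int K}. y k = x k"
  proof
    fix K
    have "{y. \<forall>k\<in>{- int K..int K}. y k = x k} \<inter> closure Y \<noteq> {}" using x by auto
    then have "{y. \<forall>k\<in>{- int K..int K}. y k = x k} \<inter> Y \<noteq> {}"
      using open_Int_closure_eq_empty[OF open_bool_cylinder] by blast
    then show "\<exists>y\<in>Y. \<forall>k\<in>{- int K..int K}. y k = x k" by blast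
  qed
next
  assume ap: "\<forall>K. \<exists>y\<in>Y. \<forall>k\<in>{- int K..int K}. y k = x k"
  show "x \<in> closure Y"
  proof (rule ccontr)
    assume "x \<notin> closure Y"
    then have "open (- closure Y)" "x \<in> - closure Y" by (simp_all add: open_Compl)
    then obtain K where "{y. \<forall>k\<in>{- int K..int K}. y k = x k} \<subseteq> - closure Y"
      by (rule open_bool_contains_cylinder)
    moreover obtain y where "y \<in> Y" "\<forall>k\<in>{- int K..int K}. y k = x k" using ap by blast
    ultimately show False using closure_subset[of Y] by blast
  qed
qed

lemma closed_topological_support: "closed (topological_support \<nu>)"
proof -
  have "- topological_support \<nu> = \<Union>{U. open U \<and> emeasure \<nu> U = 0}"
    by (auto simp: topological_support_def not_gr_zero)
  then have "open (- topological_support \<nu>)" by (simp add: open_Union)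
  then show ?thesis by (simp add: closed_def)
qed

section \<open>Haar measure and patterns\<close>

lemma diag_mult: "diag B n \<otimes>\<^bsub>prodG B\<^esub> x = (\<lambda>b\<in>B. (x b + n) mod int b)"
  by (auto simp: prodG_def product_group_def diag_def fun_eq_iff mod_add_left_eq mod_add_right_eq add.commute)

context
  fixes B :: "nat set" and m :: "(nat \<Rightarrow> int) measure"
  assumes B: "0 \<notin> B" and m: "normalised_haar B m"
begin

lemma space_haar: "space m = H B"
  using m by (simp add: normalised_haar_def)

lemma openin_sets_haar: "openin (HT B) U \<Longrightarrow> U \<in> sets m"
  using m by (auto simp: normalised_haar_def)

lemma haar_depends_on_sets:
  assumes "finite F" "F \<subseteq> B" "depends_on F P"
  shows "{h \<in> H B. P h} \<in> sets m"
  by (rule openin_sets_haar[OF openin_depends_on[OF assms]])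

lemma finite_measure_haar: "finite_measure m"
  using m by (intro finite_measureI) (auto simp: normalised_haar_def)

text \<open>
  Translation by \<open>diag B n\<close> carries one cylinder to the other, so invariance applies.
\<close>
lemma haar_cylinder_translate:
  assumes F: "finite F" "F \<subseteq> B"
  shows "emeasure m {h \<in> H B. \<forall>b\<in>F. h b = n mod int b} = emeasure m {h \<in> H B. \<forall>b\<in>F. h b = 0}"
proof -
  let ?A = "{h \<in> H B. \<forall>b\<in>F. h b = 0}"
  have A: "?A \<in> sets m" by (rule haar_depends_on_sets[OF F]) (simp add: depends_on_def)
  have "(\<lambda>x. diag B n \<otimes>\<^bsub>prodG B\<^esub> x) ` ?A = {h \<in> H B. \<forall>b\<in>F. h b = n mod int b}"
  proof (intro equalityI subsetI)
    fix y assume "y \<in> (\<lambda>x. diag B n \<otimes>\<^bsub>prodG B\<^esub> x) ` ?A"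
    then obtain x where x: "x \<in> ?A" "y = x \<otimes>\<^bsub>prodG B\<^esub> diag B n" by (auto simp: diag_mult mult_diag)
    have "y \<in> H B" using x mult_diag_in_H[OF B] by simp
    then show "y \<in> {h \<in> H B. \<forall>b\<in>F. h b = n mod int b}" using x F(2) by (auto simp: mult_diag)
  next
    fix y assume y: "y \<in> {h \<in> H B. \<forall>b\<in>F. h b = n mod int b}"
    define x where "x = y \<otimes>\<^bsub>prodG B\<^esub> diag B (- n)"
    have "x \<in> H B" unfolding x_def using y mult_diag_in_H[OF B] by simp
    moreover have "x b = 0" if "b \<in> F" for b
    proof -
      have "y b = n mod int b" using y that by blast
      then have "x b = (n mod int b + - n) mod int b" using that F(2) by (auto simp: x_def mult_diag)
      also have "\<dots> = 0" by (simp add: mod_diff_left_eq)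
      finally show ?thesis .
    qed
    moreover have "diag B n \<otimes>\<^bsub>prodG B\<^esub> x = y"
    proof
      fix b
      show "(diag B n \<otimes>\<^bsub>prodG B\<^esub> x) b = y b"
      proof (cases "b \<in> B")
        case True
        then obtain k where k: "y b = k mod int b" using H_rep[OF B, of y "{b}"] y by auto
        have "((y b + - n) mod int b + n) mod int b = y b mod int b" by (simp add: mod_add_left_eq)
        also have "\<dots> = y b" by (simp add: k)
        finally show ?thesis using True by (simp add: diag_mult x_def mult_diag)
      next
        case False
        have "y \<in> extensional B" using y mem_H[OF B] by blast
        then show ?thesis using False by (simp add: diag_mult extensional_def)
      qed
    qed
    ultimately show "y \<in> (\<lambda>x. diag B n \<otimes>\<^bsub>prodG B\<^esub> x) ` ?A" by (intro image_eqI[of _ _ x]) auto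
  qed
  moreover have "emeasure m ((\<lambda>x. diag B n \<otimes>\<^bsub>prodG B\<^esub> x) ` ?A) = emeasure m ?A"
    using m A diag_in_H[OF B, of n] unfolding normalised_haar_def by blast
  ultimately show ?thesis by simp
qed

text \<open>
  The integers modulo \<open>Lcm F\<close> index a partition of \<open>H\<close> into cylinders over \<open>F\<close>, all of the same
  measure; both sides count those on which \<open>P\<close> holds.
\<close>
lemma haar_depends_on:
  assumes F: "finite F" "F \<subseteq> B" and P: "depends_on F P"
  shows "periodic {n. P (diag B n)}" "emeasure m {h \<in> H B. P h} = ennreal (dens {n. P (diag B n)})"
proof -
  interpret finite_measure m by (rule finite_measure_haar)
  define L where "L = int (Lcm F)"
  have "0 \<notin> F" using F(2) B by blast
  then have L: "L > 0" using Lcm_pos[OF F(1)] by (simp add: L_def)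
  define Cyl where "Cyl = (\<lambda>n. {h \<in> H B. \<forall>b\<in>F. h b = n mod int b})"
  have CylS: "Cyl n \<in> sets m" for n unfolding Cyl_def
    by (rule haar_depends_on_sets[OF F]) (simp add: depends_on_def)
  define c where "c = measure m (Cyl 0)"
  have cyl: "emeasure m (Cyl n) = ennreal c" for n
  proof -
    have "emeasure m (Cyl n) = emeasure m (Cyl 0)" by (simp add: Cyl_def haar_cylinder_translate[OF F])
    then show ?thesis by (simp add: c_def emeasure_eq_measure)
  qed
  have same: "n mod int b = n' mod int b" if "L dvd n - n'" "b \<in> F" for n n' b
    using that unfolding L_def int_Lcm_dvd_iff by (simp add: mod_eq_dvd_iff)
  have disj: "disjoint_family_on Cyl I" if I: "I \<subseteq> {0..<L}" for I
    unfolding disjoint_family_on_def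
  proof (intro ballI impI)
    fix n n' assume n: "n \<in> I" "n' \<in> I" "n \<noteq> n'"
    show "Cyl n \<inter> Cyl n' = {}"
    proof (rule ccontr)
      assume "Cyl n \<inter> Cyl n' \<noteq> {}"
      then have "n mod int b = n' mod int b" if "b \<in> F" for b using that by (auto simp: Cyl_def)
      then have "L dvd n - n'" unfolding L_def int_Lcm_dvd_iff by (simp add: mod_eq_dvd_iff)
      then have "n mod L = n' mod L" by (simp add: mod_eq_dvd_iff)
      then show False using n I by (auto simp: subset_iff)
    qed
  qed
  have sum: "emeasure m (\<Union>n\<in>I. Cyl n) = ennreal (real (card I) * c)" if I: "I \<subseteq> {0..<L}" for I
  proof -
    have "finite I" by (rule finite_subset[OF I]) simp
    then have "emeasure m (\<Union>n\<in>I. Cyl n) = (\<Sum>n\<in>I. emeasure m (Cyl n))"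
      by (intro sum_emeasure[symmetric] disj I) (use CylS in auto)
    also have "\<dots> = ennreal (real (card I) * c)"
      by (simp add: cyl c_def ennreal_mult ennreal_of_nat_eq_real_of_nat)
    finally show ?thesis .
  qed
  have rep: "\<exists>n\<in>{0..<L}. h \<in> Cyl n" if h: "h \<in> H B" for h
  proof -
    obtain n where n: "\<And>b. b \<in> F \<Longrightarrow> h b = n mod int b" using H_rep[OF B h F] by blast
    have "n mod int b = (n mod L) mod int b" if "b \<in> F" for b
      by (rule same[OF _ that]) (simp add: mod_eq_dvd_iff[symmetric])
    then have "h \<in> Cyl (n mod L)" using n h by (simp add: Cyl_def)
    moreover have "n mod L \<in> {0..<L}" using L by simp
    ultimately show ?thesis by blast
  qed
  have "(\<Union>n\<in>{0..<L}. Cyl n) = H B" using rep by (auto simp: Cyl_def)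
  then have "ennreal (real (card {0..<L}) * c) = 1"
    using sum[of "{0..<L}"] m by (simp add: normalised_haar_def)
  then have c: "c = 1 / of_int L" using L by (simp add: field_simps)
  have Pdiag: "P h \<longleftrightarrow> P (diag B n)" if "h \<in> Cyl n" for h n
  proof -
    have "\<forall>b\<in>F. h b = diag B n b" using that F(2) by (auto simp: Cyl_def diag_def)
    then show ?thesis using P unfolding depends_on_def by blast
  qed
  have per: "periodic_mod L {n. P (diag B n)}"
  proof (rule periodic_modI[OF L])
    fix n n' assume n: "L dvd n - n'" "n \<in> {n. P (diag B n)}"
    have "\<forall>b\<in>F. diag B n b = diag B n' b" using same[OF n(1)] by (auto simp: diag_def)
    then show "n' \<in> {n. P (diag B n)}" using P n(2) unfolding depends_on_def by blast
  qed
  then show "periodic {n. P (diag B n)}" by (rule periodic_mod_imp_periodic)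
  have "{h \<in> H B. P h} = (\<Union>n\<in>{n. P (diag B n)} \<inter> {0..<L}. Cyl n)"
    using rep Pdiag by (auto simp: Cyl_def) blast+
  then have "emeasure m {h \<in> H B. P h} = ennreal (real (card ({n. P (diag B n)} \<inter> {0..<L})) * c)"
    using sum[of "{n. P (diag B n)} \<inter> {0..<L}"] by simp
  then show "emeasure m {h \<in> H B. P h} = ennreal (dens {n. P (diag B n)})"
    unfolding dens_eq[OF per] c by simp
qed

definition hits_upto :: "int set \<Rightarrow> nat \<Rightarrow> (nat \<Rightarrow> int) \<Rightarrow> bool" where
  "hits_upto T i h \<longleftrightarrow> (\<forall>k\<in>T. \<exists>b\<in>B. b \<le> i \<and> int b dvd h b + k)"

definition free_upto :: "int set \<Rightarrow> nat \<Rightarrow> (nat \<Rightarrow> int) \<Rightarrow> bool" where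
  "free_upto S j h \<longleftrightarrow> (\<forall>k\<in>S. \<forall>b\<in>B. b \<le> j \<longrightarrow> \<not> int b dvd h b + k)"

lemma hits_free_depends: "depends_on {b \<in> B. b \<le> max i j} (\<lambda>h. hits_upto T i h \<and> free_upto S j h)"
  unfolding depends_on_def
proof (intro allI impI)
  fix u v :: "nat \<Rightarrow> int" assume "\<forall>b\<in>{b \<in> B. b \<le> max i j}. u b = v b"
  then have uv: "b \<in> B \<Longrightarrow> b \<le> i \<Longrightarrow> u b = v b" "b \<in> B \<Longrightarrow> b \<le> j \<Longrightarrow> u b = v b" for b by auto
  have "hits_upto T i u = hits_upto T i v" unfolding hits_upto_def using uv(1) by (intro ball_cong bex_cong refl) auto
  moreover have "free_upto S j u = free_upto S j v" unfolding free_upto_def using uv(2) by (intro ball_cong refl) auto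
  ultimately show "(hits_upto T i u \<and> free_upto S j u) = (hits_upto T i v \<and> free_upto S j v)" by simp
qed

lemma hits_free_diag:
  "{n. hits_upto T i (diag B n) \<and> free_upto S j (diag B n)}
    = {n. hits_upto T i (diag B n)} - (\<Union>k\<in>S. {n. n + k \<in> multiples {b \<in> B. b \<le> j}})"
  by (auto simp: free_upto_def mem_multiples diag_def)

lemma hits_upto_diag: "hits_upto T i (diag B n) \<longleftrightarrow> (\<forall>k\<in>T. n + k \<in> multiples {b \<in> B. b \<le> i})"
  unfolding hits_upto_def mem_multiples by (auto simp: diag_def)

text \<open>
  Bounding the witnesses of \<open>T\<close> by \<open>i\<close> makes the condition on \<open>T\<close> depend on finitely many
  coordinates, so that only the condition on \<open>S\<close> has to be approximated.
\<close>
definition pattern_set :: "int set \<Rightarrow> int set \<Rightarrow> nat \<Rightarrow> (nat \<Rightarrow> int) set" where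
  "pattern_set T S i = {h \<in> H B. hits_upto T i h \<and> (\<forall>j. free_upto S j h)}"

lemma emeasure_pattern_set:
  shows "pattern_set T S i \<in> sets m"
    and "emeasure m (pattern_set T S i) = (INF j. ennreal (dens {n. hits_upto T i (diag B n) \<and> free_upto S j (diag B n)}))"
proof -
  interpret finite_measure m by (rule finite_measure_haar)
  define A where "A = (\<lambda>j. {h \<in> H B. hits_upto T i h \<and> free_upto S j h})"
  have fin: "finite {b \<in> B. b \<le> max i j}" "{b \<in> B. b \<le> max i j} \<subseteq> B" for j
    by (auto intro: finite_subset[of _ "{..max i j}"])
  have A: "A j \<in> sets m" "emeasure m (A j) = ennreal (dens {n. hits_upto T i (diag B n) \<and> free_upto S j (diag B n)})" for j
    unfolding A_def
    using haar_depends_on_sets[OF fin hits_free_depends] haar_depends_on(2)[OF fin hits_free_depends] by auto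
  have eq: "pattern_set T S i = (\<Inter>j. A j)" by (auto simp: pattern_set_def A_def)
  show "pattern_set T S i \<in> sets m" unfolding eq using A(1) by (intro sets.countable_INT) auto
  have "decseq A" unfolding decseq_def A_def free_upto_def by (auto intro: order_trans)
  then have "(INF j. emeasure m (A j)) = emeasure m (\<Inter>j. A j)"
    using A(1) by (intro INF_emeasure_decseq) (auto simp: emeasure_eq_measure)
  then show "emeasure m (pattern_set T S i) = (INF j. ennreal (dens {n. hits_upto T i (diag B n) \<and> free_upto S j (diag B n)}))"
    by (simp add: eq A(2))
qed

text \<open>
  Some \<open>pattern_set T S i\<close> already has positive measure, which bounds the density of all its periodic
  approximations from below; \<open>ex_free_shift\<close> then finds an integer that satisfies the limit condition.
\<close>
lemma positive_pattern_realised: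
  assumes fin: "finite T" "finite S"
    and pos: "emeasure m {h \<in> H B. (\<forall>k\<in>T. \<exists>b\<in>B. int b dvd h b + k) \<and> (\<forall>k\<in>S. \<forall>b\<in>B. \<not> int b dvd h b + k)} > 0"
  shows "\<exists>n. (\<forall>k\<in>T. n + k \<in> multiples B) \<and> (\<forall>k\<in>S. n + k \<notin> multiples B)"
proof -
  interpret finite_measure m by (rule finite_measure_haar)
  have "{h \<in> H B. (\<forall>k\<in>T. \<exists>b\<in>B. int b dvd h b + k) \<and> (\<forall>k\<in>S. \<forall>b\<in>B. \<not> int b dvd h b + k)}
      \<subseteq> (\<Union>i. pattern_set T S i)"
  proof
    fix h assume h: "h \<in> {h \<in> H B. (\<forall>k\<in>T. \<exists>b\<in>B. int b dvd h b + k) \<and> (\<forall>k\<in>S. \<forall>b\<in>B. \<not> int b dvd h b + k)}"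
    then have "\<forall>k\<in>T. \<exists>b. b \<in> B \<and> int b dvd h b + k" by blast
    from bchoice[OF this] obtain f where f: "\<forall>k\<in>T. f k \<in> B \<and> int (f k) dvd h (f k) + k" ..
    have "f k \<le> (\<Sum>k\<in>T. f k)" if "k \<in> T" for k using fin(1) that by (intro member_le_sum) auto
    then have "hits_upto T (\<Sum>k\<in>T. f k) h" unfolding hits_upto_def using f by blast
    then show "h \<in> (\<Union>i. pattern_set T S i)" using h by (auto simp: pattern_set_def free_upto_def)
  qed
  then have "emeasure m (\<Union>i. pattern_set T S i) > 0"
    using pos emeasure_mono[of _ "\<Union>i. pattern_set T S i" m] emeasure_pattern_set(1)
    by (meson less_le_trans sets.countable_nat_UN image_subset_iff)
  then have "\<exists>i. emeasure m (pattern_set T S i) \<noteq> 0"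
    using emeasure_UN_eq_0[of m "pattern_set T S"] emeasure_pattern_set(1) by force
  then obtain i where i: "emeasure m (pattern_set T S i) \<noteq> 0" by blast
  define c where "c = measure m (pattern_set T S i)"
  have c: "c > 0" using i by (simp add: c_def emeasure_eq_measure zero_less_measure_iff measure_nonneg less_le)
  let ?V = "{n. hits_upto T i (diag B n)}"
  have Vper: "periodic ?V"
  proof -
    have "?V = (\<Inter>k\<in>T. {n. n + k \<in> multiples {b \<in> B. b \<le> i}})" by (auto simp: hits_upto_diag)
    then show ?thesis using B
      by (auto intro!: periodic_INTER[OF fin(1)] periodic_shift periodic_multiples(2) intro: finite_subset[of _ "{..i}"])
  qed
  have "\<exists>n\<in>?V. \<forall>k\<in>S. n + k \<notin> multiples B"
  proof (rule ex_free_shift[OF B Vper fin(2) c])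
    fix F assume F: "finite F" "F \<subseteq> B"
    define j where "j = \<Sum>F"
    have "f \<le> j" if "f \<in> F" for f unfolding j_def using member_le_sum[of f F "\<lambda>x. x"] that F(1) by simp
    then have Fj: "F \<subseteq> {b \<in> B. b \<le> j}" using F(2) by blast
    have perF: "periodic (multiples F)" "periodic (multiples {b \<in> B. b \<le> j})"
      using F B by (auto intro!: periodic_multiples(2) intro: finite_subset[of _ "{..j}"])
    let ?X = "{n. hits_upto T i (diag B n) \<and> free_upto S j (diag B n)}"
    have pX: "periodic ?X" unfolding hits_free_diag
      by (intro periodic_Diff Vper periodic_UNION fin periodic_shift perF)
    have "ennreal c = emeasure m (pattern_set T S i)" by (simp add: c_def emeasure_eq_measure)
    also have "\<dots> \<le> ennreal (dens ?X)" unfolding emeasure_pattern_set(2) by (rule INF_lower) simp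
    finally have "c \<le> dens ?X" using dens_nonneg[OF pX] by simp
    also have "\<dots> \<le> dens (?V - (\<Union>k\<in>S. {n. n + k \<in> multiples F}))"
    proof (rule dens_mono[OF pX])
      show "periodic (?V - (\<Union>k\<in>S. {n. n + k \<in> multiples F}))"
        by (intro periodic_Diff Vper periodic_UNION fin periodic_shift perF)
      show "?X \<subseteq> ?V - (\<Union>k\<in>S. {n. n + k \<in> multiples F})"
        unfolding hits_free_diag using multiples_mono[OF Fj] by blast
    qed
    finally show "c \<le> dens (?V - (\<Union>k\<in>S. {n. n + k \<in> multiples F}))" .
  qed
  then obtain n where n: "\<forall>k\<in>T. n + k \<in> multiples {b \<in> B. b \<le> i}" "\<forall>k\<in>S. n + k \<notin> multiples B"
    by (auto simp: hits_upto_diag)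
  moreover have "multiples {b \<in> B. b \<le> i} \<subseteq> multiples B" by (rule multiples_mono) auto
  ultimately show ?thesis by blast
qed

text \<open>
  The reverse passage: \<open>taut_pattern_density\<close> bounds the density of the periodic approximations from
  below, hence also their limit, the measure of the pattern. The residue class of \<open>h\<close> modulo the
  witnesses keeps the positions in \<open>T\<close> hit.
\<close>
lemma taut_pattern_positive:
  assumes taut: "taut B" and h: "h \<in> H B"
    and T: "finite T" "\<And>k. k \<in> T \<Longrightarrow> \<exists>b\<in>B. int b dvd h b + k"
    and S: "S \<subseteq> {- int K..int K}" "\<And>k b. k \<in> S \<Longrightarrow> b \<in> B \<Longrightarrow> \<not> int b dvd h b + k"
  obtains i where "emeasure m (pattern_set T S i) > 0"
proof -
  have fS: "finite S" by (rule finite_subset[OF S(1)]) simp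
  have "\<forall>k\<in>T. \<exists>b. b \<in> B \<and> int b dvd h b + k" using T(2) by blast
  from bchoice[OF this] obtain f where f: "\<forall>k\<in>T. f k \<in> B \<and> int (f k) dvd h (f k) + k" ..
  define i where "i = (\<Sum>k\<in>T. f k)"
  have fi: "f k \<le> i" if "k \<in> T" for k unfolding i_def using T(1) that by (intro member_le_sum) auto
  define F0 where "F0 = {b \<in> B. b \<le> i}"
  have F0: "finite F0" "F0 \<subseteq> B" "0 \<notin> F0" using B by (auto simp: F0_def intro: finite_subset[of _ "{..i}"])
  define q0 where "q0 = int (Lcm F0)"
  have q0: "q0 > 0" using Lcm_pos[OF F0(1,3)] by (simp add: q0_def)
  obtain n0 where n0: "\<And>b. b \<in> F0 \<Longrightarrow> h b = n0 mod int b" using H_rep[OF B h F0(1,2)] by blast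
  have "\<exists>c>0. \<forall>F. finite F \<longrightarrow> F \<subseteq> B \<longrightarrow>
      c \<le> dens ({n. q0 dvd n - n0} - (\<Union>k\<in>S. {n. n + k \<in> multiples F}))"
  proof (rule taut_pattern_density[OF B taut S(1) q0])
    fix Q :: int assume Q: "Q > 0"
    define F where "F = F0 \<union> {b \<in> B. int b dvd Q}"
    have "{b \<in> B. int b dvd Q} \<subseteq> {..nat Q}" using Q by (auto dest: zdvd_imp_le)
    then have F: "finite F" "F \<subseteq> B" using F0 by (auto simp: F_def intro: finite_subset)
    obtain z where z: "\<And>b. b \<in> F \<Longrightarrow> h b = z mod int b" using H_rep[OF B h F] by blast
    have "q0 dvd z - n0" unfolding q0_def int_Lcm_dvd_iff
    proof
      fix b assume b: "b \<in> F0"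
      then have "z mod int b = n0 mod int b" using n0[OF b] z[of b] by (simp add: F_def)
      then show "int b dvd z - n0" by (simp add: mod_eq_dvd_iff)
    qed
    moreover have "\<not> int b dvd z + k" if "b \<in> B" "int b dvd Q" "k \<in> S" for b k
      using S(2)[OF that(3,1)] z[of b] that by (simp add: F_def)
    ultimately show "\<exists>z. q0 dvd z - n0 \<and> (\<forall>b\<in>B. int b dvd Q \<longrightarrow> (\<forall>k\<in>S. \<not> int b dvd z + k))" by blast
  qed
  then obtain c where c: "c > 0" and ge: "\<And>F. finite F \<Longrightarrow> F \<subseteq> B \<Longrightarrow>
      c \<le> dens ({n. q0 dvd n - n0} - (\<Union>k\<in>S. {n. n + k \<in> multiples F}))" by blast
  have "ennreal c \<le> emeasure m (pattern_set T S i)"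
    unfolding emeasure_pattern_set(2)
  proof (rule INF_greatest)
    fix j
    let ?F = "{b \<in> B. b \<le> j}"
    let ?X = "{n. hits_upto T i (diag B n) \<and> free_upto S j (diag B n)}"
    have F: "finite ?F" "?F \<subseteq> B" by (auto intro: finite_subset[of _ "{..j}"])
    have perF: "periodic (multiples ?F)" using F B by (intro periodic_multiples(2)) auto
    have "finite {b \<in> B. b \<le> max i j}" by (rule finite_subset[of _ "{..max i j}"]) auto
    then have pX: "periodic ?X" by (intro haar_depends_on(1)[OF _ _ hits_free_depends]) auto
    have "{n. q0 dvd n - n0} \<subseteq> {n. hits_upto T i (diag B n)}"
    proof
      fix n assume "n \<in> {n. q0 dvd n - n0}"
      then have n: "int b dvd n - n0" if "b \<in> F0" for b
        using that unfolding q0_def int_Lcm_dvd_iff by blast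
      have "\<exists>b\<in>B. b \<le> i \<and> int b dvd diag B n b + k" if k: "k \<in> T" for k
      proof (intro bexI[of _ "f k"] conjI)
        have fk: "f k \<in> B" "int (f k) dvd h (f k) + k" using f k by auto
        then have fF: "f k \<in> F0" using fi[OF k] by (simp add: F0_def)
        have n0k: "int (f k) dvd n0 + k" using fk(2) n0[OF fF] by simp
        have "int (f k) dvd (n - n0) + (n0 + k)" by (rule dvd_add[OF n[OF fF] n0k])
        then show "int (f k) dvd diag B n (f k) + k" using fk(1) by (simp add: diag_def)
      qed (use f k fi in auto)
      then show "n \<in> {n. hits_upto T i (diag B n)}" by (simp add: hits_upto_def)
    qed
    then have "{n. q0 dvd n - n0} - (\<Union>k\<in>S. {n. n + k \<in> multiples ?F}) \<subseteq> ?X"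
      unfolding hits_free_diag by blast
    then have "dens ({n. q0 dvd n - n0} - (\<Union>k\<in>S. {n. n + k \<in> multiples ?F})) \<le> dens ?X"
      by (intro dens_mono pX periodic_Diff periodic_UNION fS periodic_shift perF
          periodic_mod_imp_periodic[OF periodic_mod_residue[OF q0]])
    then show "ennreal c \<le> ennreal (dens ?X)" using ge[OF F] by (intro ennreal_leI) linarith
  qed
  then have "emeasure m (pattern_set T S i) > 0" using c by (metis ennreal_less_zero_iff less_le_trans)
  then show thesis by (rule that)
qed

section \<open>The Mirsky measure and the orbit closures\<close>

lemma sets_coding_coordinate: "{h \<in> H B. coding B (window B) h k} \<in> sets m"
proof -
  have "{h \<in> H B. \<forall>b\<in>B. \<not> int b dvd h b + k} \<in> sets m"
  proof -
    have "{h \<in> space m. b \<in> B \<longrightarrow> \<not> int b dvd h b + k} \<in> sets m" for b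
    proof (cases "b \<in> B")
      case True
      then have "{h \<in> H B. \<not> int b dvd h b + k} \<in> sets m"
        by (intro haar_depends_on_sets[of "{b}"]) (auto simp: depends_on_def)
      then show ?thesis using True by (simp add: space_haar)
    qed simp
    then have "{h \<in> space m. \<forall>b. b \<in> B \<longrightarrow> \<not> int b dvd h b + k} \<in> sets m"
      by (rule sets.sets_Collect_countable_All)
    then have "{h \<in> space m. \<forall>b\<in>B. \<not> int b dvd h b + k} \<in> sets m" by (simp only: Ball_def)
    then show ?thesis by (simp add: space_haar)
  qed
  moreover have "{h \<in> H B. coding B (window B) h k} = {h \<in> H B. \<forall>b\<in>B. \<not> int b dvd h b + k}"
    using coding_window[OF B] by blast
  ultimately show ?thesis by simp
qed

lemma sets_coding_cylinder: "{h \<in> H B. \<forall>k\<in>{- int K..int K}. coding B (window B) h k = x k} \<in> sets m"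
proof -
  have "{h \<in> space m. coding B (window B) h k = x k} \<in> sets m" for k
  proof (cases "x k")
    case True
    then show ?thesis using sets_coding_coordinate by (simp add: space_haar)
  next
    case False
    have "space m - {h \<in> H B. coding B (window B) h k} \<in> sets m"
      by (rule sets.compl_sets[OF sets_coding_coordinate])
    moreover have "space m - {h \<in> H B. coding B (window B) h k} = {h \<in> space m. coding B (window B) h k = x k}"
      using False by (auto simp: space_haar)
    ultimately show ?thesis by simp
  qed
  then have "{h \<in> space m. \<forall>k\<in>{- int K..int K}. coding B (window B) h k = x k} \<in> sets m"
    by (intro sets.sets_Collect_finite_All) auto
  then show ?thesis by (simp add: space_haar)
qed

text \<open>
  Every open set of the shift space is a countable union of cylinders.
\<close>
lemma measurable_coding: "coding B (window B) \<in> borel_measurable m"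
proof (rule borel_measurableI)
  fix U :: "(int \<Rightarrow> bool) set" assume U: "open U"
  define cyl where "cyl = (\<lambda>(K::nat, A). {y. \<forall>k\<in>{- int K..int K}. y k = (k \<in> A)})"
  define I where "I = {(K::nat, A). finite A \<and> cyl (K, A) \<subseteq> U}"
  have "countable ((UNIV :: nat set) \<times> {A :: int set. finite A})"
    by (intro countable_SIGMA countable_Collect_finite) simp
  then have cI: "countable I" by (rule countable_subset[rotated]) (auto simp: I_def)
  have "U = (\<Union>p\<in>I. cyl p)"
  proof (intro equalityI subsetI)
    fix x assume "x \<in> U"
    then obtain K where K: "{y. \<forall>k\<in>{- int K..int K}. y k = x k} \<subseteq> U"
      using open_bool_contains_cylinder[OF U] by blast
    define A where "A = {k \<in> {- int K..int K}. x k}"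
    have "cyl (K, A) = {y. \<forall>k\<in>{- int K..int K}. y k = x k}" by (auto simp: cyl_def A_def)
    moreover have "finite A" by (rule finite_subset[of _ "{- int K..int K}"]) (auto simp: A_def)
    ultimately have "(K, A) \<in> I" "x \<in> cyl (K, A)" using K by (auto simp: I_def)
    then show "x \<in> (\<Union>p\<in>I. cyl p)" by blast
  qed (auto simp: I_def)
  then have "coding B (window B) -` U \<inter> space m = (\<Union>p\<in>I. coding B (window B) -` cyl p \<inter> space m)" by blast
  also have "\<dots> \<in> sets m"
  proof (rule sets.countable_UN''[OF cI])
    fix p assume "p \<in> I"
    obtain K A where p: "p = (K, A)" by (cases p)
    have "coding B (window B) -` cyl p \<inter> space m
        = {h \<in> H B. \<forall>k\<in>{- int K..int K}. coding B (window B) h k = (k \<in> A)}"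
      by (auto simp: p cyl_def space_haar)
    then show "coding B (window B) -` cyl p \<inter> space m \<in> sets m" using sets_coding_cylinder by simp
  qed
  finally show "coding B (window B) -` U \<inter> space m \<in> sets m" .
qed

lemma emeasure_mirsky_cylinder:
  "emeasure (mirsky B m) {y. \<forall>k\<in>{- int K..int K}. y k = x k}
    = emeasure m {h \<in> H B. \<forall>k\<in>{- int K..int K}. coding B (window B) h k = x k}"
proof -
  have "{y. \<forall>k\<in>{- int K..int K}. y k = x k} \<in> sets borel" by (rule borel_open[OF open_bool_cylinder])
  then have "emeasure (mirsky B m) {y. \<forall>k\<in>{- int K..int K}. y k = x k}
      = emeasure m (coding B (window B) -` {y. \<forall>k\<in>{- int K..int K}. y k = x k} \<inter> space m)"
    unfolding mirsky_def by (rule emeasure_distr[OF measurable_coding])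
  also have "coding B (window B) -` {y. \<forall>k\<in>{- int K..int K}. y k = x k} \<inter> space m
      = {h \<in> H B. \<forall>k\<in>{- int K..int K}. coding B (window B) h k = x k}" by (auto simp: space_haar)
  finally show ?thesis .
qed

lemma coding_cylinder_eq:
  "{h \<in> H B. \<forall>k\<in>{- int K..int K}. coding B (window B) h k = x k}
    = {h \<in> H B. (\<forall>k\<in>{k \<in> {- int K..int K}. \<not> x k}. \<exists>b\<in>B. int b dvd h b + k) \<and>
        (\<forall>k\<in>{k \<in> {- int K..int K}. x k}. \<forall>b\<in>B. \<not> int b dvd h b + k)}"
proof -
  have "(\<forall>k\<in>{- int K..int K}. coding B (window B) h k = x k)
      \<longleftrightarrow> (\<forall>k\<in>{k \<in> {- int K..int K}. \<not> x k}. \<exists>b\<in>B. int b dvd h b + k) \<and>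
        (\<forall>k\<in>{k \<in> {- int K..int K}. x k}. \<forall>b\<in>B. \<not> int b dvd h b + k)" if "h \<in> H B" for h
    unfolding coding_window[OF B that] by blast
  then show ?thesis by blast
qed

lemma support_subset_X_eta: "topological_support (mirsky B m) \<subseteq> X_eta B"
proof
  fix x assume x: "x \<in> topological_support (mirsky B m)"
  show "x \<in> X_eta B" unfolding X_eta_def mem_closure_bool_iff
  proof
    fix K
    have "emeasure (mirsky B m) {y. \<forall>k\<in>{- int K..int K}. y k = x k} > 0"
      using x open_bool_cylinder[of K x] unfolding topological_support_def by blast
    moreover have "finite {k \<in> {- int K..int K}. \<not> x k}" "finite {k \<in> {- int K..int K}. x k}"
      by (rule finite_subset[of _ "{- int K..int K}"]; auto)+
    ultimately obtain n where "\<forall>k\<in>{k \<in> {- int K..int K}. \<not> x k}. n + k \<in> multiples B"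
        "\<forall>k\<in>{k \<in> {- int K..int K}. x k}. n + k \<notin> multiples B"
      unfolding emeasure_mirsky_cylinder coding_cylinder_eq
      using positive_pattern_realised[of "{k \<in> {- int K..int K}. \<not> x k}" "{k \<in> {- int K..int K}. x k}"]
      by blast
    then have "\<forall>k\<in>{- int K..int K}. coding B (window B) (diag B n) k = x k"
      unfolding coding_window_diag[OF B] by blast
    then show "\<exists>y\<in>range (\<lambda>n. coding B (window B) (diag B n)). \<forall>k\<in>{- int K..int K}. y k = x k" by blast
  qed
qed

text \<open>
  Codes of points of \<open>H\<close> lie in the support because every finite pattern of such a code has positive
  measure, and the support is closed.
\<close>
lemma X_phi_subset_support:
  assumes "taut B"
  shows "X_phi B \<subseteq> topological_support (mirsky B m)"
  unfolding X_phi_def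
proof (rule closure_minimal[OF _ closed_topological_support], rule image_subsetI)
  fix h assume h: "h \<in> H B"
  let ?x = "coding B (window B) h"
  show "?x \<in> topological_support (mirsky B m)"
    unfolding topological_support_def
  proof (intro CollectI allI impI)
    fix U assume U: "open U" "?x \<in> U"
    obtain K where K: "{y. \<forall>k\<in>{- int K..int K}. y k = ?x k} \<subseteq> U"
      using open_bool_contains_cylinder[OF U] by blast
    let ?T = "{k \<in> {- int K..int K}. \<not> ?x k}" and ?S = "{k \<in> {- int K..int K}. ?x k}"
    have "finite ?T" by (rule finite_subset[of _ "{- int K..int K}"]) auto
    then obtain i where i: "emeasure m (pattern_set ?T ?S i) > 0"
      using taut_pattern_positive[OF assms h, of ?T ?S K] coding_window[OF B h] by blast
    have "pattern_set ?T ?S i \<subseteq> {h' \<in> H B. \<forall>k\<in>{- int K..int K}. coding B (window B) h' k = ?x k}"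
      unfolding coding_cylinder_eq pattern_set_def hits_upto_def free_upto_def by blast
    then have "emeasure m (pattern_set ?T ?S i)
        \<le> emeasure m {h' \<in> H B. \<forall>k\<in>{- int K..int K}. coding B (window B) h' k = ?x k}"
      by (rule emeasure_mono[OF _ sets_coding_cylinder])
    also have "\<dots> = emeasure (mirsky B m) {y. \<forall>k\<in>{- int K..int K}. y k = ?x k}"
      by (rule emeasure_mirsky_cylinder[symmetric])
    also have "\<dots> \<le> emeasure (mirsky B m) U"
      using K U by (intro emeasure_mono) (auto simp: mirsky_def)
    finally show "emeasure (mirsky B m) U > 0" using i by simp
  qed
qed

end

lemma X_eta_subset_X_phi: "0 \<notin> B \<Longrightarrow> X_eta B \<subseteq> X_phi B"
  unfolding X_eta_def X_phi_def by (intro closure_mono) (auto intro: diag_in_H)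

lemma X_phi_eq_closure_interval:
  assumes B: "0 \<notin> B"
  shows "X_phi B = closure (coding_interval B)"
proof
  have "coding B (window' B) h \<le> coding B (window B) h" for h
    using window'_subset[OF B] by (auto simp: coding_def le_fun_def)
  then have "coding B (window B) ` H B \<subseteq> coding_interval B"
    by (auto simp: coding_interval_def)
  then show "X_phi B \<subseteq> closure (coding_interval B)" unfolding X_phi_def by (rule closure_mono)
  have "coding_interval B \<subseteq> X_phi B"
  proof
    fix x assume "x \<in> coding_interval B"
    then obtain h where h: "h \<in> H B" "coding B (window' B) h \<le> x" "x \<le> coding B (window B) h"
      unfolding coding_interval_def by blast
    show "x \<in> X_phi B" unfolding X_phi_def mem_closure_bool_iff
      by (intro allI) (use interval_pattern_realised[OF B h] in blast)
  qed
  then show "closure (coding_interval B) \<subseteq> X_phi B"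
    by (rule closure_minimal) (simp add: X_phi_def)
qed

theorem corollary3:
  fixes B :: "nat set" and m\<^sub>H :: "(nat \<Rightarrow> int) measure"
  assumes "0 \<notin> B" and "B \<noteq> {}"
    and "normalised_haar B m\<^sub>H"
  shows "(primitive_set B \<longrightarrow>
            topological_support (mirsky B m\<^sub>H) \<subseteq> X_eta B \<and>
            X_eta B \<subseteq> X_phi B \<and>
            X_phi B = closure (coding_interval B))
       \<and> (taut B \<longrightarrow>
            topological_support (mirsky B m\<^sub>H) = X_eta B \<and>
            X_eta B = X_phi B \<and>
            X_phi B = closure (coding_interval B))"
proof -
  note subs = support_subset_X_eta[OF assms(1,3)] X_eta_subset_X_phi[OF assms(1)]
  show ?thesis
    using subs X_phi_subset_support[OF assms(1,3)] X_phi_eq_closure_interval[OF assms(1)] by blast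
qed

end
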